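(* A monad in $\mathbb D\mathbf{TDX}$, with underlying 2-transducer $(\mathcal Q,t):\mathcal A\rightsquigarrow\mathcal A$, unit $(\jmath,\eta)$ and multiplication $(\boxtimes,\mu)$, consists of a promonad on the category $\mathcal A^*$, so that each $t(\underline a;q,q')[\underline a']$ specifies a set of heteromorphisms, compatible with the morphisms in $\mathcal A^*$ (that is, with finite tuples of morphisms in $\mathcal A$). Furthermore, this promonad is graded over $\mathcal Q^{op}\times\mathcal Q$, where the state category $\mathcal Q$ carries the monoidal structure given by $(\boxtimes,\jmath)$ and $\mathcal Q^{op}\times\mathcal Q$ is equipped with the induced pointwise monoidal structure. Graded means that the composition of something of degree $(x,y)$ with something of degree $(x',y')$ is of degree $(x\boxtimes x',y\boxtimes y')$, in the following sense: writing $t(\underline u,\underline a)_{xy}$ for $t(\underline u;x,y)[\underline a]$, composition is given by the maps, forming a cowedge in $\underline a\in\mathcal A^*$, $$t(\underline u,\underline a)_{xy}\times t(\underline a,\underline v)_{x'y'}\longrightarrow t(\underline u,\underline v)_{x\boxtimes x',\,y\boxtimes y'}$$ to which $\mu$ corresponds.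
   Context: $\mathcal B^*$ is the free monoidal category on a small category $\mathcal B$: objects are finite lists $\underline b$ of objects, morphisms are finite tuples of morphisms of $\mathcal B$ between lists of the same length, the tensor is concatenation, the unit is the empty list. $\mathcal K\langle\mathcal B\rangle$ is the presheaf category $[(\mathcal B^* )^{op},\mathrm{Set}]$, monoidal under Day convolution. A 2-transducer $(\mathcal Q,t):\mathcal A\rightsquigarrow\mathcal B$ is a category $\mathcal Q$ (the state category) with a functor $t:\mathcal A\times\mathcal Q^{op}\times\mathcal Q\to\mathcal K\langle\mathcal B\rangle$; equivalently, by the universal property of $\mathcal A^*$, a strong monoidal functor from $\mathcal A^*$ to the category of $\mathcal K\langle\mathcal B\rangle$-enriched endoprofunctors of $\mathcal Q$ (monoidal under composition). Write $t(\underline a;q,q')[\underline b]$ for the values of the extension to $\mathcal A^*$. The composite of $(\mathcal Q,s):\mathcal A\rightsquigarrow\mathcal B$ and $(\mathcal P,t):\mathcal B\rightsquigarrow\mathcal C$ has state category the product of the state categories and is $(t\circ s)(\underline a;(p,q),(p',q'))[\underline c]=\int^{\underline b\in\mathcal B^*}s(\underline a;q,q')[\underline b]\times t(\underline b;p,p')[\underline c]$. The identity $\iota$ of $\mathcal A$ has terminal state category $\mathcal I$ and sends $\underline a$ to the representable presheaf $\mathcal A^*(-,\underline a)$. $\mathbb D\mathbf{TDX}$ is the double category with small categories as objects, functors as tight arrows, 2-transducers as loose arrows, and cells $(U,\alpha)$ from $(\mathcal Q,s):\mathcal A\rightsquigarrow\mathcal B$ to $(\mathcal P,t):\mathcal A'\rightsquigarrow\mathcal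 B'$ over $F:\mathcal A\to\mathcal A'$, $G:\mathcal B\to\mathcal B'$ given by a functor $U:\mathcal Q\to\mathcal P$ and a natural transformation $s(a;q,q')[\underline b]\to t(Fa;Uq,Uq')[G^*\underline b]$, where $G^*:\mathcal B^*\to\mathcal B'^*$ applies $G$ letterwise. A 2-cell is a cell over identity functors. A monad in $\mathbb D\mathbf{TDX}$ consists of a small category $\mathcal A$; a 2-transducer $(\mathcal Q,t):\mathcal A\rightsquigarrow\mathcal A$; a unit 2-cell $(\jmath,\eta):\iota\Rightarrow t$, where $\jmath:\mathcal I\to\mathcal Q$ picks an object of $\mathcal Q$ and $\eta:\mathcal A^*(-,\underline a)\Rightarrow t(\underline a;\jmath,\jmath)$ is natural; and a multiplication 2-cell $(\boxtimes,\mu):t\circ t\Rightarrow t$, where $\boxtimes:\mathcal Q\times\mathcal Q\to\mathcal Q$ is a functor and $\mu$ has components $\int^{\underline a}t(\underline u;x,y)[\underline a]\times t(\underline a;x',y')\Rightarrow t(\underline u;x\boxtimes x',y\boxtimes y')$. These are subject to unit and associativity axioms. Associativity says that the two composites $t(\underline u,\underline a)_{xy}\times t(\underline a,\underline v)_{x'y'}\times t(\underline v,\underline w)_{x''y''}\to t(\underline u,\underline w)_{x(x'x''),y(y'y'')}\cong t(\underline u,\underline w)_{(xx')x'',(yy')y''}$ agree (juxtaposition of states denotes $\boxtimes$); the unit laws say that $\mu$ pasted with $\eta$ on either side is the identity 2-cell of $t$. The pointwise monoidal structure on $\mathcal Q^{op}\times\mathcal Q$ is $(x,y)\boxtimes(x',y')=(x\boxtimes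 x',y\boxtimes y')$. *)

theory Defs
  imports Main
begin

section \<open>Small categories, functors, set-valued functors\<close>

record ('o, 'm) cat =
  Ob :: "'o set"
  Ar :: "'m set"
  Dom :: "'m \<Rightarrow> 'o"
  Cod :: "'m \<Rightarrow> 'o"
  Ident :: "'o \<Rightarrow> 'm"
  Comp :: "'m \<Rightarrow> 'm \<Rightarrow> 'm"   (* Comp C g f is "g after f" *)

locale category =
  fixes C :: "('o, 'm) cat"
  assumes dom_ob: "f \<in> Ar C \<Longrightarrow> Dom C f \<in> Ob C"
    and cod_ob: "f \<in> Ar C \<Longrightarrow> Cod C f \<in> Ob C"
    and ident_ar: "a \<in> Ob C \<Longrightarrow> Ident C a \<in> Ar C"
    and dom_ident: "a \<in> Ob C \<Longrightarrow> Dom C (Ident C a) = a"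
    and cod_ident: "a \<in> Ob C \<Longrightarrow> Cod C (Ident C a) = a"
    and comp_ar: "\<lbrakk>f \<in> Ar C; g \<in> Ar C; Cod C f = Dom C g\<rbrakk> \<Longrightarrow> Comp C g f \<in> Ar C"
    and dom_comp: "\<lbrakk>f \<in> Ar C; g \<in> Ar C; Cod C f = Dom C g\<rbrakk> \<Longrightarrow> Dom C (Comp C g f) = Dom C f"
    and cod_comp: "\<lbrakk>f \<in> Ar C; g \<in> Ar C; Cod C f = Dom C g\<rbrakk> \<Longrightarrow> Cod C (Comp C g f) = Cod C g"
    and comp_ident_right: "f \<in> Ar C \<Longrightarrow> Comp C f (Ident C (Dom C f)) = f"
    and comp_ident_left: "f \<in> Ar C \<Longrightarrow> Comp C (Ident C (Cod C f)) f = f"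
    and comp_assoc: "\<lbrakk>f \<in> Ar C; g \<in> Ar C; h \<in> Ar C; Cod C f = Dom C g; Cod C g = Dom C h\<rbrakk>
       \<Longrightarrow> Comp C h (Comp C g f) = Comp C (Comp C h g) f"

definition hom :: "('o, 'm) cat \<Rightarrow> 'o \<Rightarrow> 'o \<Rightarrow> 'm set" where
  "hom C a b = {f \<in> Ar C. Dom C f = a \<and> Cod C f = b}"

definition opc :: "('o, 'm) cat \<Rightarrow> ('o, 'm) cat" where
  "opc C = \<lparr>Ob = Ob C, Ar = Ar C, Dom = Cod C, Cod = Dom C, Ident = Ident C,
            Comp = (\<lambda>g f. Comp C f g)\<rparr>"

definition prodc :: "('o, 'm) cat \<Rightarrow> ('p, 'n) cat \<Rightarrow> ('o \<times> 'p, 'm \<times> 'n) cat"  (infixr "\<times>\<^sub>c" 75) where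
  "C \<times>\<^sub>c D = \<lparr>Ob = Ob C \<times> Ob D, Ar = Ar C \<times> Ar D,
     Dom = map_prod (Dom C) (Dom D), Cod = map_prod (Cod C) (Cod D),
     Ident = map_prod (Ident C) (Ident D),
     Comp = (\<lambda>(g, g') (f, f'). (Comp C g f, Comp D g' f'))\<rparr>"

definition terminal_cat :: "(unit, unit) cat" where
  "terminal_cat = \<lparr>Ob = UNIV, Ar = UNIV, Dom = (\<lambda>_. ()), Cod = (\<lambda>_. ()), Ident = (\<lambda>_. ()),
     Comp = (\<lambda>_ _. ())\<rparr>"

text \<open>The free (strict) monoidal category \<open>C*\<close>; the tensor is \<open>@\<close> on objects and on morphisms,
  the unit is \<open>[]\<close>.\<close>

definition free_mon :: "('o, 'm) cat \<Rightarrow> ('o list, 'm list) cat" where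
  "free_mon C = \<lparr>Ob = lists (Ob C), Ar = lists (Ar C), Dom = map (Dom C), Cod = map (Cod C),
     Ident = map (Ident C), Comp = map2 (Comp C)\<rparr>"

record ('o, 'm, 'p, 'n) ftor =
  onOb :: "'o \<Rightarrow> 'p"
  onAr :: "'m \<Rightarrow> 'n"

definition is_functor :: "('o, 'm) cat \<Rightarrow> ('p, 'n) cat \<Rightarrow> ('o, 'm, 'p, 'n) ftor \<Rightarrow> bool" where
  "is_functor C D F \<longleftrightarrow>
     (\<forall>a \<in> Ob C. onOb F a \<in> Ob D) \<and>
     (\<forall>f \<in> Ar C. onAr F f \<in> Ar D \<and> Dom D (onAr F f) = onOb F (Dom C f) \<and>
        Cod D (onAr F f) = onOb F (Cod C f)) \<and>
     (\<forall>a \<in> Ob C. onAr F (Ident C a) = Ident D (onOb F a)) \<and>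
     (\<forall>f \<in> Ar C. \<forall>g \<in> Ar C. Cod C f = Dom C g \<longrightarrow>
        onAr F (Comp C g f) = Comp D (onAr F g) (onAr F f))"

text \<open>A functor is determined only by its values on the objects and arrows of its domain.\<close>

definition functor_eq :: "('o, 'm) cat \<Rightarrow> ('o, 'm, 'p, 'n) ftor \<Rightarrow> ('o, 'm, 'p, 'n) ftor \<Rightarrow> bool" where
  "functor_eq C F G \<longleftrightarrow> (\<forall>a \<in> Ob C. onOb F a = onOb G a) \<and> (\<forall>f \<in> Ar C. onAr F f = onAr G f)"

definition idF :: "('o, 'm, 'o, 'm) ftor" where
  "idF = \<lparr>onOb = (\<lambda>a. a), onAr = (\<lambda>f. f)\<rparr>"

definition compF :: "('p, 'n, 'r, 'k) ftor \<Rightarrow> ('o, 'm, 'p, 'n) ftor \<Rightarrow> ('o, 'm, 'r, 'k) ftor" where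
  "compF G F = \<lparr>onOb = (\<lambda>a. onOb G (onOb F a)), onAr = (\<lambda>f. onAr G (onAr F f))\<rparr>"

definition prodF :: "('o, 'm, 'p, 'n) ftor \<Rightarrow> ('o2, 'm2, 'p2, 'n2) ftor \<Rightarrow>
    ('o \<times> 'o2, 'm \<times> 'm2, 'p \<times> 'p2, 'n \<times> 'n2) ftor" where
  "prodF F G = \<lparr>onOb = map_prod (onOb F) (onOb G), onAr = map_prod (onAr F) (onAr G)\<rparr>"

definition starF :: "('o, 'm, 'p, 'n) ftor \<Rightarrow> ('o list, 'm list, 'p list, 'n list) ftor" where
  "starF F = \<lparr>onOb = map (onOb F), onAr = map (onAr F)\<rparr>"

record ('o, 'm, 'e) sfun =
  val :: "'o \<Rightarrow> 'e set"
  act :: "'m \<Rightarrow> 'e \<Rightarrow> 'e"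

definition set_functor :: "('o, 'm) cat \<Rightarrow> ('o, 'm, 'e) sfun \<Rightarrow> bool" where
  "set_functor C X \<longleftrightarrow>
     (\<forall>f \<in> Ar C. \<forall>x \<in> val X (Dom C f). act X f x \<in> val X (Cod C f)) \<and>
     (\<forall>a \<in> Ob C. \<forall>x \<in> val X a. act X (Ident C a) x = x) \<and>
     (\<forall>f \<in> Ar C. \<forall>g \<in> Ar C. Cod C f = Dom C g \<longrightarrow>
        (\<forall>x \<in> val X (Dom C f). act X (Comp C g f) x = act X g (act X f x)))"

definition nat_trans :: "('o, 'm) cat \<Rightarrow> ('o, 'm, 'e) sfun \<Rightarrow> ('o, 'm, 'f) sfun \<Rightarrow>
    ('o \<Rightarrow> 'e \<Rightarrow> 'f) \<Rightarrow> bool" where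
  "nat_trans C X Y \<alpha> \<longleftrightarrow>
     (\<forall>a \<in> Ob C. \<forall>x \<in> val X a. \<alpha> a x \<in> val Y a) \<and>
     (\<forall>f \<in> Ar C. \<forall>x \<in> val X (Dom C f). \<alpha> (Cod C f) (act X f x) = act Y f (\<alpha> (Dom C f) x))"

definition pullback :: "('o, 'm, 'p, 'n) ftor \<Rightarrow> ('p, 'n, 'e) sfun \<Rightarrow> ('o, 'm, 'e) sfun" where
  "pullback F X = \<lparr>val = (\<lambda>a. val X (onOb F a)), act = (\<lambda>f. act X (onAr F f))\<rparr>"


section \<open>Coends\<close>

text \<open>The coend of \<open>X : C\<^sup>o\<^sup>p \<times> C \<rightarrow> Set\<close> is the quotient of the disjoint union of the sets
  \<open>X(c,c)\<close> by the equivalence relation generated by \<open>X(f,1) x \<sim> X(1,f) x\<close> for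
  \<open>f : c \<rightarrow> c'\<close> and \<open>x \<in> X(c',c)\<close>.\<close>

definition coend_rel :: "('o, 'm) cat \<Rightarrow> ('o \<times> 'o, 'm \<times> 'm, 'e) sfun \<Rightarrow> (('o \<times> 'e) \<times> ('o \<times> 'e)) set" where
  "coend_rel C X =
     {((Dom C f, act X (f, Ident C (Dom C f)) x), (Cod C f, act X (Ident C (Cod C f), f) x)) | f x.
        f \<in> Ar C \<and> x \<in> val X (Cod C f, Dom C f)}"

definition coend_cls :: "('o, 'm) cat \<Rightarrow> ('o \<times> 'o, 'm \<times> 'm, 'e) sfun \<Rightarrow> 'o \<times> 'e \<Rightarrow> ('o \<times> 'e) set" where
  "coend_cls C X p = (coend_rel C X \<union> (coend_rel C X)\<inverse>)\<^sup>* `` {p}"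

definition coend :: "('o, 'm) cat \<Rightarrow> ('o \<times> 'o, 'm \<times> 'm, 'e) sfun \<Rightarrow> ('o \<times> 'e) set set" where
  "coend C X = coend_cls C X ` (SIGMA c : Ob C. val X (c, c))"

text \<open>The map into the coend of \<open>Y\<close> (over \<open>D\<close>) induced by a map of representatives.\<close>

definition coend_map :: "('p, 'n) cat \<Rightarrow> ('p \<times> 'p, 'n \<times> 'n, 'f) sfun \<Rightarrow> ('o \<times> 'e \<Rightarrow> 'p \<times> 'f) \<Rightarrow>
    ('o \<times> 'e) set \<Rightarrow> ('p \<times> 'f) set" where
  "coend_map D Y \<phi> K = (\<Union>p \<in> K. coend_cls D Y (\<phi> p))"

text \<open>The map out of a coend induced by a cowedge.\<close>

definition coend_desc :: "('o \<times> 'e \<Rightarrow> 'f) \<Rightarrow> ('o \<times> 'e) set \<Rightarrow> 'f" where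
  "coend_desc w K = the_elem (w ` K)"


section \<open>Day convolution and composition of enriched endoprofunctors\<close>

definition day_int :: "('b, 'bm) cat \<Rightarrow> ('b list, 'bm list, 'e) sfun \<Rightarrow> ('b list, 'bm list, 'f) sfun \<Rightarrow>
    'b list \<Rightarrow>
    (('b list \<times> 'b list) \<times> ('b list \<times> 'b list), ('bm list \<times> 'bm list) \<times> ('bm list \<times> 'bm list),
     'bm list \<times> 'e \<times> 'f) sfun" where
  "day_int B X Y b =
     \<lparr>val = (\<lambda>((b1, b2), (c1, c2)). hom (free_mon B) b (c1 @ c2) \<times> val X b1 \<times> val Y b2),
      act = (\<lambda>((f1, f2), (g1, g2)) (h, x, y). (Comp (free_mon B) (g1 @ g2) h, act X f1 x, act Y f2 y))\<rparr>"

definition day :: "('b, 'bm) cat \<Rightarrow> ('b list, 'bm list, 'e) sfun \<Rightarrow> ('b list, 'bm list, 'f) sfun \<Rightarrow>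
    ('b list, 'bm list, (('b list \<times> 'b list) \<times> 'bm list \<times> 'e \<times> 'f) set) sfun" where
  "day B X Y =
     \<lparr>val = (\<lambda>b. coend (free_mon B \<times>\<^sub>c free_mon B) (day_int B X Y b)),
      act = (\<lambda>k. coend_map (free_mon B \<times>\<^sub>c free_mon B) (day_int B X Y (Dom (free_mon B) k))
               (\<lambda>(c, h, x, y). (c, Comp (free_mon B) h k, x, y)))\<rparr>"

text \<open>An endoprofunctor of \<open>Q\<close> enriched in presheaves on \<open>B*\<close> is a functor
  \<open>Q\<^sup>o\<^sup>p \<times> Q \<times> (B*)\<^sup>o\<^sup>p \<rightarrow> Set\<close>; the composite of two of them at \<open>(q, q'')\<close> is the coend over the
  middle state of Day convolutions, computed pointwise at \<open>b\<close>.\<close>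

type_synonym ('q, 'qm, 'b, 'bm, 'e) eprof = "('q \<times> 'q \<times> 'b list, 'qm \<times> 'qm \<times> 'bm list, 'e) sfun"

definition eprof_at :: "('q, 'qm) cat \<Rightarrow> ('q, 'qm, 'b, 'bm, 'e) eprof \<Rightarrow> 'q \<Rightarrow> 'q \<Rightarrow>
    ('b list, 'bm list, 'e) sfun" where
  "eprof_at Q X q q' =
     \<lparr>val = (\<lambda>b. val X (q, q', b)), act = (\<lambda>g. act X (Ident Q q, Ident Q q', g))\<rparr>"

definition eprof_comp :: "('q, 'qm) cat \<Rightarrow> ('b, 'bm) cat \<Rightarrow> ('q, 'qm, 'b, 'bm, 'e) eprof \<Rightarrow>
    ('q, 'qm, 'b, 'bm, 'f) eprof \<Rightarrow> 'q \<Rightarrow> 'q \<Rightarrow> 'b list \<Rightarrow>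
    ('q \<times> (('b list \<times> 'b list) \<times> 'bm list \<times> 'e \<times> 'f) set) set set" where
  "eprof_comp Q B X Y q q'' b =
     coend Q
       \<lparr>val = (\<lambda>(r, s). val (day B (eprof_at Q X q s) (eprof_at Q Y r q'')) b),
        act = (\<lambda>(k, l). coend_map (free_mon B \<times>\<^sub>c free_mon B)
                 (day_int B (eprof_at Q X q (Cod Q l)) (eprof_at Q Y (Dom Q k) q'') b)
                 (\<lambda>((b1, b2), h, x, y).
                    ((b1, b2), h, act X (Ident Q q, l, Ident (free_mon B) b1) x,
                              act Y (k, Ident Q q'', Ident (free_mon B) b2) y)))\<rparr>"


section \<open>2-transducers\<close>

text \<open>A 2-transducer \<open>A \<leadsto> B\<close> with state category \<open>Q\<close> is given as a strong monoidal functor from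
  \<open>A*\<close> to enriched endoprofunctors of \<open>Q\<close>.
  The element \<open>e \<in> t(u; q, q')[b]\<close> lives in \<open>val (Het t) (u, q, q', b)\<close>, and \<open>Het t\<close> is a functor
  \<open>A* \<times> Q\<^sup>o\<^sup>p \<times> Q \<times> (B*)\<^sup>o\<^sup>p \<rightarrow> Set\<close>.
  By the universal property of coends the monoidal structure map
  \<open>t(u) \<circ> t(u') \<Rightarrow> t(u u')\<close> amounts to a family
  \<open>t(u; q, r)[b] \<times> t(u'; r, q'')[b'] \<rightarrow> t(u u'; q, q'')[b b']\<close>, which is
  \<open>Tens t (u, q, r, b) (u', r, q'', b')\<close>, and the unit
  \<open>Q(-,-) \<cdot> B*(-, []) \<Rightarrow> t([])\<close> to a family \<open>Q(q, q') \<rightarrow> t([]; q, q')[[]]\<close>, which is \<open>Unt t\<close>.\<close>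

record ('a, 'am, 'b, 'bm, 'q, 'qm, 'e) tdx =
  Src :: "('a, 'am) cat"
  Tgt :: "('b, 'bm) cat"
  St :: "('q, 'qm) cat"
  Het :: "('a list \<times> 'q \<times> 'q \<times> 'b list, 'am list \<times> 'qm \<times> 'qm \<times> 'bm list, 'e) sfun"
  Tens :: "'a list \<times> 'q \<times> 'q \<times> 'b list \<Rightarrow> 'a list \<times> 'q \<times> 'q \<times> 'b list \<Rightarrow> 'e \<Rightarrow> 'e \<Rightarrow> 'e"
  Unt :: "'qm \<Rightarrow> 'e"

definition shape :: "('a, 'am, 'b, 'bm, 'q, 'qm, 'e) tdx \<Rightarrow>
    ('a list \<times> 'q \<times> 'q \<times> 'b list, 'am list \<times> 'qm \<times> 'qm \<times> 'bm list) cat" where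
  "shape T = free_mon (Src T) \<times>\<^sub>c opc (St T) \<times>\<^sub>c St T \<times>\<^sub>c opc (free_mon (Tgt T))"

definition tdx_eprof :: "('a, 'am, 'b, 'bm, 'q, 'qm, 'e) tdx \<Rightarrow> 'a list \<Rightarrow> ('q, 'qm, 'b, 'bm, 'e) eprof" where
  "tdx_eprof T u =
     \<lparr>val = (\<lambda>(q, q', b). val (Het T) (u, q, q', b)),
      act = (\<lambda>(k, k', g). act (Het T) (Ident (free_mon (Src T)) u, k, k', g))\<rparr>"

text \<open>Elementwise form of a lax monoidal structure: typing, naturality, dinaturality in the middle
  state, naturality of the unit, and the associativity and unit coherence conditions.\<close>

definition lax_structure :: "('a, 'am, 'b, 'bm, 'q, 'qm, 'e) tdx \<Rightarrow> bool" where
  "lax_structure T \<longleftrightarrow>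
   (let A = free_mon (Src T); B = free_mon (Tgt T); Q = St T; X = Het T in
    (\<forall>u \<in> Ob A. \<forall>u' \<in> Ob A. \<forall>q \<in> Ob Q. \<forall>r \<in> Ob Q. \<forall>q'' \<in> Ob Q. \<forall>b \<in> Ob B. \<forall>b' \<in> Ob B.
       \<forall>e \<in> val X (u, q, r, b). \<forall>e' \<in> val X (u', r, q'', b').
         Tens T (u, q, r, b) (u', r, q'', b') e e' \<in> val X (u @ u', q, q'', b @ b')) \<and>
    (\<forall>f \<in> Ar A. \<forall>f' \<in> Ar A. \<forall>k \<in> Ar Q. \<forall>r \<in> Ob Q. \<forall>k'' \<in> Ar Q. \<forall>g \<in> Ar B. \<forall>g' \<in> Ar B.
       \<forall>e \<in> val X (Dom A f, Cod Q k, r, Cod B g). \<forall>e' \<in> val X (Dom A f', r, Dom Q k'', Cod B g').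
         Tens T (Cod A f, Dom Q k, r, Dom B g) (Cod A f', r, Cod Q k'', Dom B g')
            (act X (f, k, Ident Q r, g) e) (act X (f', Ident Q r, k'', g') e')
         = act X (f @ f', k, k'', g @ g')
            (Tens T (Dom A f, Cod Q k, r, Cod B g) (Dom A f', r, Dom Q k'', Cod B g') e e')) \<and>
    (\<forall>u \<in> Ob A. \<forall>u' \<in> Ob A. \<forall>q \<in> Ob Q. \<forall>h \<in> Ar Q. \<forall>q'' \<in> Ob Q. \<forall>b \<in> Ob B. \<forall>b' \<in> Ob B.
       \<forall>e \<in> val X (u, q, Dom Q h, b). \<forall>e' \<in> val X (u', Cod Q h, q'', b').
         Tens T (u, q, Cod Q h, b) (u', Cod Q h, q'', b')
            (act X (Ident A u, Ident Q q, h, Ident B b) e) e'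
         = Tens T (u, q, Dom Q h, b) (u', Dom Q h, q'', b')
            e (act X (Ident A u', h, Ident Q q'', Ident B b') e')) \<and>
    (\<forall>h \<in> Ar Q. Unt T h \<in> val X ([], Dom Q h, Cod Q h, [])) \<and>
    (\<forall>k \<in> Ar Q. \<forall>h \<in> Ar Q. \<forall>k' \<in> Ar Q. Cod Q k = Dom Q h \<and> Cod Q h = Dom Q k' \<longrightarrow>
         act X ([], k, k', []) (Unt T h) = Unt T (Comp Q k' (Comp Q h k))) \<and>
    (\<forall>u \<in> Ob A. \<forall>u' \<in> Ob A. \<forall>u'' \<in> Ob A. \<forall>q \<in> Ob Q. \<forall>r \<in> Ob Q. \<forall>s \<in> Ob Q. \<forall>q' \<in> Ob Q.
       \<forall>b \<in> Ob B. \<forall>b' \<in> Ob B. \<forall>b'' \<in> Ob B.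
       \<forall>e \<in> val X (u, q, r, b). \<forall>e' \<in> val X (u', r, s, b'). \<forall>e'' \<in> val X (u'', s, q', b'').
         Tens T (u @ u', q, s, b @ b') (u'', s, q', b'') (Tens T (u, q, r, b) (u', r, s, b') e e') e''
         = Tens T (u, q, r, b) (u' @ u'', r, q', b' @ b'') e (Tens T (u', r, s, b') (u'', s, q', b'') e' e'')) \<and>
    (\<forall>h \<in> Ar Q. \<forall>u \<in> Ob A. \<forall>q \<in> Ob Q. \<forall>b \<in> Ob B. \<forall>e \<in> val X (u, Cod Q h, q, b).
         Tens T ([], Dom Q h, Cod Q h, []) (u, Cod Q h, q, b) (Unt T h) e
         = act X (Ident A u, h, Ident Q q, Ident B b) e) \<and>
    (\<forall>h \<in> Ar Q. \<forall>u \<in> Ob A. \<forall>q \<in> Ob Q. \<forall>b \<in> Ob B. \<forall>e \<in> val X (u, q, Dom Q h, b).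
         Tens T (u, q, Dom Q h, b) ([], Dom Q h, Cod Q h, []) e (Unt T h)
         = act X (Ident A u, Ident Q q, h, Ident B b) e))"

text \<open>Strength: the induced maps out of the composite of enriched profunctors and out of the identity
  enriched profunctor are bijective.\<close>

definition strong_structure :: "('a, 'am, 'b, 'bm, 'q, 'qm, 'e) tdx \<Rightarrow> bool" where
  "strong_structure T \<longleftrightarrow>
   (let A = free_mon (Src T); B = free_mon (Tgt T); Q = St T; X = Het T in
    (\<forall>u \<in> Ob A. \<forall>u' \<in> Ob A. \<forall>q \<in> Ob Q. \<forall>q'' \<in> Ob Q. \<forall>b \<in> Ob B.
       bij_betw
         (coend_desc (\<lambda>(r, D). coend_desc (\<lambda>((b1, b2), h, e, e').
            act X (Ident A (u @ u'), Ident Q q, Ident Q q'', h)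
              (Tens T (u, q, r, b1) (u', r, q'', b2) e e')) D))
         (eprof_comp Q (Tgt T) (tdx_eprof T u) (tdx_eprof T u') q q'' b)
         (val X (u @ u', q, q'', b))) \<and>
    (\<forall>q \<in> Ob Q. \<forall>q' \<in> Ob Q. \<forall>b \<in> Ob B.
       bij_betw (\<lambda>(h, g). act X ([], Ident Q q, Ident Q q', g) (Unt T h))
         (hom Q q q' \<times> hom B b []) (val X ([], q, q', b))))"

definition transducer :: "('a, 'am) cat \<Rightarrow> ('b, 'bm) cat \<Rightarrow> ('a, 'am, 'b, 'bm, 'q, 'qm, 'e) tdx \<Rightarrow> bool" where
  "transducer A B T \<longleftrightarrow>
     Src T = A \<and> Tgt T = B \<and> category A \<and> category B \<and> category (St T) \<and>
     set_functor (shape T) (Het T) \<and> lax_structure T \<and> strong_structure T"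


subsection \<open>Identities and composites\<close>

definition iota :: "('a, 'am) cat \<Rightarrow> ('a, 'am, 'a, 'am, unit, unit, 'am list) tdx" where
  "iota A =
     \<lparr>Src = A, Tgt = A, St = terminal_cat,
      Het = \<lparr>val = (\<lambda>(u, _, _, a). hom (free_mon A) a u),
             act = (\<lambda>(f, _, _, g) e. Comp (free_mon A) f (Comp (free_mon A) e g))\<rparr>,
      Tens = (\<lambda>_ _ e e'. e @ e'),
      Unt = (\<lambda>_. [])\<rparr>"

text \<open>The integrand of the composite of \<open>S : A \<leadsto> B\<close> followed by \<open>T : B \<leadsto> C\<close>; states are pairs
  (state of \<open>S\<close>, state of \<open>T\<close>).\<close>

definition tcomp_int :: "('a, 'am, 'b, 'bm, 'q, 'qm, 'e) tdx \<Rightarrow> ('b, 'bm, 'c, 'cm, 'p, 'pm, 'f) tdx \<Rightarrow>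
    'a list \<times> ('q \<times> 'p) \<times> ('q \<times> 'p) \<times> 'c list \<Rightarrow>
    ('b list \<times> 'b list, 'bm list \<times> 'bm list, 'e \<times> 'f) sfun" where
  "tcomp_int S T = (\<lambda>(u, (q, p), (q', p'), c).
     \<lparr>val = (\<lambda>(b, b'). val (Het S) (u, q, q', b) \<times> val (Het T) (b', p, p', c)),
      act = (\<lambda>(g, g') (e, e').
        (act (Het S) (Ident (free_mon (Src S)) u, Ident (St S) q, Ident (St S) q', g) e,
         act (Het T) (g', Ident (St T) p, Ident (St T) p', Ident (free_mon (Tgt T)) c) e'))\<rparr>)"

abbreviation tcls :: "('a, 'am, 'b, 'bm, 'q, 'qm, 'e) tdx \<Rightarrow> ('b, 'bm, 'c, 'cm, 'p, 'pm, 'f) tdx \<Rightarrow>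
    'a list \<times> ('q \<times> 'p) \<times> ('q \<times> 'p) \<times> 'c list \<Rightarrow> 'b list \<times> 'e \<times> 'f \<Rightarrow> ('b list \<times> 'e \<times> 'f) set" where
  "tcls S T i \<equiv> coend_cls (free_mon (Tgt S)) (tcomp_int S T i)"

definition tcomp :: "('a, 'am, 'b, 'bm, 'q, 'qm, 'e) tdx \<Rightarrow> ('b, 'bm, 'c, 'cm, 'p, 'pm, 'f) tdx \<Rightarrow>
    ('a, 'am, 'c, 'cm, 'q \<times> 'p, 'qm \<times> 'pm, ('b list \<times> 'e \<times> 'f) set) tdx" where
  "tcomp S T =
     \<lparr>Src = Src S, Tgt = Tgt T, St = St S \<times>\<^sub>c St T,
      Het =
        \<lparr>val = (\<lambda>i. coend (free_mon (Tgt S)) (tcomp_int S T i)),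
         act = (\<lambda>(f, (k, l), (k', l'), h).
           coend_map (free_mon (Tgt S))
             (tcomp_int S T (Cod (free_mon (Src S)) f, (Dom (St S) k, Dom (St T) l),
                             (Cod (St S) k', Cod (St T) l'), Dom (free_mon (Tgt T)) h))
             (\<lambda>(b, e, e'). (b, act (Het S) (f, k, k', Ident (free_mon (Tgt S)) b) e,
                              act (Het T) (Ident (free_mon (Tgt S)) b, l, l', h) e')))\<rparr>,
      Tens = (\<lambda>(u, (q, p), (r, s), c) (u', _, (q'', p''), c') K K'.
        \<Union>(b, e, f) \<in> K. \<Union>(b', e', f') \<in> K'.
          tcls S T (u @ u', (q, p), (q'', p''), c @ c')
            (b @ b', Tens S (u, q, r, b) (u', r, q'', b') e e',
                     Tens T (b, p, s, c) (b', s, p'', c') f f')),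
      Unt = (\<lambda>(h, l). tcls S T ([], (Dom (St S) h, Dom (St T) l), (Cod (St S) h, Cod (St T) l), [])
               ([], Unt S h, Unt T l))\<rparr>"


section \<open>Cells\<close>

text \<open>The component \<open>\<alpha>\<close> of a cell is given on all lists \<open>u\<close>, i.e. as the monoidal transformation
  that extends its values on letters.\<close>

record ('a, 'b, 'q, 'qm, 'e, 'p, 'pm, 'f) tcell =
  stF :: "('q, 'qm, 'p, 'pm) ftor"
  cmpt :: "'a list \<times> 'q \<times> 'q \<times> 'b list \<Rightarrow> 'e \<Rightarrow> 'f"

definition is_cell :: "('a, 'am, 'a2, 'am2) ftor \<Rightarrow> ('b, 'bm, 'b2, 'bm2) ftor \<Rightarrow>
    ('a, 'am, 'b, 'bm, 'q, 'qm, 'e) tdx \<Rightarrow> ('a2, 'am2, 'b2, 'bm2, 'p, 'pm, 'f) tdx \<Rightarrow>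
    ('a, 'b, 'q, 'qm, 'e, 'p, 'pm, 'f) tcell \<Rightarrow> bool" where
  "is_cell F G S T c \<longleftrightarrow>
     is_functor (Src S) (Src T) F \<and> is_functor (Tgt S) (Tgt T) G \<and> is_functor (St S) (St T) (stF c) \<and>
     nat_trans (shape S) (Het S)
       (pullback (prodF (starF F) (prodF (stF c) (prodF (stF c) (starF G)))) (Het T)) (cmpt c) \<and>
     (\<forall>u \<in> lists (Ob (Src S)). \<forall>u' \<in> lists (Ob (Src S)). \<forall>q \<in> Ob (St S). \<forall>r \<in> Ob (St S). \<forall>q'' \<in> Ob (St S).
      \<forall>b \<in> lists (Ob (Tgt S)). \<forall>b' \<in> lists (Ob (Tgt S)).
      \<forall>e \<in> val (Het S) (u, q, r, b). \<forall>e' \<in> val (Het S) (u', r, q'', b').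
        cmpt c (u @ u', q, q'', b @ b') (Tens S (u, q, r, b) (u', r, q'', b') e e')
        = Tens T (map (onOb F) u, onOb (stF c) q, onOb (stF c) r, map (onOb G) b)
                 (map (onOb F) u', onOb (stF c) r, onOb (stF c) q'', map (onOb G) b')
            (cmpt c (u, q, r, b) e) (cmpt c (u', r, q'', b') e')) \<and>
     (\<forall>h \<in> Ar (St S).
        cmpt c ([], Dom (St S) h, Cod (St S) h, []) (Unt S h) = Unt T (onAr (stF c) h))"

definition two_cell :: "('a, 'am, 'b, 'bm, 'q, 'qm, 'e) tdx \<Rightarrow> ('a, 'am, 'b, 'bm, 'p, 'pm, 'f) tdx \<Rightarrow>
    ('a, 'b, 'q, 'qm, 'e, 'p, 'pm, 'f) tcell \<Rightarrow> bool" where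
  "two_cell S T c \<longleftrightarrow> Src S = Src T \<and> Tgt S = Tgt T \<and> is_cell idF idF S T c"

definition cell_eq :: "('a, 'am, 'b, 'bm, 'q, 'qm, 'e) tdx \<Rightarrow> ('a, 'b, 'q, 'qm, 'e, 'p, 'pm, 'f) tcell \<Rightarrow>
    ('a, 'b, 'q, 'qm, 'e, 'p, 'pm, 'f) tcell \<Rightarrow> bool" where
  "cell_eq S c d \<longleftrightarrow> functor_eq (St S) (stF c) (stF d) \<and>
     (\<forall>i \<in> Ob (shape S). \<forall>e \<in> val (Het S) i. cmpt c i e = cmpt d i e)"

definition id_cell :: "('a, 'b, 'q, 'qm, 'e, 'q, 'qm, 'e) tcell" where
  "id_cell = \<lparr>stF = idF, cmpt = (\<lambda>_ e. e)\<rparr>"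

definition vcomp :: "('a, 'b, 'p, 'pm, 'f, 'r, 'rm, 'g) tcell \<Rightarrow> ('a, 'b, 'q, 'qm, 'e, 'p, 'pm, 'f) tcell \<Rightarrow>
    ('a, 'b, 'q, 'qm, 'e, 'r, 'rm, 'g) tcell" where
  "vcomp d c = \<lparr>stF = compF (stF d) (stF c),
     cmpt = (\<lambda>(u, q, q', b) e. cmpt d (u, onOb (stF c) q, onOb (stF c) q', b) (cmpt c (u, q, q', b) e))\<rparr>"

text \<open>\<open>hcomp S' T' c d\<close> is the horizontal composite of the 2-cells \<open>c : S \<Rightarrow> S'\<close> and \<open>d : T \<Rightarrow> T'\<close>.\<close>

definition hcomp :: "('a, 'am, 'b, 'bm, 'q2, 'qm2, 'e2) tdx \<Rightarrow> ('b, 'bm, 'c, 'cm, 'p2, 'pm2, 'f2) tdx \<Rightarrow>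
    ('a, 'b, 'q, 'qm, 'e, 'q2, 'qm2, 'e2) tcell \<Rightarrow> ('b, 'c, 'p, 'pm, 'f, 'p2, 'pm2, 'f2) tcell \<Rightarrow>
    ('a, 'c, 'q \<times> 'p, 'qm \<times> 'pm, ('b list \<times> 'e \<times> 'f) set, 'q2 \<times> 'p2, 'qm2 \<times> 'pm2, ('b list \<times> 'e2 \<times> 'f2) set) tcell"
  where
  "hcomp S' T' c d = \<lparr>stF = prodF (stF c) (stF d),
     cmpt = (\<lambda>(u, (q, p), (q', p'), w).
       coend_map (free_mon (Tgt S'))
         (tcomp_int S' T' (u, (onOb (stF c) q, onOb (stF d) p), (onOb (stF c) q', onOb (stF d) p'), w))
         (\<lambda>(b, e, f). (b, cmpt c (u, q, q', b) e, cmpt d (b, p, p', w) f)))\<rparr>"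

text \<open>The associator \<open>T \<circ> (S \<circ> R) \<Rightarrow> (T \<circ> S) \<circ> R\<close>, i.e. from \<open>tcomp (tcomp R S) T\<close> to \<open>tcomp R (tcomp S T)\<close>.\<close>

definition assoc_cell :: "('a, 'am, 'b, 'bm, 'q, 'qm, 'e) tdx \<Rightarrow> ('b, 'bm, 'c, 'cm, 'p, 'pm, 'f) tdx \<Rightarrow>
    ('c, 'cm, 'd, 'dm, 'r, 'rm, 'g) tdx \<Rightarrow>
    ('a, 'd, ('q \<times> 'p) \<times> 'r, ('qm \<times> 'pm) \<times> 'rm, ('c list \<times> ('b list \<times> 'e \<times> 'f) set \<times> 'g) set,
     'q \<times> 'p \<times> 'r, 'qm \<times> 'pm \<times> 'rm, ('b list \<times> 'e \<times> ('c list \<times> 'f \<times> 'g) set) set) tcell" where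
  "assoc_cell R S T =
     \<lparr>stF = \<lparr>onOb = (\<lambda>((q, p), r). (q, p, r)), onAr = (\<lambda>((k, l), m). (k, l, m))\<rparr>,
      cmpt = (\<lambda>(u, ((q, p), r), ((q', p'), r'), w) K.
        \<Union>(c, L, g) \<in> K. \<Union>(b, e, f) \<in> L.
          tcls R (tcomp S T) (u, (q, p, r), (q', p', r'), w)
            (b, e, tcls S T (b, (p, r), (p', r'), w) (c, f, g)))\<rparr>"

text \<open>The inverse unitors \<open>T \<Rightarrow> T \<circ> \<iota>\<close> and \<open>T \<Rightarrow> \<iota> \<circ> T\<close>.\<close>

definition inv_unitor_src :: "('a, 'am, 'b, 'bm, 'q, 'qm, 'e) tdx \<Rightarrow>
    ('a, 'b, 'q, 'qm, 'e, unit \<times> 'q, unit \<times> 'qm, ('a list \<times> 'am list \<times> 'e) set) tcell" where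
  "inv_unitor_src T =
     \<lparr>stF = \<lparr>onOb = (\<lambda>q. ((), q)), onAr = (\<lambda>k. ((), k))\<rparr>,
      cmpt = (\<lambda>(u, q, q', b) e.
        tcls (iota (Src T)) T (u, ((), q), ((), q'), b) (u, Ident (free_mon (Src T)) u, e))\<rparr>"

definition inv_unitor_tgt :: "('a, 'am, 'b, 'bm, 'q, 'qm, 'e) tdx \<Rightarrow>
    ('a, 'b, 'q, 'qm, 'e, 'q \<times> unit, 'qm \<times> unit, ('b list \<times> 'e \<times> 'bm list) set) tcell" where
  "inv_unitor_tgt T =
     \<lparr>stF = \<lparr>onOb = (\<lambda>q. (q, ())), onAr = (\<lambda>k. (k, ()))\<rparr>,
      cmpt = (\<lambda>(u, q, q', b) e.
        tcls T (iota (Tgt T)) (u, (q, ()), (q', ()), b) (b, e, Ident (free_mon (Tgt T)) b))\<rparr>"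


section \<open>Monads in the double category of 2-transducers\<close>

type_synonym ('a, 'am, 'q, 'qm, 'e) unit_cell = "('a, 'a, unit, unit, 'am list, 'q, 'qm, 'e) tcell"
type_synonym ('a, 'q, 'qm, 'e) mult_cell =
  "('a, 'a, 'q \<times> 'q, 'qm \<times> 'qm, ('a list \<times> 'e \<times> 'e) set, 'q, 'qm, 'e) tcell"

definition tdx_monad :: "('a, 'am) cat \<Rightarrow> ('a, 'am, 'a, 'am, 'q, 'qm, 'e) tdx \<Rightarrow>
    ('a, 'am, 'q, 'qm, 'e) unit_cell \<Rightarrow> ('a, 'q, 'qm, 'e) mult_cell \<Rightarrow> bool" where
  "tdx_monad A T \<eta> \<mu> \<longleftrightarrow>
     category A \<and> transducer A A T \<and>
     two_cell (iota A) T \<eta> \<and>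
     two_cell (tcomp T T) T \<mu> \<and>
     cell_eq (tcomp (tcomp T T) T)
       (vcomp \<mu> (hcomp T T \<mu> id_cell))
       (vcomp \<mu> (vcomp (hcomp T T id_cell \<mu>) (assoc_cell T T T))) \<and>
     cell_eq T (vcomp \<mu> (vcomp (hcomp T T \<eta> id_cell) (inv_unitor_src T))) id_cell \<and>
     cell_eq T (vcomp \<mu> (vcomp (hcomp T T id_cell \<eta>) (inv_unitor_tgt T))) id_cell"


section \<open>Graded promonads\<close>

definition strict_monoidal :: "('d, 'dm) cat \<Rightarrow> ('d \<times> 'd, 'dm \<times> 'dm, 'd, 'dm) ftor \<Rightarrow> 'd \<Rightarrow> bool" where
  "strict_monoidal M ten I \<longleftrightarrow>
     category M \<and> is_functor (M \<times>\<^sub>c M) M ten \<and> I \<in> Ob M \<and>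
     (\<forall>x \<in> Ob M. \<forall>y \<in> Ob M. \<forall>z \<in> Ob M. onOb ten (onOb ten (x, y), z) = onOb ten (x, onOb ten (y, z))) \<and>
     (\<forall>f \<in> Ar M. \<forall>g \<in> Ar M. \<forall>h \<in> Ar M. onAr ten (onAr ten (f, g), h) = onAr ten (f, onAr ten (g, h))) \<and>
     (\<forall>x \<in> Ob M. onOb ten (I, x) = x \<and> onOb ten (x, I) = x) \<and>
     (\<forall>f \<in> Ar M. onAr ten (Ident M I, f) = f \<and> onAr ten (f, Ident M I) = f)"

text \<open>A promonad on \<open>C\<close> graded over \<open>(M, \<otimes>, I)\<close>, i.e. a lax monoidal functor from \<open>M\<close> to
  endoprofunctors of \<open>C\<close>. The element \<open>e \<in> val P (d, u, a)\<close> is a heteromorphism of degree \<open>d\<close>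
  from \<open>a\<close> to \<open>u\<close>, covariant in \<open>u\<close> and contravariant in \<open>a\<close>;
  \<open>cp d d' u a v : P\<^sub>d(u, a) \<times> P\<^sub>d'(a, v) \<rightarrow> P\<^bsub>d \<otimes> d'\<^esub>(u, v)\<close> is composition, and
  \<open>un\<close> turns a morphism \<open>a \<rightarrow> u\<close> of \<open>C\<close> into an element of \<open>P\<^sub>I(u, a)\<close>.\<close>

definition graded_promonad :: "('o, 'm) cat \<Rightarrow> ('d, 'dm) cat \<Rightarrow> ('d \<times> 'd, 'dm \<times> 'dm, 'd, 'dm) ftor \<Rightarrow> 'd \<Rightarrow>
    ('d \<times> 'o \<times> 'o, 'dm \<times> 'm \<times> 'm, 'e) sfun \<Rightarrow> ('m \<Rightarrow> 'e) \<Rightarrow>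
    ('d \<Rightarrow> 'd \<Rightarrow> 'o \<Rightarrow> 'o \<Rightarrow> 'o \<Rightarrow> 'e \<Rightarrow> 'e \<Rightarrow> 'e) \<Rightarrow> bool" where
  "graded_promonad C M ten I P un cp \<longleftrightarrow>
     category C \<and> strict_monoidal M ten I \<and> set_functor (M \<times>\<^sub>c C \<times>\<^sub>c opc C) P \<and>
     (\<forall>f \<in> Ar C. un f \<in> val P (I, Cod C f, Dom C f)) \<and>
     (\<forall>h \<in> Ar C. \<forall>f \<in> Ar C. \<forall>g \<in> Ar C. Cod C h = Dom C f \<and> Cod C f = Dom C g \<longrightarrow>
        act P (Ident M I, g, h) (un f) = un (Comp C g (Comp C f h))) \<and>
     (\<forall>d \<in> Ob M. \<forall>d' \<in> Ob M. \<forall>u \<in> Ob C. \<forall>a \<in> Ob C. \<forall>v \<in> Ob C.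
        \<forall>e \<in> val P (d, u, a). \<forall>e' \<in> val P (d', a, v). cp d d' u a v e e' \<in> val P (onOb ten (d, d'), u, v)) \<and>
     (\<forall>k \<in> Ar M. \<forall>k' \<in> Ar M. \<forall>f \<in> Ar C. \<forall>a \<in> Ob C. \<forall>h \<in> Ar C.
        \<forall>e \<in> val P (Dom M k, Dom C f, a). \<forall>e' \<in> val P (Dom M k', a, Cod C h).
          cp (Cod M k) (Cod M k') (Cod C f) a (Dom C h)
             (act P (k, f, Ident C a) e) (act P (k', Ident C a, h) e')
          = act P (onAr ten (k, k'), f, h) (cp (Dom M k) (Dom M k') (Dom C f) a (Cod C h) e e')) \<and>
     (\<forall>d \<in> Ob M. \<forall>d' \<in> Ob M. \<forall>u \<in> Ob C. \<forall>g \<in> Ar C. \<forall>v \<in> Ob C.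
        \<forall>e \<in> val P (d, u, Cod C g). \<forall>e' \<in> val P (d', Dom C g, v).
          cp d d' u (Dom C g) v (act P (Ident M d, Ident C u, g) e) e'
          = cp d d' u (Cod C g) v e (act P (Ident M d', g, Ident C v) e')) \<and>
     (\<forall>d \<in> Ob M. \<forall>d' \<in> Ob M. \<forall>d'' \<in> Ob M. \<forall>u \<in> Ob C. \<forall>a \<in> Ob C. \<forall>v \<in> Ob C. \<forall>w \<in> Ob C.
        \<forall>e \<in> val P (d, u, a). \<forall>e' \<in> val P (d', a, v). \<forall>e'' \<in> val P (d'', v, w).
          cp (onOb ten (d, d')) d'' u v w (cp d d' u a v e e') e''
          = cp d (onOb ten (d', d'')) u a w e (cp d' d'' a v w e' e'')) \<and>
     (\<forall>d \<in> Ob M. \<forall>f \<in> Ar C. \<forall>v \<in> Ob C. \<forall>e \<in> val P (d, Dom C f, v).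
        cp I d (Cod C f) (Dom C f) v (un f) e = act P (Ident M d, f, Ident C v) e) \<and>
     (\<forall>d \<in> Ob M. \<forall>u \<in> Ob C. \<forall>f \<in> Ar C. \<forall>e \<in> val P (d, u, Cod C f).
        cp d I u (Cod C f) (Dom C f) e (un f) = act P (Ident M d, Ident C u, f) e)"


subsection \<open>Promonads on \<open>A*\<close> graded over \<open>Q\<^sup>o\<^sup>p \<times> Q\<close> with heteromorphisms given by a 2-transducer\<close>

definition pointwise_tensor :: "('q \<times> 'q, 'qm \<times> 'qm, 'q, 'qm) ftor \<Rightarrow>
    (('q \<times> 'q) \<times> ('q \<times> 'q), ('qm \<times> 'qm) \<times> ('qm \<times> 'qm), 'q \<times> 'q, 'qm \<times> 'qm) ftor" where
  "pointwise_tensor bx =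
     \<lparr>onOb = (\<lambda>((x, y), (x', y')). (onOb bx (x, x'), onOb bx (y, y'))),
      onAr = (\<lambda>((k, l), (k', l')). (onAr bx (k, k'), onAr bx (l, l')))\<rparr>"

definition tdx_het :: "('a, 'am, 'a, 'am, 'q, 'qm, 'e) tdx \<Rightarrow>
    (('q \<times> 'q) \<times> 'a list \<times> 'a list, ('qm \<times> 'qm) \<times> 'am list \<times> 'am list, 'e) sfun" where
  "tdx_het T =
     \<lparr>val = (\<lambda>((x, y), u, a). val (Het T) (u, x, y, a)),
      act = (\<lambda>((k, l), f, g). act (Het T) (f, k, l, g))\<rparr>"

type_synonym ('a, 'q, 'e) gcomp =
  "'q \<times> 'q \<Rightarrow> 'q \<times> 'q \<Rightarrow> 'a list \<Rightarrow> 'a list \<Rightarrow> 'a list \<Rightarrow> 'e \<Rightarrow> 'e \<Rightarrow> 'e"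

definition tdx_graded_promonad :: "('a, 'am) cat \<Rightarrow> ('a, 'am, 'a, 'am, 'q, 'qm, 'e) tdx \<Rightarrow>
    'q \<Rightarrow> ('q \<times> 'q, 'qm \<times> 'qm, 'q, 'qm) ftor \<Rightarrow> ('am list \<Rightarrow> 'e) \<Rightarrow> ('a, 'q, 'e) gcomp \<Rightarrow> bool" where
  "tdx_graded_promonad A T j bx un m \<longleftrightarrow>
     strict_monoidal (St T) bx j \<and>
     graded_promonad (free_mon A) (opc (St T) \<times>\<^sub>c St T) (pointwise_tensor bx) (j, j) (tdx_het T) un m"

text \<open>Compatibility of the unit and composition with concatenation of lists: the images of two
  morphisms (resp. the composites) of concatenated heteromorphisms are the concatenations of the
  images (resp. composites).\<close>

definition concat_compatible :: "('a, 'am) cat \<Rightarrow> ('a, 'am, 'a, 'am, 'q, 'qm, 'e) tdx \<Rightarrow>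
    'q \<Rightarrow> ('q \<times> 'q, 'qm \<times> 'qm, 'q, 'qm) ftor \<Rightarrow> ('am list \<Rightarrow> 'e) \<Rightarrow> ('a, 'q, 'e) gcomp \<Rightarrow> bool" where
  "concat_compatible A T j bx un m \<longleftrightarrow>
   (let C = free_mon A; Q = St T; X = Het T in
    (\<forall>f \<in> Ar C. \<forall>f' \<in> Ar C.
       un (f @ f') = Tens T (Cod C f, j, j, Dom C f) (Cod C f', j, j, Dom C f') (un f) (un f')) \<and>
    un [] = Unt T (Ident Q j) \<and>
    (\<forall>u1 \<in> Ob C. \<forall>u2 \<in> Ob C. \<forall>a1 \<in> Ob C. \<forall>a2 \<in> Ob C. \<forall>v1 \<in> Ob C. \<forall>v2 \<in> Ob C.
     \<forall>x \<in> Ob Q. \<forall>y \<in> Ob Q. \<forall>z \<in> Ob Q. \<forall>x' \<in> Ob Q. \<forall>y' \<in> Ob Q. \<forall>z' \<in> Ob Q.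
     \<forall>e1 \<in> val X (u1, x, y, a1). \<forall>e2 \<in> val X (u2, y, z, a2).
     \<forall>e1' \<in> val X (a1, x', y', v1). \<forall>e2' \<in> val X (a2, y', z', v2).
       m (x, z) (x', z') (u1 @ u2) (a1 @ a2) (v1 @ v2)
         (Tens T (u1, x, y, a1) (u2, y, z, a2) e1 e2) (Tens T (a1, x', y', v1) (a2, y', z', v2) e1' e2')
       = Tens T (u1, onOb bx (x, x'), onOb bx (y, y'), v1) (u2, onOb bx (y, y'), onOb bx (z, z'), v2)
           (m (x, y) (x', y') u1 a1 v1 e1 e1') (m (y, z) (y', z') u2 a2 v2 e2 e2')) \<and>
    (\<forall>h \<in> Ar Q. \<forall>h' \<in> Ar Q.
       m (Dom Q h, Cod Q h) (Dom Q h', Cod Q h') [] [] [] (Unt T h) (Unt T h')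
       = Unt T (onAr bx (h, h'))))"

text \<open>The data \<open>(j, bx, un, m)\<close> corresponds to the cells \<open>\<eta>\<close> and \<open>\<mu>\<close>: same state functors, same unit,
  and \<open>m\<close> is the family of maps obtained from \<open>\<mu>\<close> by precomposition with the coend injections.\<close>

definition corresponds :: "('a, 'am) cat \<Rightarrow> ('a, 'am, 'a, 'am, 'q, 'qm, 'e) tdx \<Rightarrow>
    ('a, 'am, 'q, 'qm, 'e) unit_cell \<Rightarrow> ('a, 'q, 'qm, 'e) mult_cell \<Rightarrow>
    'q \<Rightarrow> ('q \<times> 'q, 'qm \<times> 'qm, 'q, 'qm) ftor \<Rightarrow> ('am list \<Rightarrow> 'e) \<Rightarrow> ('a, 'q, 'e) gcomp \<Rightarrow> bool" where
  "corresponds A T \<eta> \<mu> j bx un m \<longleftrightarrow>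
   (let C = free_mon A; Q = St T; X = Het T in
    j = onOb (stF \<eta>) () \<and>
    functor_eq (Q \<times>\<^sub>c Q) bx (stF \<mu>) \<and>
    (\<forall>f \<in> Ar C. un f = cmpt \<eta> (Cod C f, (), (), Dom C f) f) \<and>
    (\<forall>u \<in> Ob C. \<forall>a \<in> Ob C. \<forall>v \<in> Ob C. \<forall>x \<in> Ob Q. \<forall>y \<in> Ob Q. \<forall>x' \<in> Ob Q. \<forall>y' \<in> Ob Q.
     \<forall>e \<in> val X (u, x, y, a). \<forall>e' \<in> val X (a, x', y', v).
       m (x, y) (x', y') u a v e e'
       = cmpt \<mu> (u, (x, x'), (y, y'), v) (tcls T T (u, (x, x'), (y, y'), v) (a, e, e'))))"

end

theory Submission
  imports Defs
begin

text \<open>By the universal property of the coend, a 2-cell \<open>t \<circ> t \<Rightarrow> t\<close> is the same as a family of maps out of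
  the sets \<open>t(u; x, y)[a] \<times> t(a; x', y')[v]\<close> of representatives that is dinatural in \<open>a\<close>. All structure
  on composites of 2-transducers is defined on representatives, so once each operation (action, tensor,
  horizontal composition, associator, unitors) is known to be independent of the representative,
  every axiom of a monad becomes an equation between values of that family. These are
  the axioms of a graded promonad, except that the unit laws of a monad only
  concern identities of \<open>A*\<close>; the unit laws for arbitrary morphisms then follow by naturality.\<close>

section \<open>Categories\<close>

text \<open>The obstacle is nesting: the associativity law lives on a coend whose elements
  themselves contain coend classes. Functoriality (\<open>het\<close>) is therefore kept apart from
  lax structure (\<open>lax_het\<close>). The former passes to composites, so a composite can serve
  as a factor again; the latter is used for the two factors of a single composite. Operations on
  classes are unions over all representatives, so independence of the representative says that all
  members of such a union are equal.

  \<open>concat_compatible\<close> originates in the notion of cell: a 2-cell is given on all lists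
  and respects \<open>Tens\<close> and \<open>Unt\<close>, and for \<eta> and \<mu> these clauses
  become the concatenation conditions. Because \<open>cell_eq\<close> compares state functors by
  equality, the tensor of states comes out strictly associative and unital. In the direction from
  graded promonads to monads, the cowedge axiom lets composition descend to the coend, and
  functoriality forces the state functor of the unit to send the only arrow of the terminal category
  to an identity.\<close>

lemma prodc_simps [simp]:
  "Ob (C \<times>\<^sub>c D) = Ob C \<times> Ob D" "Ar (C \<times>\<^sub>c D) = Ar C \<times> Ar D"
  "Dom (C \<times>\<^sub>c D) = map_prod (Dom C) (Dom D)" "Cod (C \<times>\<^sub>c D) = map_prod (Cod C) (Cod D)"
  "Ident (C \<times>\<^sub>c D) = map_prod (Ident C) (Ident D)"
  "Comp (C \<times>\<^sub>c D) (g, g') (f, f') = (Comp C g f, Comp D g' f')"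
  by (simp_all add: prodc_def)

lemma opc_simps [simp]:
  "Ob (opc C) = Ob C" "Ar (opc C) = Ar C" "Dom (opc C) = Cod C" "Cod (opc C) = Dom C"
  "Ident (opc C) = Ident C" "Comp (opc C) g f = Comp C f g"
  by (simp_all add: opc_def)

lemma comp_ident_ident [simp]: "category C \<Longrightarrow> a \<in> Ob C \<Longrightarrow> Comp C (Ident C a) (Ident C a) = Ident C a"
  by (metis category.comp_ident_left category.cod_ident category.ident_ar)

lemma terminal_cat_simps [simp]:
  "Ob terminal_cat = UNIV" "Ar terminal_cat = UNIV" "Dom terminal_cat f = ()" "Cod terminal_cat f = ()"
  "Ident terminal_cat a = ()" "Comp terminal_cat g f = ()"
  by (simp_all add: terminal_cat_def)

lemma ftor_simps [simp]:
  "onOb idF = (\<lambda>a. a)" "onAr idF = (\<lambda>f. f)"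
  "onOb (compF G F) a = onOb G (onOb F a)" "onAr (compF G F) f = onAr G (onAr F f)"
  "onOb (prodF F H) = map_prod (onOb F) (onOb H)" "onAr (prodF F H) = map_prod (onAr F) (onAr H)"
  "onOb (starF F) = map (onOb F)" "onAr (starF F) = map (onAr F)"
  "val (pullback F X) a = val X (onOb F a)" "act (pullback F X) f = act X (onAr F f)"
  by (simp_all add: idF_def compF_def prodF_def starF_def pullback_def)

lemma is_functor_idF: "is_functor C C idF"
  by (simp add: is_functor_def)

lemmas category_simps [simp] =
  category.dom_ob category.cod_ob category.ident_ar category.dom_ident category.cod_ident
  category.comp_ar category.dom_comp category.cod_comp
  category.comp_ident_right category.comp_ident_left

lemma category_opc [simp]: "category C \<Longrightarrow> category (opc C)"
  by (unfold_locales) (auto simp: category.comp_assoc)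

lemma category_prodc [simp]: "category C \<Longrightarrow> category D \<Longrightarrow> category (C \<times>\<^sub>c D)"
  by (unfold_locales) (auto simp: category.comp_assoc)

lemma category_terminal_cat [simp]: "category terminal_cat"
  by unfold_locales auto

lemma category_free_mon [simp]:
  assumes "category C"
  shows "category (free_mon C)"
proof -
  interpret category C by fact
  show ?thesis
  proof
    fix f assume f: "f \<in> Ar (free_mon C)"
    show "Comp (free_mon C) f (Ident (free_mon C) (Dom (free_mon C) f)) = f"
      "Comp (free_mon C) (Ident (free_mon C) (Cod (free_mon C) f)) f = f"
      using f by (auto simp: free_mon_def list_eq_iff_nth_eq comp_ident_right comp_ident_left in_lists_conv_set)
  next
    fix f g assume fg: "f \<in> Ar (free_mon C)" "g \<in> Ar (free_mon C)" "Cod (free_mon C) f = Dom (free_mon C) g"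
    \<comment> \<open>Composition is \<open>map2\<close>, which truncates; equality of the codomain
      and domain lists is what forces equal lengths and composability at each position.\<close>
    then have "length f = length g" "\<And>i. i < length f \<Longrightarrow> Cod C (f ! i) = Dom C (g ! i)"
      by (auto simp: free_mon_def list_eq_iff_nth_eq)
    moreover have "\<And>i. i < length f \<Longrightarrow> f ! i \<in> Ar C" "\<And>i. i < length g \<Longrightarrow> g ! i \<in> Ar C"
      using fg by (auto simp: free_mon_def in_lists_conv_set)
    ultimately show "Comp (free_mon C) g f \<in> Ar (free_mon C)"
      "Dom (free_mon C) (Comp (free_mon C) g f) = Dom (free_mon C) f"
      "Cod (free_mon C) (Comp (free_mon C) g f) = Cod (free_mon C) g"
      by (auto simp: free_mon_def list_eq_iff_nth_eq in_lists_conv_set in_set_conv_nth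
          comp_ar dom_comp cod_comp)
  next
    fix f g h assume fgh: "f \<in> Ar (free_mon C)" "g \<in> Ar (free_mon C)" "h \<in> Ar (free_mon C)"
      "Cod (free_mon C) f = Dom (free_mon C) g" "Cod (free_mon C) g = Dom (free_mon C) h"
    then have "length f = length g" "length g = length h"
      "\<And>i. i < length f \<Longrightarrow> Cod C (f ! i) = Dom C (g ! i)"
      "\<And>i. i < length g \<Longrightarrow> Cod C (g ! i) = Dom C (h ! i)"
      by (auto simp: free_mon_def list_eq_iff_nth_eq)
    with fgh show "Comp (free_mon C) h (Comp (free_mon C) g f) = Comp (free_mon C) (Comp (free_mon C) h g) f"
      by (auto simp: free_mon_def list_eq_iff_nth_eq in_lists_conv_set comp_assoc)
  qed (auto simp: free_mon_def in_lists_conv_set dom_ob cod_ob ident_ar dom_ident cod_ident intro!: map_idI)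
qed

lemma free_mon_append [simp]:
  "u @ u' \<in> Ob (free_mon C) \<longleftrightarrow> u \<in> Ob (free_mon C) \<and> u' \<in> Ob (free_mon C)"
  "f @ f' \<in> Ar (free_mon C) \<longleftrightarrow> f \<in> Ar (free_mon C) \<and> f' \<in> Ar (free_mon C)"
  "Dom (free_mon C) (f @ f') = Dom (free_mon C) f @ Dom (free_mon C) f'"
  "Cod (free_mon C) (f @ f') = Cod (free_mon C) f @ Cod (free_mon C) f'"
  "Ident (free_mon C) (u @ u') = Ident (free_mon C) u @ Ident (free_mon C) u'"
  by (auto simp: free_mon_def)

lemma free_mon_Nil [simp]:
  "[] \<in> Ob (free_mon C)" "[] \<in> Ar (free_mon C)"
  "Dom (free_mon C) [] = []" "Cod (free_mon C) [] = []" "Ident (free_mon C) [] = []"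
  by (auto simp: free_mon_def)

lemma lists_Ob: "lists (Ob C) = Ob (free_mon C)"
  by (simp add: free_mon_def)

lemma hom_Ident [simp]: "category C \<Longrightarrow> a \<in> Ob C \<Longrightarrow> Ident C a \<in> hom C a a"
  by (simp add: hom_def)

lemma hom_self [simp]: "f \<in> Ar C \<Longrightarrow> f \<in> hom C (Dom C f) (Cod C f)"
  by (simp add: hom_def)

lemma hom_Comp [intro]: "category C \<Longrightarrow> f \<in> hom C a b \<Longrightarrow> g \<in> hom C b c \<Longrightarrow> Comp C g f \<in> hom C a c"
  by (auto simp: hom_def)

lemma homD:
  assumes "category C" "f \<in> hom C a b"
  shows "f \<in> Ar C" "Dom C f = a" "Cod C f = b" "a \<in> Ob C" "b \<in> Ob C"
    "Comp C f (Ident C a) = f" "Comp C (Ident C b) f = f"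
  using assms by (auto simp: hom_def)


section \<open>Coends\<close>

lemma coend_cls_refl: "p \<in> coend_cls C X p"
  by (simp add: coend_cls_def)

lemma coend_cls_eq:
  assumes "(p, q) \<in> coend_rel C X"
  shows "coend_cls C X p = coend_cls C X q"
proof -
  have "(p, q) \<in> (coend_rel C X \<union> (coend_rel C X)\<inverse>)\<^sup>*" "(q, p) \<in> (coend_rel C X \<union> (coend_rel C X)\<inverse>)\<^sup>*"
    using assms by auto
  then show ?thesis
    unfolding coend_cls_def by (auto intro: rtrancl_trans)
qed

text \<open>Invariance on generators propagates along a zigzag: each step of the closure is a
  generator or the converse of one, and both preserve the value of \<open>w\<close>.\<close>

lemma coend_cls_invariant:
  assumes "\<And>p q. (p, q) \<in> coend_rel C X \<Longrightarrow> w p = w q" and "q \<in> coend_cls C X p"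
  shows "w q = w p"
proof -
  have "(p, q) \<in> (coend_rel C X \<union> (coend_rel C X)\<inverse>)\<^sup>*"
    using assms(2) by (simp add: coend_cls_def)
  then show ?thesis
    by induction (use assms(1) in force)+
qed

text \<open>Maps into coends are defined as unions of classes over all representatives. When the
  class does not depend on the representative, the union collapses to it, without any
  choice.\<close>

lemma UN_constant_at: "p \<in> K \<Longrightarrow> (\<And>q. q \<in> K \<Longrightarrow> w q = w p) \<Longrightarrow> (\<Union>q \<in> K. w q) = w p"
  by blast

text \<open>The counterpart for \<open>coend_desc\<close>, whose values are elements of an arbitrary
  type rather than sets that can be united.\<close>

lemma the_elem_constant_at: "p \<in> K \<Longrightarrow> (\<And>q. q \<in> K \<Longrightarrow> w q = w p) \<Longrightarrow> the_elem (w ` K) = w p"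
  by (metis empty_iff the_elem_image_unique)

section \<open>Set-valued functors underlying 2-transducers\<close>

text \<open>Only functoriality is recorded, because this is the property that is carried over to
  composites and to \<open>iota A\<close>, which then occur as factors in the laws of a
  monad.\<close>

locale het =
  fixes T :: "('a, 'am, 'b, 'bm, 'q, 'qm, 'e) tdx"
  assumes category_Src [simp]: "category (Src T)"
    and category_Tgt [simp]: "category (Tgt T)"
    and category_St [simp]: "category (St T)"
    and set_functor_Het: "set_functor (shape T) (Het T)"
begin

lemma act_val:
  assumes "e \<in> val (Het T) (u, q, q', b)"
    and "f \<in> hom (free_mon (Src T)) u u'" "k \<in> hom (St T) p q" "l \<in> hom (St T) q' p'"
      "g \<in> hom (free_mon (Tgt T)) b' b"
  shows "act (Het T) (f, k, l, g) e \<in> val (Het T) (u', p, p', b')"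
proof -
  have "(f, k, l, g) \<in> Ar (shape T)"
    using assms by (auto simp: shape_def hom_def)
  moreover have "e \<in> val (Het T) (Dom (shape T) (f, k, l, g))"
    using assms by (auto simp: shape_def hom_def)
  ultimately have "act (Het T) (f, k, l, g) e \<in> val (Het T) (Cod (shape T) (f, k, l, g))"
    using set_functor_Het unfolding set_functor_def by blast
  then show ?thesis
    using assms by (auto simp: shape_def hom_def)
qed

lemma act_ident:
  assumes "e \<in> val (Het T) (u, q, q', b)"
    and "u \<in> Ob (free_mon (Src T))" "q \<in> Ob (St T)" "q' \<in> Ob (St T)" "b \<in> Ob (free_mon (Tgt T))"
  shows "act (Het T) (Ident (free_mon (Src T)) u, Ident (St T) q, Ident (St T) q', Ident (free_mon (Tgt T)) b) e = e"
proof -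
  have "act (Het T) (Ident (shape T) (u, q, q', b)) e = e"
    using assms set_functor_Het unfolding set_functor_def by (auto simp: shape_def)
  then show ?thesis
    by (simp add: shape_def)
qed

lemma act_act:
  assumes "e \<in> val (Het T) (u, q, q', b)"
    and f: "f \<in> hom (free_mon (Src T)) u u'" "k \<in> hom (St T) p q" "l \<in> hom (St T) q' p'"
      "g \<in> hom (free_mon (Tgt T)) b' b"
    and f': "f' \<in> hom (free_mon (Src T)) u' u''" "k' \<in> hom (St T) r p" "l' \<in> hom (St T) p' r'"
      "g' \<in> hom (free_mon (Tgt T)) b'' b'"
  shows "act (Het T) (f', k', l', g') (act (Het T) (f, k, l, g) e) =
    act (Het T) (Comp (free_mon (Src T)) f' f, Comp (St T) k k', Comp (St T) l' l, Comp (free_mon (Tgt T)) g g') e"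
proof -
  have "(f, k, l, g) \<in> Ar (shape T)" "(f', k', l', g') \<in> Ar (shape T)"
    "Cod (shape T) (f, k, l, g) = Dom (shape T) (f', k', l', g')"
    "e \<in> val (Het T) (Dom (shape T) (f, k, l, g))"
    using assms by (auto simp: shape_def hom_def)
  then have "act (Het T) (Comp (shape T) (f', k', l', g') (f, k, l, g)) e =
      act (Het T) (f', k', l', g') (act (Het T) (f, k, l, g) e)"
    using set_functor_Het unfolding set_functor_def by blast
  then show ?thesis
    by (simp add: shape_def)
qed

text \<open>Both sides are the action of \<open>(f, k, l, g)\<close>, by functoriality. The lemma
  lets a morphism of the target, which is a slide when the element is the first factor of a
  composite, pass through the action in the other variables.\<close>

lemma act_commute_tgt:
  assumes e: "e \<in> val (Het T) (u, q, q', b)"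
    and u: "u \<in> Ob (free_mon (Src T))" "q \<in> Ob (St T)" "q' \<in> Ob (St T)"
    and f: "f \<in> hom (free_mon (Src T)) u u'" "k \<in> hom (St T) p q" "l \<in> hom (St T) q' p'"
      "g \<in> hom (free_mon (Tgt T)) b' b"
  shows "act (Het T) (f, k, l, Ident (free_mon (Tgt T)) b')
      (act (Het T) (Ident (free_mon (Src T)) u, Ident (St T) q, Ident (St T) q', g) e) =
    act (Het T) (Ident (free_mon (Src T)) u', Ident (St T) p, Ident (St T) p', g)
      (act (Het T) (f, k, l, Ident (free_mon (Tgt T)) b) e)"
  using f[THEN homD(4)[rotated]] f[THEN homD(5)[rotated]] f[THEN homD(6)[rotated]] f[THEN homD(7)[rotated]]
  by (simp add: act_act[OF e _ _ _ f(4) f(1-3), where b'' = b']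
      act_act[OF e f(1-3) _ _ _ _ f(4), where u'' = u' and r = p and r' = p'])

text \<open>The same interchange for the source variable, along which the second factor of a
  composite is slid.\<close>

lemma act_commute_src:
  assumes e: "e \<in> val (Het T) (u, q, q', b)"
    and b: "q \<in> Ob (St T)" "q' \<in> Ob (St T)" "b \<in> Ob (free_mon (Tgt T))"
    and f: "f \<in> hom (free_mon (Src T)) u u'" "k \<in> hom (St T) p q" "l \<in> hom (St T) q' p'"
      "g \<in> hom (free_mon (Tgt T)) b' b"
  shows "act (Het T) (f, Ident (St T) p, Ident (St T) p', Ident (free_mon (Tgt T)) b')
      (act (Het T) (Ident (free_mon (Src T)) u, k, l, g) e) =
    act (Het T) (Ident (free_mon (Src T)) u', k, l, g)
      (act (Het T) (f, Ident (St T) q, Ident (St T) q', Ident (free_mon (Tgt T)) b) e)"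
  using f[THEN homD(4)[rotated]] f[THEN homD(5)[rotated]] f[THEN homD(6)[rotated]] f[THEN homD(7)[rotated]]
  by (simp add: act_act[OF e _ f(2-4) f(1), where r = p and r' = p' and b'' = b']
      act_act[OF e f(1) _ _ _ _ f(2-4), where u'' = u'])

end

section \<open>Composition of 2-transducers on representatives\<close>

locale het_pair = S: het S + T: het T
  for S :: "('a, 'am, 'b, 'bm, 'q, 'qm, 'e) tdx" and T :: "('b, 'bm, 'c, 'cm, 'p, 'pm, 'f) tdx" +
  assumes Src_eq_Tgt [simp]: "Src T = Tgt S"
begin

text \<open>A generator of the coend also acts by identities on the factor that \<open>g\<close>
  does not touch. Removing these with \<open>act_ident\<close> leaves the usual sliding relation
  between \<open>(e g, f)\<close> and \<open>(e, g f)\<close>; the membership assumptions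
  \<open>objs\<close> serve this removal.\<close>

lemma coend_rel_tcomp_int:
  assumes "(x, y) \<in> coend_rel (free_mon (Tgt S)) (tcomp_int S T (u, (q, p), (q', p'), w))"
    and objs: "u \<in> Ob (free_mon (Src S))" "q \<in> Ob (St S)" "q' \<in> Ob (St S)" "p \<in> Ob (St T)" "p' \<in> Ob (St T)"
      "w \<in> Ob (free_mon (Tgt T))"
  obtains g b b' e f where "g \<in> hom (free_mon (Tgt S)) b b'" "e \<in> val (Het S) (u, q, q', b')"
    "f \<in> val (Het T) (b, p, p', w)"
    "x = (b, act (Het S) (Ident (free_mon (Src S)) u, Ident (St S) q, Ident (St S) q', g) e, f)"
    "y = (b', e, act (Het T) (g, Ident (St T) p, Ident (St T) p', Ident (free_mon (Tgt T)) w) f)"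
proof -
  obtain g e f where g: "g \<in> Ar (free_mon (Tgt S))" and e: "e \<in> val (Het S) (u, q, q', Cod (free_mon (Tgt S)) g)"
    and f: "f \<in> val (Het T) (Dom (free_mon (Tgt S)) g, p, p', w)"
    and x: "x = (Dom (free_mon (Tgt S)) g,
        act (Het S) (Ident (free_mon (Src S)) u, Ident (St S) q, Ident (St S) q', g) e,
        act (Het T) (Ident (free_mon (Tgt S)) (Dom (free_mon (Tgt S)) g), Ident (St T) p, Ident (St T) p', Ident (free_mon (Tgt T)) w) f)"
    and y: "y = (Cod (free_mon (Tgt S)) g,
        act (Het S) (Ident (free_mon (Src S)) u, Ident (St S) q, Ident (St S) q', Ident (free_mon (Tgt S)) (Cod (free_mon (Tgt S)) g)) e,
        act (Het T) (g, Ident (St T) p, Ident (St T) p', Ident (free_mon (Tgt T)) w) f)"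
    using assms(1) by (auto simp: coend_rel_def tcomp_int_def)
  show thesis
    by (rule that[of g "Dom (free_mon (Tgt S)) g" "Cod (free_mon (Tgt S)) g" e f])
      (use g e f x y objs S.act_ident[OF e] T.act_ident[OF f] in simp_all)
qed

lemma tcls_slide:
  assumes g: "g \<in> hom (free_mon (Tgt S)) b b'"
    and e: "e \<in> val (Het S) (u, q, q', b')" and f: "f \<in> val (Het T) (b, p, p', w)"
    and objs: "u \<in> Ob (free_mon (Src S))" "q \<in> Ob (St S)" "q' \<in> Ob (St S)" "p \<in> Ob (St T)" "p' \<in> Ob (St T)"
      "w \<in> Ob (free_mon (Tgt T))"
  shows "tcls S T (u, (q, p), (q', p'), w)
      (b, act (Het S) (Ident (free_mon (Src S)) u, Ident (St S) q, Ident (St S) q', g) e, f) =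
    tcls S T (u, (q, p), (q', p'), w)
      (b', e, act (Het T) (g, Ident (St T) p, Ident (St T) p', Ident (free_mon (Tgt T)) w) f)"
proof (rule coend_cls_eq)
  have g': "g \<in> Ar (free_mon (Tgt S))" "Dom (free_mon (Tgt S)) g = b" "Cod (free_mon (Tgt S)) g = b'"
    "b \<in> Ob (free_mon (Tgt S))" "b' \<in> Ob (free_mon (Tgt S))"
    using homD[OF _ g] by auto
  then show "((b, act (Het S) (Ident (free_mon (Src S)) u, Ident (St S) q, Ident (St S) q', g) e, f),
      (b', e, act (Het T) (g, Ident (St T) p, Ident (St T) p', Ident (free_mon (Tgt T)) w) f))
    \<in> coend_rel (free_mon (Tgt S)) (tcomp_int S T (u, (q, p), (q', p'), w))"
    unfolding coend_rel_def tcomp_int_def using e f objs S.act_ident[OF e] T.act_ident[OF f]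
    by (auto intro!: exI[of _ g] exI[of _ e] exI[of _ f])
qed

text \<open>The values have an arbitrary type \<open>'z\<close>, so the notion covers both the
  classes united in maps between coends and the elements produced by
  \<open>coend_desc\<close>.\<close>

definition cowedge :: "'a list \<times> ('q \<times> 'p) \<times> ('q \<times> 'p) \<times> 'c list \<Rightarrow> ('b list \<times> 'e \<times> 'f \<Rightarrow> 'z) \<Rightarrow> bool" where
  "cowedge = (\<lambda>(u, (q, p), (q', p'), w) W.
     \<forall>b b' g e f. g \<in> hom (free_mon (Tgt S)) b b' \<and> e \<in> val (Het S) (u, q, q', b') \<and> f \<in> val (Het T) (b, p, p', w) \<longrightarrow>
       W (b, act (Het S) (Ident (free_mon (Src S)) u, Ident (St S) q, Ident (St S) q', g) e, f) =
       W (b', e, act (Het T) (g, Ident (St T) p, Ident (St T) p', Ident (free_mon (Tgt T)) w) f))"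

lemma cowedgeI:
  assumes "\<And>g b b' e f. \<lbrakk>g \<in> hom (free_mon (Tgt S)) b b'; b \<in> Ob (free_mon (Tgt S)); b' \<in> Ob (free_mon (Tgt S));
      e \<in> val (Het S) (u, q, q', b'); f \<in> val (Het T) (b, p, p', w)\<rbrakk>
      \<Longrightarrow> W (b, act (Het S) (Ident (free_mon (Src S)) u, Ident (St S) q, Ident (St S) q', g) e, f) =
        W (b', e, act (Het T) (g, Ident (St T) p, Ident (St T) p', Ident (free_mon (Tgt T)) w) f)"
  shows "cowedge (u, (q, p), (q', p'), w) W"
  unfolding cowedge_def prod.case
proof (intro allI impI, elim conjE)
  fix b b' g e f
  assume g: "g \<in> hom (free_mon (Tgt S)) b b'" and e: "e \<in> val (Het S) (u, q, q', b')"
    and f: "f \<in> val (Het T) (b, p, p', w)"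
  show "W (b, act (Het S) (Ident (free_mon (Src S)) u, Ident (St S) q, Ident (St S) q', g) e, f) =
    W (b', e, act (Het T) (g, Ident (St T) p, Ident (St T) p', Ident (free_mon (Tgt T)) w) f)"
    using homD[OF _ g] by (intro assms g e f) simp_all
qed

lemma cowedge_tcls:
  assumes W: "cowedge (u, (q, p), (q', p'), w) W"
    and objs: "u \<in> Ob (free_mon (Src S))" "q \<in> Ob (St S)" "q' \<in> Ob (St S)" "p \<in> Ob (St T)" "p' \<in> Ob (St T)"
      "w \<in> Ob (free_mon (Tgt T))"
    and "y \<in> tcls S T (u, (q, p), (q', p'), w) x"
  shows "W y = W x"
proof (rule coend_cls_invariant[OF _ assms(8)])
  fix x y assume "(x, y) \<in> coend_rel (free_mon (Tgt S)) (tcomp_int S T (u, (q, p), (q', p'), w))"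
  then show "W x = W y"
    using objs by (rule coend_rel_tcomp_int) (use W in \<open>simp add: cowedge_def\<close>)
qed

text \<open>This is the computation rule for every operation on classes: after a check of the
  sliding identity, the union may be evaluated at the representative at hand.\<close>

lemma UN_tcls:
  assumes "cowedge (u, (q, p), (q', p'), w) W"
    and "u \<in> Ob (free_mon (Src S))" "q \<in> Ob (St S)" "q' \<in> Ob (St S)" "p \<in> Ob (St T)" "p' \<in> Ob (St T)"
      "w \<in> Ob (free_mon (Tgt T))"
  shows "(\<Union>y \<in> tcls S T (u, (q, p), (q', p'), w) x. W y) = W x"
  using cowedge_tcls[OF assms] coend_cls_refl by (intro UN_constant_at)

lemma coend_desc_tcls:
  assumes "cowedge (u, (q, p), (q', p'), w) W"
    and "u \<in> Ob (free_mon (Src S))" "q \<in> Ob (St S)" "q' \<in> Ob (St S)" "p \<in> Ob (St T)" "p' \<in> Ob (St T)"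
      "w \<in> Ob (free_mon (Tgt T))"
  shows "coend_desc W (tcls S T (u, (q, p), (q', p'), w) x) = W x"
  unfolding coend_desc_def using cowedge_tcls[OF assms] coend_cls_refl by (intro the_elem_constant_at)

lemma val_tcomp_cases [consumes 1]:
  assumes "K \<in> val (Het (tcomp S T)) (u, (q, p), (q', p'), w)"
  obtains b e f where "b \<in> Ob (free_mon (Tgt S))" "e \<in> val (Het S) (u, q, q', b)" "f \<in> val (Het T) (b, p, p', w)"
    "K = tcls S T (u, (q, p), (q', p'), w) (b, e, f)"
  using assms by (auto simp: tcomp_def coend_def tcomp_int_def)

lemma tcls_val:
  assumes "b \<in> Ob (free_mon (Tgt S))" "e \<in> val (Het S) (u, q, q', b)" "f \<in> val (Het T) (b, p, p', w)"
  shows "tcls S T (u, (q, p), (q', p'), w) (b, e, f) \<in> val (Het (tcomp S T)) (u, (q, p), (q', p'), w)"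
  using assms by (auto simp: tcomp_def coend_def tcomp_int_def)

lemma tcomp_simps [simp]:
  "Src (tcomp S T) = Src S" "Tgt (tcomp S T) = Tgt T" "St (tcomp S T) = St S \<times>\<^sub>c St T"
  by (simp_all add: tcomp_def)

text \<open>The representative-wise action respects slides: \<open>(f, k, k')\<close> commutes with
  \<open>g\<close> in the first factor, \<open>tcls_slide\<close> carries \<open>g\<close> to the
  second factor, and there it commutes with \<open>(l, l', h)\<close>.\<close>

lemma act_tcls:
  assumes e: "e \<in> val (Het S) (u, q, q', b)" and e': "e' \<in> val (Het T) (b, p, p', w)"
    and objs: "b \<in> Ob (free_mon (Tgt S))"
    and f: "f \<in> hom (free_mon (Src S)) u u'" and h: "h \<in> hom (free_mon (Tgt T)) w' w"
    and k: "k \<in> hom (St S) r q" and k': "k' \<in> hom (St S) q' r'"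
    and l: "l \<in> hom (St T) s p" and l': "l' \<in> hom (St T) p' s'"
  shows "act (Het (tcomp S T)) (f, (k, l), (k', l'), h) (tcls S T (u, (q, p), (q', p'), w) (b, e, e')) =
    tcls S T (u', (r, s), (r', s'), w')
      (b, act (Het S) (f, k, k', Ident (free_mon (Tgt S)) b) e, act (Het T) (Ident (free_mon (Tgt S)) b, l, l', h) e')"
    (is "_ = ?R (b, _, _)")
proof -
  note homs = f h k k' l l'
  have objs': "u \<in> Ob (free_mon (Src S))" "q \<in> Ob (St S)" "q' \<in> Ob (St S)" "p \<in> Ob (St T)" "p' \<in> Ob (St T)"
     "w \<in> Ob (free_mon (Tgt T))" "u' \<in> Ob (free_mon (Src S))" "r \<in> Ob (St S)" "r' \<in> Ob (St S)"
     "s \<in> Ob (St T)" "s' \<in> Ob (St T)" "w' \<in> Ob (free_mon (Tgt T))"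
     "Cod (free_mon (Src S)) f = u'" "Dom (St S) k = r" "Dom (St T) l = s" "Cod (St S) k' = r'" "Cod (St T) l' = s'"
     "Dom (free_mon (Tgt T)) h = w'"
    using homs[THEN homD(4)[rotated]] homs[THEN homD(5)[rotated]] homs by (simp_all add: hom_def)
  let ?\<phi> = "\<lambda>(b, e, e'). (b, act (Het S) (f, k, k', Ident (free_mon (Tgt S)) b) e,
    act (Het T) (Ident (free_mon (Tgt S)) b, l, l', h) e')"
  have "(\<Union>x \<in> tcls S T (u, (q, p), (q', p'), w) (b, e, e').
      ?R (?\<phi> x)) =
    ?R (?\<phi> (b, e, e'))"
  proof (rule UN_tcls, rule cowedgeI)
    fix g b b' e e'
    assume b: "b \<in> Ob (free_mon (Tgt S))" "b' \<in> Ob (free_mon (Tgt S))"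
    assume g: "g \<in> hom (free_mon (Tgt S)) b b'" and e: "e \<in> val (Het S) (u, q, q', b')"
      and e': "e' \<in> val (Het T) (b, p, p', w)"
    have "?R (b, act (Het S) (f, k, k', Ident (free_mon (Tgt S)) b)
            (act (Het S) (Ident (free_mon (Src S)) u, Ident (St S) q, Ident (St S) q', g) e),
          act (Het T) (Ident (free_mon (Tgt S)) b, l, l', h) e') =
        ?R (b, act (Het S) (Ident (free_mon (Src S)) u', Ident (St S) r, Ident (St S) r', g)
            (act (Het S) (f, k, k', Ident (free_mon (Tgt S)) b') e),
          act (Het T) (Ident (free_mon (Tgt S)) b, l, l', h) e')"
      by (simp add: S.act_commute_tgt[OF e objs'(1-3) f k k' g])
    also have "\<dots> = ?R (b', act (Het S) (f, k, k', Ident (free_mon (Tgt S)) b') e,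
        act (Het T) (g, Ident (St T) s, Ident (St T) s', Ident (free_mon (Tgt T)) w')
          (act (Het T) (Ident (free_mon (Tgt S)) b, l, l', h) e'))"
      by (rule tcls_slide[OF g S.act_val[OF e f k k'] T.act_val[OF e' _ l l' h]])
        (use objs' b in simp_all)
    also have "\<dots> = ?R (b', act (Het S) (f, k, k', Ident (free_mon (Tgt S)) b') e,
        act (Het T) (Ident (free_mon (Tgt S)) b', l, l', h)
          (act (Het T) (g, Ident (St T) p, Ident (St T) p', Ident (free_mon (Tgt T)) w) e'))"
      using T.act_commute_src[OF e' objs'(4-6) _ l l' h] g by simp
    finally show "?R (?\<phi>
           (b, act (Het S) (Ident (free_mon (Src S)) u, Ident (St S) q, Ident (St S) q', g) e, e')) =
      ?R (?\<phi>
           (b', e, act (Het T) (g, Ident (St T) p, Ident (St T) p', Ident (free_mon (Tgt T)) w) e'))"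
      by simp
  qed (use objs' in simp_all)
  then show ?thesis
    using objs' by (simp add: tcomp_def coend_map_def)
qed

end

text \<open>By \<open>act_tcls\<close> the functor laws of the composite are those of the factors on
  a representative. With this, composites of composites are again instances of
  \<open>het_pair\<close>.\<close>

sublocale het_pair \<subseteq> tcomp: het "tcomp S T"
proof (rule het.intro)
  show "set_functor (shape (tcomp S T)) (Het (tcomp S T))"
    unfolding set_functor_def
  proof (intro conjI ballI impI)
    fix F K assume F: "F \<in> Ar (shape (tcomp S T))" and K: "K \<in> val (Het (tcomp S T)) (Dom (shape (tcomp S T)) F)"
    obtain f k l k' l' h where F_eq: "F = (f, (k, l), (k', l'), h)"
      by (metis prod.exhaust)
    have ars: "f \<in> Ar (free_mon (Src S))" "k \<in> Ar (St S)" "l \<in> Ar (St T)" "k' \<in> Ar (St S)" "l' \<in> Ar (St T)"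
      "h \<in> Ar (free_mon (Tgt T))"
      using F by (auto simp: F_eq shape_def)
    have "K \<in> val (Het (tcomp S T)) (Dom (free_mon (Src S)) f, (Cod (St S) k, Cod (St T) l),
        (Dom (St S) k', Dom (St T) l'), Cod (free_mon (Tgt T)) h)"
      using K by (simp add: F_eq shape_def)
    then obtain b e e' where b: "b \<in> Ob (free_mon (Tgt S))"
      and e: "e \<in> val (Het S) (Dom (free_mon (Src S)) f, Cod (St S) k, Dom (St S) k', b)"
      and e': "e' \<in> val (Het T) (b, Cod (St T) l, Dom (St T) l', Cod (free_mon (Tgt T)) h)"
      and K_eq: "K = tcls S T (Dom (free_mon (Src S)) f, (Cod (St S) k, Cod (St T) l),
        (Dom (St S) k', Dom (St T) l'), Cod (free_mon (Tgt T)) h) (b, e, e')"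
      by (rule val_tcomp_cases)
    note homs = ars[THEN hom_self]
    have act_F: "act (Het (tcomp S T)) F K = tcls S T (Cod (free_mon (Src S)) f, (Dom (St S) k, Dom (St T) l),
        (Cod (St S) k', Cod (St T) l'), Dom (free_mon (Tgt T)) h)
        (b, act (Het S) (f, k, k', Ident (free_mon (Tgt S)) b) e, act (Het T) (Ident (free_mon (Tgt S)) b, l, l', h) e')"
      unfolding F_eq K_eq by (rule act_tcls[OF e e' b homs(1,6,2,4,3,5)])
    have "\<dots> \<in> val (Het (tcomp S T)) (Cod (shape (tcomp S T)) F)"
      using b by (auto simp: F_eq shape_def intro!: tcls_val S.act_val[OF e homs(1,2,4)] T.act_val[OF e' _ homs(3,5,6)])
    then show "act (Het (tcomp S T)) F K \<in> val (Het (tcomp S T)) (Cod (shape (tcomp S T)) F)"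
      by (simp only: act_F)
    fix F' assume F': "F' \<in> Ar (shape (tcomp S T))" and "Cod (shape (tcomp S T)) F = Dom (shape (tcomp S T)) F'"
    obtain f' m n m' n' i where F'_eq: "F' = (f', (m, n), (m', n'), i)"
      by (metis prod.exhaust)
    have homs': "f' \<in> hom (free_mon (Src S)) (Cod (free_mon (Src S)) f) (Cod (free_mon (Src S)) f')"
      "m \<in> hom (St S) (Dom (St S) m) (Dom (St S) k)" "n \<in> hom (St T) (Dom (St T) n) (Dom (St T) l)"
      "m' \<in> hom (St S) (Cod (St S) k') (Cod (St S) m')" "n' \<in> hom (St T) (Cod (St T) l') (Cod (St T) n')"
      "i \<in> hom (free_mon (Tgt T)) (Dom (free_mon (Tgt T)) i) (Dom (free_mon (Tgt T)) h)"
      using F' \<open>Cod (shape (tcomp S T)) F = _\<close> by (simp_all add: F_eq F'_eq shape_def hom_def)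
    \<comment> \<open>Both sides become classes over the same list \<open>b\<close>: in each factor
      the actions compose, and the two identities at \<open>b\<close> compose to an
      identity.\<close>
    show "act (Het (tcomp S T)) (Comp (shape (tcomp S T)) F' F) K =
        act (Het (tcomp S T)) F' (act (Het (tcomp S T)) F K)"
      unfolding act_F unfolding F_eq K_eq F'_eq using b
      by (simp add: shape_def
          act_tcls[OF e e' b hom_Comp[OF _ homs(1) homs'(1)] hom_Comp[OF _ homs'(6) homs(6)]
            hom_Comp[OF _ homs'(2) homs(2)] hom_Comp[OF _ homs(4) homs'(4)]
            hom_Comp[OF _ homs'(3) homs(3)] hom_Comp[OF _ homs(5) homs'(5)]]
          act_tcls[OF S.act_val[OF e homs(1,2,4), where b' = b] T.act_val[OF e' _ homs(3,5,6), where u' = b]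
            b homs'(1,6,2,4,3,5)]
          S.act_act[OF e homs(1,2,4) _ homs'(1,2,4), where b' = b and b'' = b]
          T.act_act[OF e' _ homs(3,5,6) _ homs'(3,5,6), where u' = b and u'' = b])
  next
    fix i K assume i: "i \<in> Ob (shape (tcomp S T))" and K: "K \<in> val (Het (tcomp S T)) i"
    obtain u q p q' p' w where i_eq: "i = (u, (q, p), (q', p'), w)"
      by (metis prod.exhaust)
    have objs: "u \<in> Ob (free_mon (Src S))" "q \<in> Ob (St S)" "p \<in> Ob (St T)" "q' \<in> Ob (St S)" "p' \<in> Ob (St T)"
      "w \<in> Ob (free_mon (Tgt T))"
      using i by (auto simp: i_eq shape_def)
    obtain b e e' where b: "b \<in> Ob (free_mon (Tgt S))" and e: "e \<in> val (Het S) (u, q, q', b)"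
      and e': "e' \<in> val (Het T) (b, p, p', w)" and K_eq: "K = tcls S T i (b, e, e')"
      using K unfolding i_eq by (rule val_tcomp_cases)
    show "act (Het (tcomp S T)) (Ident (shape (tcomp S T)) i) K = K"
      unfolding K_eq i_eq shape_def using b objs T.act_ident[OF e']
      by (simp add: act_tcls[OF e e' b, where u' = u and r = q and r' = q' and s = p and s' = p' and w' = w] S.act_ident[OF e])
  qed
qed simp_all

lemma hom_append: "f \<in> hom (free_mon C) a b \<Longrightarrow> f' \<in> hom (free_mon C) a' b' \<Longrightarrow> f @ f' \<in> hom (free_mon C) (a @ a') (b @ b')"
  by (simp add: hom_def)

section \<open>Lax monoidal structure of a 2-transducer and the tensor on classes\<close>

locale lax_het = het +
  assumes lax_structure: "lax_structure T"
begin

lemma tens_val: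
  assumes "u \<in> Ob (free_mon (Src T))" "u' \<in> Ob (free_mon (Src T))"
    "q \<in> Ob (St T)" "r \<in> Ob (St T)" "q' \<in> Ob (St T)" "b \<in> Ob (free_mon (Tgt T))" "b' \<in> Ob (free_mon (Tgt T))"
    "e \<in> val (Het T) (u, q, r, b)" "e' \<in> val (Het T) (u', r, q', b')"
  shows "Tens T (u, q, r, b) (u', r, q', b') e e' \<in> val (Het T) (u @ u', q, q', b @ b')"
  using lax_structure[unfolded lax_structure_def Let_def, THEN conjunct1] assms by blast

lemma tens_nat:
  assumes e: "e \<in> val (Het T) (u, q, r, b)" and e': "e' \<in> val (Het T) (u', r, q', b')" and r: "r \<in> Ob (St T)"
    and f: "f \<in> hom (free_mon (Src T)) u v" and f': "f' \<in> hom (free_mon (Src T)) u' v'"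
    and k: "k \<in> hom (St T) p q" and k': "k' \<in> hom (St T) q' p'"
    and g: "g \<in> hom (free_mon (Tgt T)) c b" and g': "g' \<in> hom (free_mon (Tgt T)) c' b'"
  shows "Tens T (v, p, r, c) (v', r, p', c') (act (Het T) (f, k, Ident (St T) r, g) e) (act (Het T) (f', Ident (St T) r, k', g') e') =
    act (Het T) (f @ f', k, k', g @ g') (Tens T (u, q, r, b) (u', r, q', b') e e')"
proof -
  have "\<forall>f \<in> Ar (free_mon (Src T)). \<forall>f' \<in> Ar (free_mon (Src T)). \<forall>k \<in> Ar (St T). \<forall>r \<in> Ob (St T). \<forall>k'' \<in> Ar (St T).
      \<forall>g \<in> Ar (free_mon (Tgt T)). \<forall>g' \<in> Ar (free_mon (Tgt T)).
      \<forall>e \<in> val (Het T) (Dom (free_mon (Src T)) f, Cod (St T) k, r, Cod (free_mon (Tgt T)) g).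
      \<forall>e' \<in> val (Het T) (Dom (free_mon (Src T)) f', r, Dom (St T) k'', Cod (free_mon (Tgt T)) g').
         Tens T (Cod (free_mon (Src T)) f, Dom (St T) k, r, Dom (free_mon (Tgt T)) g)
           (Cod (free_mon (Src T)) f', r, Cod (St T) k'', Dom (free_mon (Tgt T)) g')
            (act (Het T) (f, k, Ident (St T) r, g) e) (act (Het T) (f', Ident (St T) r, k'', g') e')
         = act (Het T) (f @ f', k, k'', g @ g')
            (Tens T (Dom (free_mon (Src T)) f, Cod (St T) k, r, Cod (free_mon (Tgt T)) g)
              (Dom (free_mon (Src T)) f', r, Dom (St T) k'', Cod (free_mon (Tgt T)) g') e e')"
    by (rule lax_structure[unfolded lax_structure_def Let_def, THEN conjunct2, THEN conjunct1])
  then show ?thesis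
    using assms unfolding hom_def by blast
qed

lemma unt_val: "h \<in> Ar (St T) \<Longrightarrow> Unt T h \<in> val (Het T) ([], Dom (St T) h, Cod (St T) h, [])"
  using lax_structure[unfolded lax_structure_def Let_def, THEN conjunct2, THEN conjunct2, THEN conjunct2, THEN conjunct1]
  by blast

context
  fixes u u' q r q' b b' e e'
  assumes objs: "u \<in> Ob (free_mon (Src T))" "u' \<in> Ob (free_mon (Src T))"
    "q \<in> Ob (St T)" "r \<in> Ob (St T)" "q' \<in> Ob (St T)" "b \<in> Ob (free_mon (Tgt T))" "b' \<in> Ob (free_mon (Tgt T))"
    and e: "e \<in> val (Het T) (u, q, r, b)" and e': "e' \<in> val (Het T) (u', r, q', b')"
begin

text \<open>This lemma and its three companions are \<open>tens_nat\<close> with identities in all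
  variables but one, the identity action on the untouched argument being removed by
  \<open>act_ident\<close>. They cover the slides of a tensor of classes: a morphism in the target
  variable of the first factor or in the source variable of the second, in the left or the right
  argument of \<open>Tens\<close>.\<close>

lemma tens_nat_tgt:
  assumes "g \<in> hom (free_mon (Tgt T)) c b"
  shows "Tens T (u, q, r, c) (u', r, q', b') (act (Het T) (Ident (free_mon (Src T)) u, Ident (St T) q, Ident (St T) r, g) e) e' =
    act (Het T) (Ident (free_mon (Src T)) (u @ u'), Ident (St T) q, Ident (St T) q', g @ Ident (free_mon (Tgt T)) b')
      (Tens T (u, q, r, b) (u', r, q', b') e e')"
  using tens_nat[OF e e' objs(4) _ _ _ _ assms, of "Ident (free_mon (Src T)) u" u "Ident (free_mon (Src T)) u'" u'
      "Ident (St T) q" q "Ident (St T) q'" q' "Ident (free_mon (Tgt T)) b'" b'] objs act_ident[OF e']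
  by simp

lemma tens_nat_tgt':
  assumes "g \<in> hom (free_mon (Tgt T)) c b'"
  shows "Tens T (u, q, r, b) (u', r, q', c) e (act (Het T) (Ident (free_mon (Src T)) u', Ident (St T) r, Ident (St T) q', g) e') =
    act (Het T) (Ident (free_mon (Src T)) (u @ u'), Ident (St T) q, Ident (St T) q', Ident (free_mon (Tgt T)) b @ g)
      (Tens T (u, q, r, b) (u', r, q', b') e e')"
  using tens_nat[OF e e' objs(4) _ _ _ _ _ assms, of "Ident (free_mon (Src T)) u" u "Ident (free_mon (Src T)) u'" u'
      "Ident (St T) q" q "Ident (St T) q'" q' "Ident (free_mon (Tgt T)) b" b] objs act_ident[OF e]
  by simp

lemma tens_nat_src:
  assumes "f \<in> hom (free_mon (Src T)) u v"
  shows "Tens T (v, q, r, b) (u', r, q', b') (act (Het T) (f, Ident (St T) q, Ident (St T) r, Ident (free_mon (Tgt T)) b) e) e' =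
    act (Het T) (f @ Ident (free_mon (Src T)) u', Ident (St T) q, Ident (St T) q', Ident (free_mon (Tgt T)) (b @ b'))
      (Tens T (u, q, r, b) (u', r, q', b') e e')"
  using tens_nat[OF e e' objs(4) assms, of "Ident (free_mon (Src T)) u'" u'
      "Ident (St T) q" q "Ident (St T) q'" q' "Ident (free_mon (Tgt T)) b" b "Ident (free_mon (Tgt T)) b'" b'] objs act_ident[OF e']
  by simp

lemma tens_nat_src':
  assumes "f \<in> hom (free_mon (Src T)) u' v"
  shows "Tens T (u, q, r, b) (v, r, q', b') e (act (Het T) (f, Ident (St T) r, Ident (St T) q', Ident (free_mon (Tgt T)) b') e') =
    act (Het T) (Ident (free_mon (Src T)) u @ f, Ident (St T) q, Ident (St T) q', Ident (free_mon (Tgt T)) (b @ b'))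
      (Tens T (u, q, r, b) (u', r, q', b') e e')"
  using tens_nat[OF e e' objs(4) _ assms, of "Ident (free_mon (Src T)) u" u
      "Ident (St T) q" q "Ident (St T) q'" q' "Ident (free_mon (Tgt T)) b" b "Ident (free_mon (Tgt T)) b'" b'] objs act_ident[OF e]
  by simp

end

end

locale lax_pair = het_pair S T + S: lax_het S + T: lax_het T
  for S :: "('a, 'am, 'b, 'bm, 'q, 'qm, 'e) tdx" and T :: "('b, 'bm, 'c, 'cm, 'p, 'pm, 'f) tdx"
begin

text \<open>A binary operation on classes is well defined once it respects slides in each argument
  separately. A morphism \<open>g\<close> slid in the right argument becomes the slide of
  \<open>Ident b @ g\<close> between the concatenated lists, one in the left argument that of
  \<open>g @ Ident b'\<close>; naturality of \<open>Tens\<close> in both factors identifies the two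
  descriptions.\<close>

lemma tens_tcls:
  assumes objs: "u \<in> Ob (free_mon (Src S))" "q \<in> Ob (St S)" "r \<in> Ob (St S)" "p \<in> Ob (St T)" "s \<in> Ob (St T)"
      "c \<in> Ob (free_mon (Tgt T))" "b \<in> Ob (free_mon (Tgt S))"
    and objs': "u' \<in> Ob (free_mon (Src S))" "q' \<in> Ob (St S)" "p' \<in> Ob (St T)" "c' \<in> Ob (free_mon (Tgt T))"
      "b' \<in> Ob (free_mon (Tgt S))"
    and e: "e \<in> val (Het S) (u, q, r, b)" and f: "f \<in> val (Het T) (b, p, s, c)"
    and e': "e' \<in> val (Het S) (u', r, q', b')" and f': "f' \<in> val (Het T) (b', s, p', c')"
  shows "Tens (tcomp S T) (u, (q, p), (r, s), c) (u', (r, s), (q', p'), c')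
      (tcls S T (u, (q, p), (r, s), c) (b, e, f)) (tcls S T (u', (r, s), (q', p'), c') (b', e', f')) =
    tcls S T (u @ u', (q, p), (q', p'), c @ c')
      (b @ b', Tens S (u, q, r, b) (u', r, q', b') e e', Tens T (b, p, s, c) (b', s, p', c') f f')"
proof -
  let ?W = "\<lambda>(b, e, f) (b', e', f'). tcls S T (u @ u', (q, p), (q', p'), c @ c')
      (b @ b', Tens S (u, q, r, b) (u', r, q', b') e e', Tens T (b, p, s, c) (b', s, p', c') f f')"
  \<comment> \<open>The left representative is kept general, since the slide in the left argument
    below evaluates the inner union at both of its ends.\<close>
  have inner: "(\<Union>y \<in> tcls S T (u', (r, s), (q', p'), c') (b', e', f'). ?W (b, e, f) y) = ?W (b, e, f) (b', e', f')"
    if b: "b \<in> Ob (free_mon (Tgt S))" and e: "e \<in> val (Het S) (u, q, r, b)" and f: "f \<in> val (Het T) (b, p, s, c)"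
    for b e f
  proof (rule UN_tcls, rule cowedgeI)
    fix g d d' e' f'
    assume d: "d \<in> Ob (free_mon (Tgt S))" "d' \<in> Ob (free_mon (Tgt S))" and g: "g \<in> hom (free_mon (Tgt S)) d d'"
      and e': "e' \<in> val (Het S) (u', r, q', d')" and f': "f' \<in> val (Het T) (d, s, p', c')"
    have "tcls S T (u @ u', (q, p), (q', p'), c @ c') (b @ d,
        act (Het S) (Ident (free_mon (Src S)) (u @ u'), Ident (St S) q, Ident (St S) q', Ident (free_mon (Tgt S)) b @ g)
          (Tens S (u, q, r, b) (u', r, q', d') e e'),
        Tens T (b, p, s, c) (d, s, p', c') f f') =
      tcls S T (u @ u', (q, p), (q', p'), c @ c') (b @ d', Tens S (u, q, r, b) (u', r, q', d') e e',
        act (Het T) (Ident (free_mon (Tgt S)) b @ g, Ident (St T) p, Ident (St T) p', Ident (free_mon (Tgt T)) (c @ c'))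
          (Tens T (b, p, s, c) (d, s, p', c') f f'))"
      \<comment> \<open>\<open>tcls_slide\<close> has the identity of the whole list
        \<open>u @ u'\<close>, as do the naturality lemmas for \<open>Tens\<close>;
        \<open>free_mon_append(5)\<close> would split it and spoil the match.\<close>
      by (rule tcls_slide) (use objs objs' b d g e f e' f' in \<open>simp_all add: hom_append S.tens_val T.tens_val del: free_mon_append(5)\<close>)
    then show "?W (b, e, f) (d, act (Het S) (Ident (free_mon (Src S)) u', Ident (St S) r, Ident (St S) q', g) e', f') =
        ?W (b, e, f) (d', e', act (Het T) (g, Ident (St T) s, Ident (St T) p', Ident (free_mon (Tgt T)) c') f')"
      using objs objs' b d g e f e' f' by (simp add: S.tens_nat_tgt' T.tens_nat_src' del: free_mon_append(5))
  qed (use objs objs' in simp_all)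
  have "(\<Union>x \<in> tcls S T (u, (q, p), (r, s), c) (b, e, f). \<Union>y \<in> tcls S T (u', (r, s), (q', p'), c') (b', e', f'). ?W x y) =
    (\<Union>y \<in> tcls S T (u', (r, s), (q', p'), c') (b', e', f'). ?W (b, e, f) y)"
  proof (rule UN_tcls, rule cowedgeI)
    fix g d d' e f
    assume d: "d \<in> Ob (free_mon (Tgt S))" "d' \<in> Ob (free_mon (Tgt S))" and g: "g \<in> hom (free_mon (Tgt S)) d d'"
      and e: "e \<in> val (Het S) (u, q, r, d')" and f: "f \<in> val (Het T) (d, p, s, c)"
    \<comment> \<open>These are the acted entries at the two ends of the slide, where
      \<open>inner\<close> is applied.\<close>
    have eg: "act (Het S) (Ident (free_mon (Src S)) u, Ident (St S) q, Ident (St S) r, g) e \<in> val (Het S) (u, q, r, d)"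
      by (rule S.act_val[OF e]) (use objs g in simp_all)
    have gf: "act (Het T) (g, Ident (St T) p, Ident (St T) s, Ident (free_mon (Tgt T)) c) f \<in> val (Het T) (d', p, s, c)"
      by (rule T.act_val[OF f]) (use objs g in simp_all)
    have "tcls S T (u @ u', (q, p), (q', p'), c @ c') (d @ b',
        act (Het S) (Ident (free_mon (Src S)) (u @ u'), Ident (St S) q, Ident (St S) q', g @ Ident (free_mon (Tgt S)) b')
          (Tens S (u, q, r, d') (u', r, q', b') e e'),
        Tens T (d, p, s, c) (b', s, p', c') f f') =
      tcls S T (u @ u', (q, p), (q', p'), c @ c') (d' @ b', Tens S (u, q, r, d') (u', r, q', b') e e',
        act (Het T) (g @ Ident (free_mon (Tgt S)) b', Ident (St T) p, Ident (St T) p', Ident (free_mon (Tgt T)) (c @ c'))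
          (Tens T (d, p, s, c) (b', s, p', c') f f'))"
      by (rule tcls_slide) (use objs objs' d g e f e' f' in \<open>simp_all add: hom_append S.tens_val T.tens_val del: free_mon_append(5)\<close>)
    then show "(\<Union>y \<in> tcls S T (u', (r, s), (q', p'), c') (b', e', f').
          ?W (d, act (Het S) (Ident (free_mon (Src S)) u, Ident (St S) q, Ident (St S) r, g) e, f) y) =
        (\<Union>y \<in> tcls S T (u', (r, s), (q', p'), c') (b', e', f').
          ?W (d', e, act (Het T) (g, Ident (St T) p, Ident (St T) s, Ident (free_mon (Tgt T)) c) f) y)"
      unfolding inner[OF d(1) eg f] inner[OF d(2) e gf]
      using objs objs' d g e f e' f' by (simp add: S.tens_nat_tgt T.tens_nat_src del: free_mon_append(5))
  qed (use objs objs' in simp_all)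
  also note inner[OF objs(7) e f]
  finally show ?thesis
    by (simp add: tcomp_def case_prod_unfold)
qed

lemma unt_tcomp:
  "Unt (tcomp S T) (h, l) = tcls S T ([], (Dom (St S) h, Dom (St T) l), (Cod (St S) h, Cod (St T) l), []) ([], Unt S h, Unt T l)"
  by (simp add: tcomp_def)

end


section \<open>Two-cells\<close>

lemma is_functor_D:
  assumes "is_functor C D F"
  shows "a \<in> Ob C \<Longrightarrow> onOb F a \<in> Ob D" "f \<in> Ar C \<Longrightarrow> onAr F f \<in> Ar D"
    "f \<in> Ar C \<Longrightarrow> Dom D (onAr F f) = onOb F (Dom C f)" "f \<in> Ar C \<Longrightarrow> Cod D (onAr F f) = onOb F (Cod C f)"
    "a \<in> Ob C \<Longrightarrow> onAr F (Ident C a) = Ident D (onOb F a)"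
    "f \<in> Ar C \<Longrightarrow> g \<in> Ar C \<Longrightarrow> Cod C f = Dom C g \<Longrightarrow> onAr F (Comp C g f) = Comp D (onAr F g) (onAr F f)"
  using assms by (auto simp: is_functor_def)

lemma two_cell_functor: "two_cell S T c \<Longrightarrow> is_functor (St S) (St T) (stF c)"
  by (simp add: two_cell_def is_cell_def)

lemma two_cell_val:
  assumes "two_cell S T c" "u \<in> Ob (free_mon (Src S))" "q \<in> Ob (St S)" "q' \<in> Ob (St S)" "b \<in> Ob (free_mon (Tgt S))"
    "e \<in> val (Het S) (u, q, q', b)"
  shows "cmpt c (u, q, q', b) e \<in> val (Het T) (u, onOb (stF c) q, onOb (stF c) q', b)"
proof -
  have "(u, q, q', b) \<in> Ob (shape S)"
    using assms by (simp add: shape_def)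
  then have "cmpt c (u, q, q', b) e \<in>
      val (pullback (prodF (starF idF) (prodF (stF c) (prodF (stF c) (starF idF)))) (Het T)) (u, q, q', b)"
    using assms(1,6) unfolding two_cell_def is_cell_def nat_trans_def by blast
  then show ?thesis
    by simp
qed

lemma two_cell_nat:
  assumes c: "two_cell S T c" and e: "e \<in> val (Het S) (u, q, q', b)"
    and f: "f \<in> hom (free_mon (Src S)) u u'" and k: "k \<in> hom (St S) p q" and l: "l \<in> hom (St S) q' p'"
    and g: "g \<in> hom (free_mon (Tgt S)) b' b"
  shows "cmpt c (u', p, p', b') (act (Het S) (f, k, l, g) e) =
    act (Het T) (f, onAr (stF c) k, onAr (stF c) l, g) (cmpt c (u, q, q', b) e)"
proof -
  have "(f, k, l, g) \<in> Ar (shape S)" and D: "Dom (shape S) (f, k, l, g) = (u, q, q', b)"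
    and C: "Cod (shape S) (f, k, l, g) = (u', p, p', b')"
    using f k l g by (auto simp: shape_def hom_def)
  moreover have "e \<in> val (Het S) (Dom (shape S) (f, k, l, g))"
    using e D by simp
  ultimately have "cmpt c (Cod (shape S) (f, k, l, g)) (act (Het S) (f, k, l, g) e) =
      act (pullback (prodF (starF idF) (prodF (stF c) (prodF (stF c) (starF idF)))) (Het T)) (f, k, l, g)
        (cmpt c (Dom (shape S) (f, k, l, g)) e)"
    using c unfolding two_cell_def is_cell_def nat_trans_def by blast
  then show ?thesis
    by (simp add: C D)
qed

lemma (in het) two_cell_id_cell: "two_cell T T id_cell"
  by (auto simp: two_cell_def is_cell_def id_cell_def is_functor_idF nat_trans_def shape_def)

text \<open>Naturality of \<open>c\<close> in the target variable and of \<open>d\<close> in the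
  source variable turns a slide for \<open>S\<close>, \<open>T\<close> into a slide for
  \<open>S'\<close>, \<open>T'\<close>.\<close>

lemma hcomp_tcls:
  assumes "het_pair S T" "het_pair S' T'" and c: "two_cell S S' c" and d: "two_cell T T' d"
    and objs: "u \<in> Ob (free_mon (Src S))" "q \<in> Ob (St S)" "q' \<in> Ob (St S)" "p \<in> Ob (St T)" "p' \<in> Ob (St T)"
      "w \<in> Ob (free_mon (Tgt T))"
  shows "cmpt (hcomp S' T' c d) (u, (q, p), (q', p'), w) (tcls S T (u, (q, p), (q', p'), w) (b, e, f)) =
    tcls S' T' (u, (onOb (stF c) q, onOb (stF d) p), (onOb (stF c) q', onOb (stF d) p'), w)
      (b, cmpt c (u, q, q', b) e, cmpt d (b, p, p', w) f)"
proof -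
  interpret ST: het_pair S T by fact
  interpret ST': het_pair S' T' by fact
  have [simp]: "Src S = Src S'" "Tgt S = Tgt S'" "Tgt T = Tgt T'"
    using c d by (auto simp: two_cell_def)
  have U: "is_functor (St S) (St S') (stF c)" and V: "is_functor (St T) (St T') (stF d)"
    using c d by (auto intro: two_cell_functor)
  let ?R = "tcls S' T' (u, (onOb (stF c) q, onOb (stF d) p), (onOb (stF c) q', onOb (stF d) p'), w)"
  let ?\<phi> = "\<lambda>(b, e, f). (b, cmpt c (u, q, q', b) e, cmpt d (b, p, p', w) f)"
  have "(\<Union>x \<in> tcls S T (u, (q, p), (q', p'), w) (b, e, f). ?R (?\<phi> x)) = ?R (?\<phi> (b, e, f))"
  proof (rule ST.UN_tcls, rule ST.cowedgeI)
    fix g b b' e f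
    assume b: "b \<in> Ob (free_mon (Tgt S))" "b' \<in> Ob (free_mon (Tgt S))" and g: "g \<in> hom (free_mon (Tgt S)) b b'"
      and e: "e \<in> val (Het S) (u, q, q', b')" and f: "f \<in> val (Het T) (b, p, p', w)"
    have "?R (b, act (Het S') (Ident (free_mon (Src S')) u, Ident (St S') (onOb (stF c) q),
          Ident (St S') (onOb (stF c) q'), g) (cmpt c (u, q, q', b') e), cmpt d (b, p, p', w) f) =
        ?R (b', cmpt c (u, q, q', b') e,
          act (Het T') (g, Ident (St T') (onOb (stF d) p), Ident (St T') (onOb (stF d) p'), Ident (free_mon (Tgt T')) w)
            (cmpt d (b, p, p', w) f))"
      by (rule ST'.tcls_slide) (use b objs g e f c d in \<open>auto simp: is_functor_D[OF U] is_functor_D[OF V]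
        intro!: two_cell_val[OF c] two_cell_val[OF d]\<close>)
    then show "?R (?\<phi> (b, act (Het S) (Ident (free_mon (Src S)) u, Ident (St S) q, Ident (St S) q', g) e, f)) =
        ?R (?\<phi> (b', e, act (Het T) (g, Ident (St T) p, Ident (St T) p', Ident (free_mon (Tgt T)) w) f))"
      using objs b g two_cell_nat[OF c e, of "Ident (free_mon (Src S)) u" u "Ident (St S) q" q "Ident (St S) q'" q' g b]
        two_cell_nat[OF d f, of g b' "Ident (St T) p" p "Ident (St T) p'" p' "Ident (free_mon (Tgt T)) w" w]
      by (simp add: is_functor_D[OF U] is_functor_D[OF V])
  qed (use objs in simp_all)
  then show ?thesis
    by (simp add: hcomp_def coend_map_def)
qed

lemma hcomp_stF [simp]: "stF (hcomp S T c d) = prodF (stF c) (stF d)"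
  by (simp add: hcomp_def)

lemma vcomp_simps [simp]:
  "stF (vcomp d c) = compF (stF d) (stF c)"
  "cmpt (vcomp d c) (u, q, q', b) e = cmpt d (u, onOb (stF c) q, onOb (stF c) q', b) (cmpt c (u, q, q', b) e)"
  by (simp_all add: vcomp_def)

lemma id_cell_simps [simp]: "stF id_cell = idF" "cmpt id_cell i e = e"
  by (simp_all add: id_cell_def)


section \<open>The identity 2-transducer\<close>

lemma iota_simps [simp]:
  "Src (iota A) = A" "Tgt (iota A) = A" "St (iota A) = terminal_cat"
  "val (Het (iota A)) (u, x, y, a) = hom (free_mon A) a u"
  "act (Het (iota A)) (f, k, l, g) e = Comp (free_mon A) f (Comp (free_mon A) e g)"
  "Tens (iota A) i i' e e' = e @ e'" "Unt (iota A) h = []"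
  by (simp_all add: iota_def)

text \<open>This is the hom-profunctor of \<open>A*\<close>, functorial by associativity of
  composition. It makes the composites with \<open>iota A\<close>, through which the unit laws pass,
  instances of \<open>het_pair\<close>.\<close>

lemma het_iota:
  assumes "category A"
  shows "het (iota A)"
proof -
  have "category (free_mon A)"
    using assms by simp
  then interpret M: category "free_mon A" .
  show ?thesis
    by (rule het.intro) (use assms in \<open>auto simp: set_functor_def shape_def hom_def M.comp_assoc\<close>)
qed


section \<open>Cells out of composites and identities\<close>

context lax_pair
begin

text \<open>Every element of the composite is the class of some \<open>(b, e, f)\<close>, and
  \<open>act_tcls\<close>, \<open>tens_tcls\<close> and \<open>unt_tcomp\<close> evaluate its
  structure on such triples, so each clause can be tested there. Dinaturality in \<open>b\<close>
  does not appear on the right because \<open>m\<close> is defined through the class of its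
  argument.\<close>

lemma two_cell_tcomp_iff:
  fixes R :: "('a, 'am, 'c, 'cm, 'r, 'rm, 'g) tdx"
  assumes [simp]: "Src R = Src S" "Tgt R = Tgt T"
  shows "two_cell (tcomp S T) R c \<longleftrightarrow>
    (let A = free_mon (Src S); B = free_mon (Tgt S); C = free_mon (Tgt T); P = onOb (stF c);
       m = (\<lambda>u q q' p p' w x. cmpt c (u, (q, p), (q', p'), w) (tcls S T (u, (q, p), (q', p'), w) x))
     in is_functor (St S \<times>\<^sub>c St T) (St R) (stF c) \<and>
     (\<forall>u \<in> Ob A. \<forall>b \<in> Ob B. \<forall>w \<in> Ob C. \<forall>q \<in> Ob (St S). \<forall>q' \<in> Ob (St S). \<forall>p \<in> Ob (St T). \<forall>p' \<in> Ob (St T).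
      \<forall>e \<in> val (Het S) (u, q, q', b). \<forall>f \<in> val (Het T) (b, p, p', w).
        m u q q' p p' w (b, e, f) \<in> val (Het R) (u, P (q, p), P (q', p'), w)) \<and>
     (\<forall>f \<in> Ar A. \<forall>k \<in> Ar (St S). \<forall>k' \<in> Ar (St S). \<forall>l \<in> Ar (St T). \<forall>l' \<in> Ar (St T). \<forall>h \<in> Ar C. \<forall>b \<in> Ob B.
      \<forall>e \<in> val (Het S) (Dom A f, Cod (St S) k, Dom (St S) k', b). \<forall>e' \<in> val (Het T) (b, Cod (St T) l, Dom (St T) l', Cod C h).
        m (Cod A f) (Dom (St S) k) (Cod (St S) k') (Dom (St T) l) (Cod (St T) l') (Dom C h)
          (b, act (Het S) (f, k, k', Ident B b) e, act (Het T) (Ident B b, l, l', h) e') =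
        act (Het R) (f, onAr (stF c) (k, l), onAr (stF c) (k', l'), h)
          (m (Dom A f) (Cod (St S) k) (Dom (St S) k') (Cod (St T) l) (Dom (St T) l') (Cod C h) (b, e, e'))) \<and>
     (\<forall>u \<in> Ob A. \<forall>u' \<in> Ob A. \<forall>b \<in> Ob B. \<forall>b' \<in> Ob B. \<forall>w \<in> Ob C. \<forall>w' \<in> Ob C.
      \<forall>q \<in> Ob (St S). \<forall>r \<in> Ob (St S). \<forall>q' \<in> Ob (St S). \<forall>p \<in> Ob (St T). \<forall>s \<in> Ob (St T). \<forall>p' \<in> Ob (St T).
      \<forall>e \<in> val (Het S) (u, q, r, b). \<forall>f \<in> val (Het T) (b, p, s, w).
      \<forall>e' \<in> val (Het S) (u', r, q', b'). \<forall>f' \<in> val (Het T) (b', s, p', w').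
        m (u @ u') q q' p p' (w @ w')
          (b @ b', Tens S (u, q, r, b) (u', r, q', b') e e', Tens T (b, p, s, w) (b', s, p', w') f f') =
        Tens R (u, P (q, p), P (r, s), w) (u', P (r, s), P (q', p'), w')
          (m u q r p s w (b, e, f)) (m u' r q' s p' w' (b', e', f'))) \<and>
     (\<forall>h \<in> Ar (St S). \<forall>l \<in> Ar (St T).
        m [] (Dom (St S) h) (Cod (St S) h) (Dom (St T) l) (Cod (St T) l) [] ([], Unt S h, Unt T l) =
        Unt R (onAr (stF c) (h, l))))"
    (is "_ \<longleftrightarrow> ?rhs")
proof
  assume c: "two_cell (tcomp S T) R c"
  have F: "is_functor (St S \<times>\<^sub>c St T) (St R) (stF c)"
    using two_cell_functor[OF c] by simp
  have tens: "cmpt c (u @ u', q, q', w @ w') (Tens (tcomp S T) (u, q, r, w) (u', r, q', w') K K') =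
      Tens R (u, onOb (stF c) q, onOb (stF c) r, w) (u', onOb (stF c) r, onOb (stF c) q', w')
       (cmpt c (u, q, r, w) K) (cmpt c (u', r, q', w') K')"
    if "u \<in> Ob (free_mon (Src S))" "u' \<in> Ob (free_mon (Src S))" "w \<in> Ob (free_mon (Tgt T))" "w' \<in> Ob (free_mon (Tgt T))"
     "q \<in> Ob (St S \<times>\<^sub>c St T)" "r \<in> Ob (St S \<times>\<^sub>c St T)" "q' \<in> Ob (St S \<times>\<^sub>c St T)"
     "K \<in> val (Het (tcomp S T)) (u, q, r, w)" "K' \<in> val (Het (tcomp S T)) (u', r, q', w')"
    for u u' w w' q r q' K K'
    using c that unfolding two_cell_def is_cell_def lists_Ob tcomp_simps ftor_simps(1) list.map_ident by blast
  have unt: "cmpt c ([], Dom (St S \<times>\<^sub>c St T) h, Cod (St S \<times>\<^sub>c St T) h, []) (Unt (tcomp S T) h) = Unt R (onAr (stF c) h)"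
    if "h \<in> Ar (St S \<times>\<^sub>c St T)" for h
    using c that unfolding two_cell_def is_cell_def tcomp_simps by blast
  show ?rhs
    unfolding Let_def
  proof (intro conjI ballI)
    show "is_functor (St S \<times>\<^sub>c St T) (St R) (stF c)" by (rule F)
  next
    fix u b w q q' p p' e f
    assume *: "u \<in> Ob (free_mon (Src S))" "b \<in> Ob (free_mon (Tgt S))" "w \<in> Ob (free_mon (Tgt T))"
     "q \<in> Ob (St S)" "q' \<in> Ob (St S)" "p \<in> Ob (St T)" "p' \<in> Ob (St T)" "e \<in> val (Het S) (u, q, q', b)" "f \<in> val (Het T) (b, p, p', w)"
    then show "cmpt c (u, (q, p), (q', p'), w) (tcls S T (u, (q, p), (q', p'), w) (b, e, f))
       \<in> val (Het R) (u, onOb (stF c) (q, p), onOb (stF c) (q', p'), w)"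
      by (intro two_cell_val[OF c]) (auto intro: tcls_val)
  next
    fix f k k' l l' h b e e'
    assume ars: "f \<in> Ar (free_mon (Src S))" "k \<in> Ar (St S)" "k' \<in> Ar (St S)" "l \<in> Ar (St T)" "l' \<in> Ar (St T)" "h \<in> Ar (free_mon (Tgt T))"
      and b: "b \<in> Ob (free_mon (Tgt S))"
      and e: "e \<in> val (Het S) (Dom (free_mon (Src S)) f, Cod (St S) k, Dom (St S) k', b)"
      and e': "e' \<in> val (Het T) (b, Cod (St T) l, Dom (St T) l', Cod (free_mon (Tgt T)) h)"
    note homs = ars[THEN hom_self]
    show "cmpt c (Cod (free_mon (Src S)) f, (Dom (St S) k, Dom (St T) l), (Cod (St S) k', Cod (St T) l'), Dom (free_mon (Tgt T)) h)
        (tcls S T (Cod (free_mon (Src S)) f, (Dom (St S) k, Dom (St T) l), (Cod (St S) k', Cod (St T) l'), Dom (free_mon (Tgt T)) h)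
          (b, act (Het S) (f, k, k', Ident (free_mon (Tgt S)) b) e, act (Het T) (Ident (free_mon (Tgt S)) b, l, l', h) e')) =
      act (Het R) (f, onAr (stF c) (k, l), onAr (stF c) (k', l'), h)
        (cmpt c (Dom (free_mon (Src S)) f, (Cod (St S) k, Cod (St T) l), (Dom (St S) k', Dom (St T) l'), Cod (free_mon (Tgt T)) h)
          (tcls S T (Dom (free_mon (Src S)) f, (Cod (St S) k, Cod (St T) l), (Dom (St S) k', Dom (St T) l'), Cod (free_mon (Tgt T)) h)
          (b, e, e')))"
      unfolding act_tcls[OF e e' b homs(1,6,2,3,4,5), symmetric]
      by (rule two_cell_nat[OF c]) (use ars in \<open>auto simp: hom_def intro!: tcls_val[OF b e e']\<close>)
  next
    fix u u' b b' w w' q r q' p s p' e f e' f'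
    assume *: "u \<in> Ob (free_mon (Src S))" "u' \<in> Ob (free_mon (Src S))" "b \<in> Ob (free_mon (Tgt S))" "b' \<in> Ob (free_mon (Tgt S))"
      "w \<in> Ob (free_mon (Tgt T))" "w' \<in> Ob (free_mon (Tgt T))"
      "q \<in> Ob (St S)" "r \<in> Ob (St S)" "q' \<in> Ob (St S)" "p \<in> Ob (St T)" "s \<in> Ob (St T)" "p' \<in> Ob (St T)"
      "e \<in> val (Het S) (u, q, r, b)" "f \<in> val (Het T) (b, p, s, w)"
      "e' \<in> val (Het S) (u', r, q', b')" "f' \<in> val (Het T) (b', s, p', w')"
    then show "cmpt c (u @ u', (q, p), (q', p'), w @ w') (tcls S T (u @ u', (q, p), (q', p'), w @ w')
          (b @ b', Tens S (u, q, r, b) (u', r, q', b') e e', Tens T (b, p, s, w) (b', s, p', w') f f')) =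
        Tens R (u, onOb (stF c) (q, p), onOb (stF c) (r, s), w) (u', onOb (stF c) (r, s), onOb (stF c) (q', p'), w')
          (cmpt c (u, (q, p), (r, s), w) (tcls S T (u, (q, p), (r, s), w) (b, e, f)))
          (cmpt c (u', (r, s), (q', p'), w') (tcls S T (u', (r, s), (q', p'), w') (b', e', f')))"
      by (subst tens_tcls[symmetric]; (assumption)?) (auto intro!: tens tcls_val)
  next
    fix h l assume "h \<in> Ar (St S)" "l \<in> Ar (St T)"
    then show "cmpt c ([], (Dom (St S) h, Dom (St T) l), (Cod (St S) h, Cod (St T) l), [])
        (tcls S T ([], (Dom (St S) h, Dom (St T) l), (Cod (St S) h, Cod (St T) l), []) ([], Unt S h, Unt T l)) =
       Unt R (onAr (stF c) (h, l))"
      using unt[of "(h, l)"] by (simp add: unt_tcomp)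
  qed
next
  assume rhs: ?rhs
  note rhs = rhs[unfolded Let_def]
  note F = rhs[THEN conjunct1]
    and val = rhs[THEN conjunct2, THEN conjunct1, rule_format]
    and nat = rhs[THEN conjunct2, THEN conjunct2, THEN conjunct1, rule_format]
    and tens = rhs[THEN conjunct2, THEN conjunct2, THEN conjunct2, THEN conjunct1, rule_format]
    and unt = rhs[THEN conjunct2, THEN conjunct2, THEN conjunct2, THEN conjunct2, rule_format]
  show "two_cell (tcomp S T) R c"
    unfolding two_cell_def is_cell_def
  proof (intro conjI ballI)
    show "nat_trans (shape (tcomp S T)) (Het (tcomp S T))
        (pullback (prodF (starF idF) (prodF (stF c) (prodF (stF c) (starF idF)))) (Het R)) (cmpt c)"
      unfolding nat_trans_def
    proof (intro conjI ballI)
      fix i K assume i: "i \<in> Ob (shape (tcomp S T))" and K: "K \<in> val (Het (tcomp S T)) i"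
      obtain u q p q' p' w where i_eq: "i = (u, (q, p), (q', p'), w)"
        by (metis prod.exhaust)
      show "cmpt c i K \<in> val (pullback (prodF (starF idF) (prodF (stF c) (prodF (stF c) (starF idF)))) (Het R)) i"
        using K[unfolded i_eq] i by (cases rule: val_tcomp_cases) (auto simp: i_eq shape_def intro: val)
    next
      fix F K assume F: "F \<in> Ar (shape (tcomp S T))" and K: "K \<in> val (Het (tcomp S T)) (Dom (shape (tcomp S T)) F)"
      obtain f k l k' l' h where F_eq: "F = (f, (k, l), (k', l'), h)"
        by (metis prod.exhaust)
      have ars: "f \<in> Ar (free_mon (Src S))" "k \<in> Ar (St S)" "l \<in> Ar (St T)" "k' \<in> Ar (St S)" "l' \<in> Ar (St T)"
        "h \<in> Ar (free_mon (Tgt T))"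
        using F by (auto simp: F_eq shape_def)
      note homs = ars[THEN hom_self]
      have "K \<in> val (Het (tcomp S T)) (Dom (free_mon (Src S)) f, (Cod (St S) k, Cod (St T) l),
          (Dom (St S) k', Dom (St T) l'), Cod (free_mon (Tgt T)) h)"
        using K by (simp add: F_eq shape_def)
      then show "cmpt c (Cod (shape (tcomp S T)) F) (act (Het (tcomp S T)) F K) =
        act (pullback (prodF (starF idF) (prodF (stF c) (prodF (stF c) (starF idF)))) (Het R)) F (cmpt c (Dom (shape (tcomp S T)) F) K)"
      proof (cases rule: val_tcomp_cases)
        case (1 b e e')
        show ?thesis
          unfolding F_eq 1(4)
          using nat[OF ars(1,2,4,3,5,6) 1(1-3)] act_tcls[OF 1(2,3,1) homs(1,6,2,4,3,5)] by (simp add: shape_def)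
      qed
    qed
  next
    fix u u' q r q' w w' K K'
    assume *: "u \<in> lists (Ob (Src (tcomp S T)))" "u' \<in> lists (Ob (Src (tcomp S T)))"
     "q \<in> Ob (St (tcomp S T))" "r \<in> Ob (St (tcomp S T))" "q' \<in> Ob (St (tcomp S T))"
     "w \<in> lists (Ob (Tgt (tcomp S T)))" "w' \<in> lists (Ob (Tgt (tcomp S T)))"
     and K: "K \<in> val (Het (tcomp S T)) (u, q, r, w)" and K': "K' \<in> val (Het (tcomp S T)) (u', r, q', w')"
    obtain q1 q2 r1 r2 q1' q2' where eqs: "q = (q1, q2)" "r = (r1, r2)" "q' = (q1', q2')"
      by (metis prod.exhaust)
    note * = *[unfolded lists_Ob]
    show "cmpt c (u @ u', q, q', w @ w') (Tens (tcomp S T) (u, q, r, w) (u', r, q', w') K K') =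
      Tens R (map (onOb idF) u, onOb (stF c) q, onOb (stF c) r, map (onOb idF) w)
        (map (onOb idF) u', onOb (stF c) r, onOb (stF c) q', map (onOb idF) w')
        (cmpt c (u, q, r, w) K) (cmpt c (u', r, q', w') K')"
      using K[unfolded eqs]
    proof (cases rule: val_tcomp_cases)
      case K: (1 b e f)
      show ?thesis
        using K'[unfolded eqs]
      proof (cases rule: val_tcomp_cases)
        case K': (1 b' e' f')
        show ?thesis
          unfolding K(4) K'(4) using * K(1-3) K'(1-3) by (simp add: eqs tens_tcls tens)
      qed
    qed
  next
    fix h assume "h \<in> Ar (St (tcomp S T))"
    then show "cmpt c ([], Dom (St (tcomp S T)) h, Cod (St (tcomp S T)) h, []) (Unt (tcomp S T) h) = Unt R (onAr (stF c) h)"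
      by (cases h) (simp add: unt_tcomp unt)
  qed (simp_all add: is_functor_idF F)
qed

end

text \<open>A functor out of the terminal category is an object together with its identity, and an
  element of \<open>iota A\<close> at \<open>(u, (), (), a)\<close> is an arrow
  \<open>a \<rightarrow> u\<close>. A family indexed by objects and elements is thus one indexed by
  the arrows of \<open>A*\<close>.\<close>

lemma two_cell_iota_iff:
  assumes A: "category A" and [simp]: "Src T = A" "Tgt T = A" and St: "category (St T)"
  shows "two_cell (iota A) T c \<longleftrightarrow>
    (let C = free_mon A; j = onOb (stF c) (); m = (\<lambda>u a f. cmpt c (u, (), (), a) f)
     in j \<in> Ob (St T) \<and> onAr (stF c) () = Ident (St T) j \<and>
     (\<forall>f \<in> Ar C. m (Cod C f) (Dom C f) f \<in> val (Het T) (Cod C f, j, j, Dom C f)) \<and>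
     (\<forall>h \<in> Ar C. \<forall>f \<in> Ar C. \<forall>g \<in> Ar C. Cod C h = Dom C f \<and> Cod C f = Dom C g \<longrightarrow>
        m (Cod C g) (Dom C h) (Comp C g (Comp C f h)) =
        act (Het T) (g, Ident (St T) j, Ident (St T) j, h) (m (Cod C f) (Dom C f) f)) \<and>
     (\<forall>f \<in> Ar C. \<forall>f' \<in> Ar C. m (Cod C f @ Cod C f') (Dom C f @ Dom C f') (f @ f') =
       Tens T (Cod C f, j, j, Dom C f) (Cod C f', j, j, Dom C f')
         (m (Cod C f) (Dom C f) f) (m (Cod C f') (Dom C f') f')) \<and>
     m [] [] [] = Unt T (Ident (St T) j))"
proof -
  have fun_iff: "is_functor terminal_cat (St T) (stF c) \<longleftrightarrow>
     onOb (stF c) () \<in> Ob (St T) \<and> onAr (stF c) () = Ident (St T) (onOb (stF c) ())"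
    using St by (auto simp: is_functor_def)
  have nat_iff: "nat_trans (shape (iota A)) (Het (iota A))
      (pullback (prodF (starF idF) (prodF (stF c) (prodF (stF c) (starF idF)))) (Het T)) (cmpt c) \<longleftrightarrow>
     (\<forall>f \<in> Ar (free_mon A). cmpt c (Cod (free_mon A) f, (), (), Dom (free_mon A) f) f
        \<in> val (Het T) (Cod (free_mon A) f, onOb (stF c) (), onOb (stF c) (), Dom (free_mon A) f)) \<and>
     (\<forall>h \<in> Ar (free_mon A). \<forall>f \<in> Ar (free_mon A). \<forall>g \<in> Ar (free_mon A).
        Cod (free_mon A) h = Dom (free_mon A) f \<and> Cod (free_mon A) f = Dom (free_mon A) g \<longrightarrow>
        cmpt c (Cod (free_mon A) g, (), (), Dom (free_mon A) h) (Comp (free_mon A) g (Comp (free_mon A) f h)) =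
        act (Het T) (g, onAr (stF c) (), onAr (stF c) (), h) (cmpt c (Cod (free_mon A) f, (), (), Dom (free_mon A) f) f))"
    (is "?nat \<longleftrightarrow> ?elem")
  proof
    assume ?nat
    then show ?elem
      using A by (auto simp: nat_trans_def shape_def hom_def)
  next
    assume ?elem
    then show ?nat
      using A by (auto simp: nat_trans_def shape_def hom_def)
  qed
  \<comment> \<open>Quantifying over the ends and an arrow between them is the same as quantifying
    over arrows. The predicate variable \<open>P\<close> turns this reindexing into a rewrite rule
    for the tensor clause.\<close>
  have tens_iff: "(\<forall>u \<in> Ob (free_mon A). \<forall>u' \<in> Ob (free_mon A). \<forall>b \<in> Ob (free_mon A). \<forall>b' \<in> Ob (free_mon A).
      \<forall>e \<in> hom (free_mon A) b u. \<forall>e' \<in> hom (free_mon A) b' u'. P u u' b b' e e') \<longleftrightarrow>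
    (\<forall>f \<in> Ar (free_mon A). \<forall>f' \<in> Ar (free_mon A).
      P (Cod (free_mon A) f) (Cod (free_mon A) f') (Dom (free_mon A) f) (Dom (free_mon A) f') f f')" for P
    using A by (auto simp: hom_def)
  show ?thesis
    unfolding two_cell_def is_cell_def iota_simps fun_iff nat_iff lists_Ob
    by (simp add: Let_def is_functor_idF terminal_cat_def UNIV_unit tens_iff cong: conj_cong)
qed

section \<open>Associator and unitors on representatives\<close>

text \<open>Two independences are involved. A slide over the list \<open>b\<close> inside the inner
  class becomes an outer slide on the other side of the associator, and a slide over the outer list
  \<open>c\<close> becomes an inner one.\<close>

lemma assoc_cell_tcls:
  assumes "het_pair R S" "het_pair S T"
    and objs: "u \<in> Ob (free_mon (Src R))" "q \<in> Ob (St R)" "q' \<in> Ob (St R)" "p \<in> Ob (St S)" "p' \<in> Ob (St S)"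
      "r \<in> Ob (St T)" "r' \<in> Ob (St T)" "w \<in> Ob (free_mon (Tgt T))" "b \<in> Ob (free_mon (Tgt R))" "c \<in> Ob (free_mon (Tgt S))"
    and e: "e \<in> val (Het R) (u, q, q', b)" and f: "f \<in> val (Het S) (b, p, p', c)" and g: "g \<in> val (Het T) (c, r, r', w)"
  shows "cmpt (assoc_cell R S T) (u, ((q, p), r), ((q', p'), r'), w)
      (tcls (tcomp R S) T (u, ((q, p), r), ((q', p'), r'), w) (c, tcls R S (u, (q, p), (q', p'), c) (b, e, f), g)) =
    tcls R (tcomp S T) (u, (q, p, r), (q', p', r'), w) (b, e, tcls S T (b, (p, r), (p', r'), w) (c, f, g))"
proof -
  interpret RS: het_pair R S by fact
  interpret ST: het_pair S T by fact
  interpret RS_T: het_pair "tcomp R S" T by unfold_locales simp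
  interpret R_ST: het_pair R "tcomp S T" by unfold_locales simp
  let ?\<Phi> = "\<lambda>c (b, e, f) g. tcls R (tcomp S T) (u, (q, p, r), (q', p', r'), w) (b, e, tcls S T (b, (p, r), (p', r'), w) (c, f, g))"
  have inner: "(\<Union>x \<in> tcls R S (u, (q, p), (q', p'), c) y. ?\<Phi> c x g) = ?\<Phi> c y g"
    if c: "c \<in> Ob (free_mon (Tgt S))" and g: "g \<in> val (Het T) (c, r, r', w)" for y c g
  proof (rule RS.UN_tcls, rule RS.cowedgeI)
    fix h b b' e f
    assume b: "b \<in> Ob (free_mon (Tgt R))" "b' \<in> Ob (free_mon (Tgt R))" and h: "h \<in> hom (free_mon (Tgt R)) b b'"
      and e: "e \<in> val (Het R) (u, q, q', b')" and f: "f \<in> val (Het S) (b, p, p', c)"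
    \<comment> \<open>Sliding \<open>h\<close> away from \<open>e\<close> lets it act on the class
      of \<open>(c, f, g)\<close>; by \<open>act_tcls\<close> this gives the class of
      \<open>(c, h f, g)\<close>, since \<open>h\<close> reaches only the first factor and
      \<open>g\<close> is acted on by identities.\<close>
    show "?\<Phi> c (b, act (Het R) (Ident (free_mon (Src R)) u, Ident (St R) q, Ident (St R) q', h) e, f) g =
        ?\<Phi> c (b', e, act (Het S) (h, Ident (St S) p, Ident (St S) p', Ident (free_mon (Tgt S)) c) f) g"
      using R_ST.tcls_slide[OF h e ST.tcls_val[OF c f g]] objs(1-8) c h
        ST.act_tcls[OF f g c, where f = h and u' = b' and h = "Ident (free_mon (Tgt T)) w" and w' = w
          and k = "Ident (St S) p" and r = p and k' = "Ident (St S) p'" and r' = p'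
          and l = "Ident (St T) r" and s = r and l' = "Ident (St T) r'" and s' = r'] ST.T.act_ident[OF g]
      by simp
  qed (use objs c in simp_all)
  have "(\<Union>(c, L, g) \<in> tcls (tcomp R S) T (u, ((q, p), r), ((q', p'), r'), w) (c, tcls R S (u, (q, p), (q', p'), c) (b, e, f), g).
      \<Union>x \<in> L. ?\<Phi> c x g) =
    (case (c, tcls R S (u, (q, p), (q', p'), c) (b, e, f), g) of (c, L, g) \<Rightarrow> \<Union>x \<in> L. ?\<Phi> c x g)"
  proof (rule RS_T.UN_tcls, rule RS_T.cowedgeI)
    fix h c c' L g
    assume c': "c \<in> Ob (free_mon (Tgt (tcomp R S)))" "c' \<in> Ob (free_mon (Tgt (tcomp R S)))"
      and h': "h \<in> hom (free_mon (Tgt (tcomp R S))) c c'"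
      and L: "L \<in> val (Het (tcomp R S)) (u, (q, p), (q', p'), c')" and g: "g \<in> val (Het T) (c, r, r', w)"
    have c: "c \<in> Ob (free_mon (Tgt S))" "c' \<in> Ob (free_mon (Tgt S))" and h: "h \<in> hom (free_mon (Tgt S)) c c'"
      using c' h' by simp_all
    have hg: "act (Het T) (h, Ident (St T) r, Ident (St T) r', Ident (free_mon (Tgt T)) w) g \<in> val (Het T) (c', r, r', w)"
      by (rule ST.T.act_val[OF g]) (use objs h in simp_all)
    from L obtain b e f where b: "b \<in> Ob (free_mon (Tgt R))" and e: "e \<in> val (Het R) (u, q, q', b)"
      and f: "f \<in> val (Het S) (b, p, p', c')" and L_eq: "L = tcls R S (u, (q, p), (q', p'), c') (b, e, f)"
      by (rule RS.val_tcomp_cases)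
    \<comment> \<open>Here \<open>h\<close> is a morphism in the target variable of the composite,
      so it changes only the \<open>S\<close>-component of a representative and leaves
      \<open>e\<close> fixed.\<close>
    have Lh: "act (Het (tcomp R S)) (Ident (free_mon (Src R)) u, (Ident (St R) q, Ident (St S) p), (Ident (St R) q', Ident (St S) p'), h) L =
        tcls R S (u, (q, p), (q', p'), c)
          (b, e, act (Het S) (Ident (free_mon (Tgt R)) b, Ident (St S) p, Ident (St S) p', h) f)"
      unfolding L_eq
      using RS.act_tcls[OF e f b, where f = "Ident (free_mon (Src R)) u" and u' = u and h = h and w' = c
          and k = "Ident (St R) q" and r = q and k' = "Ident (St R) q'" and r' = q'
          and l = "Ident (St S) p" and s = p and l' = "Ident (St S) p'" and s' = p'] RS.S.act_ident[OF e] objs b h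
      by simp
    show "(case (c, act (Het (tcomp R S)) (Ident (free_mon (Src (tcomp R S))) u,
            Ident (St (tcomp R S)) (q, p), Ident (St (tcomp R S)) (q', p'), h) L, g) of (c, L, g) \<Rightarrow> \<Union>x \<in> L. ?\<Phi> c x g) =
        (case (c', L, act (Het T) (h, Ident (St T) r, Ident (St T) r', Ident (free_mon (Tgt T)) w) g) of
          (c, L, g) \<Rightarrow> \<Union>x \<in> L. ?\<Phi> c x g)"
      \<comment> \<open>Once the inner unions are evaluated, the two sides differ by a slide over
        \<open>h\<close> in the class for \<open>S\<close> and \<open>T\<close>. \<open>Lh\<close>
        is applied while \<open>L\<close> is still folded, and only then is \<open>L\<close>
        replaced by its representative.\<close>
      using ST.tcls_slide[OF h f g] objs b
      by (simp add: Lh) (simp add: L_eq inner[OF c(1) g] inner[OF c(2) hg])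
  qed (use objs in simp_all)
  also have "\<dots> = ?\<Phi> c (b, e, f) g"
    using inner[OF objs(10) g] by simp
  finally show ?thesis
    by (simp add: assoc_cell_def case_prod_unfold)
qed

section \<open>Endo-2-transducers: the laws of a monad on representatives\<close>

locale endo_tdx = lax_het T
  for T :: "('a, 'am, 'a, 'am, 'q, 'qm, 'e) tdx" +
  fixes A :: "('a, 'am) cat"
  assumes Src [simp]: "Src T = A" and Tgt [simp]: "Tgt T = A"

lemma endo_tdx_transducer: "transducer A A T \<Longrightarrow> endo_tdx T A"
  by (auto simp: transducer_def endo_tdx_def endo_tdx_axioms_def lax_het_def lax_het_axioms_def het_def)

sublocale endo_tdx \<subseteq> lax_pair T T
  by unfold_locales simp

context endo_tdx
begin

lemma category_A [simp]: "category A"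
  using category_Src by simp

text \<open>An element of the threefold composite is a class of \<open>(c, L, g)\<close> in which
  \<open>L\<close> is itself the class of some \<open>(b, e, f)\<close>. Evaluating both pastings at
  these doubly nested classes gives the equation for \<open>m\<close>, while equality of the state
  functors, on objects and on arrows, gives strict associativity.\<close>

lemma assoc_iff:
  assumes \<mu>: "two_cell (tcomp T T) T \<mu>"
  shows "cell_eq (tcomp (tcomp T T) T)
       (vcomp \<mu> (hcomp T T \<mu> id_cell)) (vcomp \<mu> (vcomp (hcomp T T id_cell \<mu>) (assoc_cell T T T))) \<longleftrightarrow>
    (let Q = St T; C = free_mon A; U = onOb (stF \<mu>); V = onAr (stF \<mu>);
       m = (\<lambda>u x y x' y' v b e e'. cmpt \<mu> (u, (x, x'), (y, y'), v) (tcls T T (u, (x, x'), (y, y'), v) (b, e, e')))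
     in (\<forall>x \<in> Ob Q. \<forall>y \<in> Ob Q. \<forall>z \<in> Ob Q. U (U (x, y), z) = U (x, U (y, z))) \<and>
     (\<forall>x \<in> Ar Q. \<forall>y \<in> Ar Q. \<forall>z \<in> Ar Q. V (V (x, y), z) = V (x, V (y, z))) \<and>
     (\<forall>u \<in> Ob C. \<forall>b \<in> Ob C. \<forall>c \<in> Ob C. \<forall>w \<in> Ob C. \<forall>x \<in> Ob Q. \<forall>y \<in> Ob Q. \<forall>z \<in> Ob Q. \<forall>x' \<in> Ob Q. \<forall>y' \<in> Ob Q. \<forall>z' \<in> Ob Q.
      \<forall>e \<in> val (Het T) (u, x, x', b). \<forall>f \<in> val (Het T) (b, y, y', c). \<forall>g \<in> val (Het T) (c, z, z', w).
        m u (U (x, y)) (U (x', y')) z z' w c (m u x x' y y' c b e f) g =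
        m u x x' (U (y, z)) (U (y', z')) w b e (m b y y' z z' w c f g)))"
    (is "cell_eq _ ?l ?r \<longleftrightarrow> ?elem")
proof -
  interpret TT_T: het_pair "tcomp T T" T by unfold_locales simp
  interpret T_TT: het_pair T "tcomp T T" by unfold_locales simp
  have lhs: "cmpt (vcomp \<mu> (hcomp T T \<mu> id_cell)) (u, ((x, y), z), ((x', y'), z'), w)
      (tcls (tcomp T T) T (u, ((x, y), z), ((x', y'), z'), w) (c, tcls T T (u, (x, y), (x', y'), c) (b, e, f), g)) =
    (let U = onOb (stF \<mu>) in cmpt \<mu> (u, (U (x, y), z), (U (x', y'), z'), w) (tcls T T (u, (U (x, y), z), (U (x', y'), z'), w)
      (c, cmpt \<mu> (u, (x, y), (x', y'), c) (tcls T T (u, (x, y), (x', y'), c) (b, e, f)), g)))"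
    if "u \<in> Ob (free_mon A)" "x \<in> Ob (St T)" "y \<in> Ob (St T)" "z \<in> Ob (St T)" "x' \<in> Ob (St T)" "y' \<in> Ob (St T)"
      "z' \<in> Ob (St T)" "w \<in> Ob (free_mon A)"
    for u x y z x' y' z' w c b e f g
    using hcomp_tcls[OF TT_T.het_pair_axioms het_pair_axioms \<mu> two_cell_id_cell] that by (simp add: Let_def)
  have rhs: "cmpt (vcomp \<mu> (vcomp (hcomp T T id_cell \<mu>) (assoc_cell T T T))) (u, ((x, y), z), ((x', y'), z'), w)
      (tcls (tcomp T T) T (u, ((x, y), z), ((x', y'), z'), w) (c, tcls T T (u, (x, y), (x', y'), c) (b, e, f), g)) =
    (let U = onOb (stF \<mu>) in cmpt \<mu> (u, (x, U (y, z)), (x', U (y', z')), w) (tcls T T (u, (x, U (y, z)), (x', U (y', z')), w)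
      (b, e, cmpt \<mu> (b, (y, z), (y', z'), w) (tcls T T (b, (y, z), (y', z'), w) (c, f, g)))))"
    if "u \<in> Ob (free_mon A)" "x \<in> Ob (St T)" "y \<in> Ob (St T)" "z \<in> Ob (St T)" "x' \<in> Ob (St T)" "y' \<in> Ob (St T)"
      "z' \<in> Ob (St T)" "w \<in> Ob (free_mon A)" "b \<in> Ob (free_mon A)" "c \<in> Ob (free_mon A)"
      "e \<in> val (Het T) (u, x, x', b)" "f \<in> val (Het T) (b, y, y', c)" "g \<in> val (Het T) (c, z, z', w)"
    for u x y z x' y' z' w c b e f g
    using hcomp_tcls[OF T_TT.het_pair_axioms het_pair_axioms two_cell_id_cell \<mu>]
      assoc_cell_tcls[OF het_pair_axioms het_pair_axioms, where u = u and q = x and p = y and r = z and q' = x' and p' = y' and r' = z'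
        and w = w and b = b and c = c and e = e and f = f and g = g] that
    \<comment> \<open>Only the state functor of the associator is unfolded, so that its component
      stays in the form to which \<open>assoc_cell_tcls\<close> applies.\<close>
    by (simp add: Let_def assoc_cell_def[THEN arg_cong[where f = stF]])
  have 1: "functor_eq (St (tcomp (tcomp T T) T)) (stF ?l) (stF ?r) \<longleftrightarrow>
    (let Q = St T; U = onOb (stF \<mu>); V = onAr (stF \<mu>) in
     (\<forall>x \<in> Ob Q. \<forall>y \<in> Ob Q. \<forall>z \<in> Ob Q. U (U (x, y), z) = U (x, U (y, z))) \<and>
     (\<forall>x \<in> Ar Q. \<forall>y \<in> Ar Q. \<forall>z \<in> Ar Q. V (V (x, y), z) = V (x, V (y, z))))"
    by (auto simp: functor_eq_def Let_def assoc_cell_def)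
  have 2: "(\<forall>i \<in> Ob (shape (tcomp (tcomp T T) T)). \<forall>K \<in> val (Het (tcomp (tcomp T T) T)) i. cmpt ?l i K = cmpt ?r i K) \<longleftrightarrow>
    (\<forall>u \<in> Ob (free_mon A). \<forall>b \<in> Ob (free_mon A). \<forall>c \<in> Ob (free_mon A). \<forall>w \<in> Ob (free_mon A).
     \<forall>x \<in> Ob (St T). \<forall>y \<in> Ob (St T). \<forall>z \<in> Ob (St T). \<forall>x' \<in> Ob (St T). \<forall>y' \<in> Ob (St T). \<forall>z' \<in> Ob (St T).
     \<forall>e \<in> val (Het T) (u, x, x', b). \<forall>f \<in> val (Het T) (b, y, y', c). \<forall>g \<in> val (Het T) (c, z, z', w).
      let i = (u, ((x, y), z), ((x', y'), z'), w); K = tcls (tcomp T T) T i (c, tcls T T (u, (x, y), (x', y'), c) (b, e, f), g)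
      in cmpt ?l i K = cmpt ?r i K)" (is "?a \<longleftrightarrow> ?b")
  proof
    assume ?a
    show ?b
      unfolding Let_def
    proof (intro ballI)
      fix u b c w x y z x' y' z' e f g
      assume *: "u \<in> Ob (free_mon A)" "b \<in> Ob (free_mon A)" "c \<in> Ob (free_mon A)" "w \<in> Ob (free_mon A)"
        "x \<in> Ob (St T)" "y \<in> Ob (St T)" "z \<in> Ob (St T)" "x' \<in> Ob (St T)" "y' \<in> Ob (St T)" "z' \<in> Ob (St T)"
        "e \<in> val (Het T) (u, x, x', b)" "f \<in> val (Het T) (b, y, y', c)" "g \<in> val (Het T) (c, z, z', w)"
      let ?i = "(u, ((x, y), z), ((x', y'), z'), w)"
      have "?i \<in> Ob (shape (tcomp (tcomp T T) T))"
        using * by (simp add: shape_def)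
      moreover have "tcls (tcomp T T) T ?i (c, tcls T T (u, (x, y), (x', y'), c) (b, e, f), g) \<in> val (Het (tcomp (tcomp T T) T)) ?i"
        using * by (intro TT_T.tcls_val tcls_val) simp_all
      ultimately show "cmpt ?l ?i (tcls (tcomp T T) T ?i (c, tcls T T (u, (x, y), (x', y'), c) (b, e, f), g)) =
        cmpt ?r ?i (tcls (tcomp T T) T ?i (c, tcls T T (u, (x, y), (x', y'), c) (b, e, f), g))"
        using \<open>?a\<close> by blast
    qed
  next
    assume b: ?b
    show ?a
    proof (intro ballI)
      fix i K assume i: "i \<in> Ob (shape (tcomp (tcomp T T) T))" and K: "K \<in> val (Het (tcomp (tcomp T T) T)) i"
      obtain u x y z x' y' z' w where i_eq: "i = (u, ((x, y), z), ((x', y'), z'), w)"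
        by (metis prod.exhaust)
      from K[unfolded i_eq] show "cmpt ?l i K = cmpt ?r i K"
      proof (cases rule: TT_T.val_tcomp_cases)
        case K: (1 c L g)
        from K(2) show ?thesis
        proof (cases rule: val_tcomp_cases)
          case L: (1 b e f)
          show ?thesis
            using b i K L by (simp add: i_eq shape_def Let_def)
        qed
      qed
    qed
  qed
  show ?thesis
    \<comment> \<open>The pasted cells must stay folded for \<open>lhs\<close> and
      \<open>rhs\<close> to match, hence the removal of \<open>vcomp_simps\<close>; the congruence
      rules provide the memberships that their premises ask for.\<close>
    unfolding cell_eq_def 1 2 by (simp add: Let_def lhs[unfolded Let_def Tgt tcomp_simps] rhs[unfolded Let_def Tgt tcomp_simps] del: vcomp_simps cong: ball_cong conj_cong)
qed

text \<open>The inverse unitor sends \<open>e\<close> to the class of an identity of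
  \<open>A*\<close> paired with \<open>e\<close>, so the law tests \<eta> at identities only. Its
  state part says that \<open>j\<close> is a strict left unit, on arrows in terms of
  \<open>Ident Q j\<close> because the state functor of \<eta> preserves identities.\<close>

lemma unit_src_iff:
  assumes \<mu>: "two_cell (tcomp T T) T \<mu>" and \<eta>: "two_cell (iota A) T \<eta>"
  shows "cell_eq T (vcomp \<mu> (vcomp (hcomp T T \<eta> id_cell) (inv_unitor_src T))) id_cell \<longleftrightarrow>
    (let Q = St T; C = free_mon A; j = onOb (stF \<eta>) ()
     in (\<forall>x \<in> Ob Q. onOb (stF \<mu>) (j, x) = x) \<and> (\<forall>k \<in> Ar Q. onAr (stF \<mu>) (Ident Q j, k) = k) \<and>
     (\<forall>u \<in> Ob C. \<forall>x \<in> Ob Q. \<forall>y \<in> Ob Q. \<forall>v \<in> Ob C. \<forall>e \<in> val (Het T) (u, x, y, v).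
        cmpt \<mu> (u, (j, x), (j, y), v) (tcls T T (u, (j, x), (j, y), v) (u, cmpt \<eta> (u, (), (), u) (Ident C u), e)) = e))"
proof -
  interpret I: het "iota A" by (rule het_iota) simp
  interpret IT: het_pair "iota A" T by unfold_locales simp
  have [simp]: "onAr (stF \<eta>) () = Ident (St T) (onOb (stF \<eta>) ())"
    using is_functor_D(5)[OF two_cell_functor[OF \<eta>], of "()"] by simp
  have "cmpt (vcomp \<mu> (vcomp (hcomp T T \<eta> id_cell) (inv_unitor_src T))) (u, x, y, v) e =
    (let j = onOb (stF \<eta>) () in
    cmpt \<mu> (u, (j, x), (j, y), v) (tcls T T (u, (j, x), (j, y), v) (u, cmpt \<eta> (u, (), (), u) (Ident (free_mon A) u), e)))"
    if "u \<in> Ob (free_mon A)" "x \<in> Ob (St T)" "y \<in> Ob (St T)" "v \<in> Ob (free_mon A)" for u x y v e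
    using hcomp_tcls[OF IT.het_pair_axioms het_pair_axioms \<eta> two_cell_id_cell] that
    by (simp add: Let_def inv_unitor_src_def)
  then show ?thesis
    by (simp add: cell_eq_def functor_eq_def shape_def inv_unitor_src_def Let_def del: vcomp_simps(2) cong: ball_cong conj_cong)
qed

lemma unit_tgt_iff:
  assumes \<mu>: "two_cell (tcomp T T) T \<mu>" and \<eta>: "two_cell (iota A) T \<eta>"
  shows "cell_eq T (vcomp \<mu> (vcomp (hcomp T T id_cell \<eta>) (inv_unitor_tgt T))) id_cell \<longleftrightarrow>
    (let Q = St T; C = free_mon A; j = onOb (stF \<eta>) ()
     in (\<forall>x \<in> Ob Q. onOb (stF \<mu>) (x, j) = x) \<and> (\<forall>k \<in> Ar Q. onAr (stF \<mu>) (k, Ident Q j) = k) \<and>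
     (\<forall>u \<in> Ob C. \<forall>x \<in> Ob Q. \<forall>y \<in> Ob Q. \<forall>v \<in> Ob C. \<forall>e \<in> val (Het T) (u, x, y, v).
        cmpt \<mu> (u, (x, j), (y, j), v) (tcls T T (u, (x, j), (y, j), v) (v, e, cmpt \<eta> (v, (), (), v) (Ident C v))) = e))"
proof -
  interpret I: het "iota A" by (rule het_iota) simp
  interpret TI: het_pair T "iota A" by unfold_locales simp
  have [simp]: "onAr (stF \<eta>) () = Ident (St T) (onOb (stF \<eta>) ())"
    using is_functor_D(5)[OF two_cell_functor[OF \<eta>], of "()"] by simp
  have "cmpt (vcomp \<mu> (vcomp (hcomp T T id_cell \<eta>) (inv_unitor_tgt T))) (u, x, y, v) e =
    (let j = onOb (stF \<eta>) () in
    cmpt \<mu> (u, (x, j), (y, j), v) (tcls T T (u, (x, j), (y, j), v) (v, e, cmpt \<eta> (v, (), (), v) (Ident (free_mon A) v))))"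
    if "u \<in> Ob (free_mon A)" "x \<in> Ob (St T)" "y \<in> Ob (St T)" "v \<in> Ob (free_mon A)" for u x y v e
    using hcomp_tcls[OF TI.het_pair_axioms het_pair_axioms two_cell_id_cell \<eta>] that
    by (simp add: Let_def inv_unitor_tgt_def)
  then show ?thesis
    by (simp add: cell_eq_def functor_eq_def shape_def inv_unitor_tgt_def Let_def del: vcomp_simps(2) cong: ball_cong conj_cong)
qed

end

section \<open>Monads and graded promonads\<close>

lemma is_functor_cong:
  assumes "category C" "functor_eq C F G"
  shows "is_functor C D F \<longleftrightarrow> is_functor C D G"
  using assms by (auto simp: is_functor_def functor_eq_def)

text \<open>Each law holds componentwise; reversing the arrows of the first component merely
  exchanges domain and codomain, which functoriality of \<open>bx\<close> respects.\<close>

lemma strict_monoidal_pointwise: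
  assumes "strict_monoidal Q bx j"
  shows "strict_monoidal (opc Q \<times>\<^sub>c Q) (pointwise_tensor bx) (j, j)"
  using assms unfolding strict_monoidal_def pointwise_tensor_def is_functor_def
  by simp

context endo_tdx
begin

text \<open>The index category differs from \<open>shape T\<close> only in the order and bracketing
  of its variables.\<close>

lemma set_functor_tdx_het:
  "set_functor ((opc (St T) \<times>\<^sub>c St T) \<times>\<^sub>c free_mon A \<times>\<^sub>c opc (free_mon A)) (tdx_het T)"
  using set_functor_Het
  by (simp add: set_functor_def tdx_het_def shape_def)

text \<open>Degrees are split into pairs of states and arrows of degrees into pairs of arrows, the
  first one reversed. The clauses thereby take the shape in which the conditions on \<eta> and \<mu>
  are later stated.\<close>

lemma tdx_graded_promonad_iff:
  "tdx_graded_promonad A T j bx un m \<longleftrightarrow>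
    (let C = free_mon A; Q = St T; X = Het T in
    strict_monoidal Q bx j \<and>
    (\<forall>f \<in> Ar C. un f \<in> val X (Cod C f, j, j, Dom C f)) \<and>
    (\<forall>h \<in> Ar C. \<forall>f \<in> Ar C. \<forall>g \<in> Ar C. Cod C h = Dom C f \<and> Cod C f = Dom C g \<longrightarrow>
      act X (g, Ident Q j, Ident Q j, h) (un f) = un (Comp C g (Comp C f h))) \<and>
    (\<forall>x \<in> Ob Q. \<forall>y \<in> Ob Q. \<forall>x' \<in> Ob Q. \<forall>y' \<in> Ob Q. \<forall>u \<in> Ob C. \<forall>a \<in> Ob C. \<forall>v \<in> Ob C.
      \<forall>e \<in> val X (u, x, y, a). \<forall>e' \<in> val X (a, x', y', v).
        m (x, y) (x', y') u a v e e' \<in> val X (u, onOb bx (x, x'), onOb bx (y, y'), v)) \<and>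
    (\<forall>k \<in> Ar Q. \<forall>l \<in> Ar Q. \<forall>k' \<in> Ar Q. \<forall>l' \<in> Ar Q. \<forall>f \<in> Ar C. \<forall>a \<in> Ob C. \<forall>h \<in> Ar C.
      \<forall>e \<in> val X (Dom C f, Cod Q k, Dom Q l, a). \<forall>e' \<in> val X (a, Cod Q k', Dom Q l', Cod C h).
        m (Dom Q k, Cod Q l) (Dom Q k', Cod Q l') (Cod C f) a (Dom C h)
          (act X (f, k, l, Ident C a) e) (act X (Ident C a, k', l', h) e') =
        act X (f, onAr bx (k, k'), onAr bx (l, l'), h)
          (m (Cod Q k, Dom Q l) (Cod Q k', Dom Q l') (Dom C f) a (Cod C h) e e')) \<and>
    (\<forall>x \<in> Ob Q. \<forall>y \<in> Ob Q. \<forall>x' \<in> Ob Q. \<forall>y' \<in> Ob Q. \<forall>u \<in> Ob C. \<forall>g \<in> Ar C. \<forall>v \<in> Ob C.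
      \<forall>e \<in> val X (u, x, y, Cod C g). \<forall>e' \<in> val X (Dom C g, x', y', v).
        m (x, y) (x', y') u (Dom C g) v (act X (Ident C u, Ident Q x, Ident Q y, g) e) e' =
        m (x, y) (x', y') u (Cod C g) v e (act X (g, Ident Q x', Ident Q y', Ident C v) e')) \<and>
    (\<forall>x \<in> Ob Q. \<forall>y \<in> Ob Q. \<forall>x' \<in> Ob Q. \<forall>y' \<in> Ob Q. \<forall>x'' \<in> Ob Q. \<forall>y'' \<in> Ob Q.
      \<forall>u \<in> Ob C. \<forall>a \<in> Ob C. \<forall>v \<in> Ob C. \<forall>w \<in> Ob C.
      \<forall>e \<in> val X (u, x, y, a). \<forall>e' \<in> val X (a, x', y', v). \<forall>e'' \<in> val X (v, x'', y'', w).
        m (onOb bx (x, x'), onOb bx (y, y')) (x'', y'') u v w (m (x, y) (x', y') u a v e e') e'' =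
        m (x, y) (onOb bx (x', x''), onOb bx (y', y'')) u a w e (m (x', y') (x'', y'') a v w e' e'')) \<and>
    (\<forall>x \<in> Ob Q. \<forall>y \<in> Ob Q. \<forall>f \<in> Ar C. \<forall>v \<in> Ob C. \<forall>e \<in> val X (Dom C f, x, y, v).
      m (j, j) (x, y) (Cod C f) (Dom C f) v (un f) e = act X (f, Ident Q x, Ident Q y, Ident C v) e) \<and>
    (\<forall>x \<in> Ob Q. \<forall>y \<in> Ob Q. \<forall>u \<in> Ob C. \<forall>f \<in> Ar C. \<forall>e \<in> val X (u, x, y, Cod C f).
      m (x, y) (j, j) u (Cod C f) (Dom C f) e (un f) = act X (Ident C u, Ident Q x, Ident Q y, f) e))"
proof (cases "strict_monoidal (St T) bx j")
  case True
  then have "strict_monoidal (opc (St T) \<times>\<^sub>c St T) (pointwise_tensor bx) (j, j)"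
    by (rule strict_monoidal_pointwise)
  with True show ?thesis
    unfolding tdx_graded_promonad_def graded_promonad_def Let_def using set_functor_tdx_het
    by (simp add: tdx_het_def pointwise_tensor_def)
qed (simp add: tdx_graded_promonad_def)

lemma act_val_left:
  assumes "f \<in> Ar (free_mon A)" "k \<in> Ar (St T)" "l \<in> Ar (St T)" "b \<in> Ob (free_mon A)"
    "e \<in> val (Het T) (Dom (free_mon A) f, Cod (St T) k, Dom (St T) l, b)"
  shows "act (Het T) (f, k, l, Ident (free_mon A) b) e \<in> val (Het T) (Cod (free_mon A) f, Dom (St T) k, Cod (St T) l, b)"
  using assms by (auto intro!: act_val[OF assms(5)])

lemma act_val_right:
  assumes "b \<in> Ob (free_mon A)" "k \<in> Ar (St T)" "l \<in> Ar (St T)" "h \<in> Ar (free_mon A)"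
    "e \<in> val (Het T) (b, Cod (St T) k, Dom (St T) l, Cod (free_mon A) h)"
  shows "act (Het T) (Ident (free_mon A) b, k, l, h) e \<in> val (Het T) (b, Dom (St T) k, Cod (St T) l, Dom (free_mon A) h)"
  using assms by (auto intro!: act_val[OF assms(5)])

section \<open>Translation of the axioms along \<open>corresponds\<close>\<close>

context
  fixes \<eta> :: "('a, 'am, 'q, 'qm, 'e) unit_cell" and \<mu> :: "('a, 'q, 'qm, 'e) mult_cell" and j bx un m
  assumes corr: "corresponds A T \<eta> \<mu> j bx un m"
    and onAr_\<eta>: "onAr (stF \<eta>) () = Ident (St T) j"
begin

lemma stF_\<eta>: "onOb (stF \<eta>) () = j"
  using corr by (simp add: corresponds_def Let_def)

lemma stF_\<mu>:
  "x \<in> Ob (St T) \<Longrightarrow> y \<in> Ob (St T) \<Longrightarrow> onOb (stF \<mu>) (x, y) = onOb bx (x, y)"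
  "k \<in> Ar (St T) \<Longrightarrow> l \<in> Ar (St T) \<Longrightarrow> onAr (stF \<mu>) (k, l) = onAr bx (k, l)"
  using corr by (simp_all add: corresponds_def Let_def functor_eq_def)

lemma cmpt_\<eta>:
  "f \<in> Ar (free_mon A) \<Longrightarrow> cmpt \<eta> (Cod (free_mon A) f, (), (), Dom (free_mon A) f) f = un f"
  using corr by (simp add: corresponds_def Let_def)

text \<open>The class is spelled out over \<open>free_mon A\<close>, which is the form of
  \<open>tcls T T\<close> after simplification with \<open>Tgt\<close>, so that the equation can act
  as a rewrite rule.\<close>

lemma cmpt_\<mu>:
  assumes "u \<in> Ob (free_mon A)" "a \<in> Ob (free_mon A)" "v \<in> Ob (free_mon A)"
    "x \<in> Ob (St T)" "y \<in> Ob (St T)" "x' \<in> Ob (St T)" "y' \<in> Ob (St T)"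
    "e \<in> val (Het T) (u, x, y, a)" "e' \<in> val (Het T) (a, x', y', v)"
  shows "cmpt \<mu> (u, (x, x'), (y, y'), v) (coend_cls (free_mon A) (tcomp_int T T (u, (x, x'), (y, y'), v)) (a, e, e')) =
    m (x, y) (x', y') u a v e e'"
  using corr assms by (simp add: corresponds_def Let_def)

text \<open>\<open>corresponds\<close> fixes the state functor of \<eta> on the object only; its
  value on the arrow comes from the context assumption \<open>onAr_\<eta>\<close>.\<close>

lemma two_cell_\<eta>_iff:
  "two_cell (iota A) T \<eta> \<longleftrightarrow>
    (let C = free_mon A in
     j \<in> Ob (St T) \<and>
     (\<forall>f \<in> Ar C. un f \<in> val (Het T) (Cod C f, j, j, Dom C f)) \<and>
     (\<forall>h \<in> Ar C. \<forall>f \<in> Ar C. \<forall>g \<in> Ar C. Cod C h = Dom C f \<and> Cod C f = Dom C g \<longrightarrow>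
        act (Het T) (g, Ident (St T) j, Ident (St T) j, h) (un f) = un (Comp C g (Comp C f h))) \<and>
     (\<forall>f \<in> Ar C. \<forall>f' \<in> Ar C. un (f @ f') =
       Tens T (Cod C f, j, j, Dom C f) (Cod C f', j, j, Dom C f') (un f) (un f')) \<and>
     un [] = Unt T (Ident (St T) j))"
proof -
  \<comment> \<open>\<open>cmpt_\<eta>\<close> expects an index of the form \<open>Cod\<close>,
    \<open>Dom\<close> of its argument. For concatenations, the empty list and composites the index
    occurs in evaluated form, so these instances are prepared separately.\<close>
  have "cmpt \<eta> (Cod (free_mon A) f @ Cod (free_mon A) f', (), (), Dom (free_mon A) f @ Dom (free_mon A) f') (f @ f') = un (f @ f')"
    if "f \<in> Ar (free_mon A)" "f' \<in> Ar (free_mon A)" for f f'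
    using cmpt_\<eta>[of "f @ f'"] that by simp
  moreover have "cmpt \<eta> ([], (), (), []) [] = un []"
    using cmpt_\<eta>[of "[]"] by simp
  moreover have "cmpt \<eta> (Cod (free_mon A) g, (), (), Dom (free_mon A) h) (Comp (free_mon A) g (Comp (free_mon A) f h)) =
      un (Comp (free_mon A) g (Comp (free_mon A) f h))"
    if "f \<in> Ar (free_mon A)" "g \<in> Ar (free_mon A)" "h \<in> Ar (free_mon A)"
      "Cod (free_mon A) h = Dom (free_mon A) f \<and> Cod (free_mon A) f = Dom (free_mon A) g" for f g h
    using cmpt_\<eta>[of "Comp (free_mon A) g (Comp (free_mon A) f h)"] that by simp
  moreover have "cmpt \<eta> (Cod (free_mon A) f, (), (), Dom (free_mon A) f) f = un f" if "f \<in> Ar (free_mon A)" for f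
    using cmpt_\<eta> that .
  ultimately show ?thesis
    unfolding two_cell_iota_iff[OF category_A Src Tgt category_St] Let_def stF_\<eta> onAr_\<eta>
    by (auto simp: eq_commute)
qed

text \<open>Every value of \<mu> in the characterization of cells out of \<open>tcomp T T\<close> is
  taken at a class, so \<open>cmpt_\<mu>\<close> replaces it by \<open>m\<close>. The membership
  rules show that acted, tensored and unit elements are legitimate arguments.\<close>

lemma two_cell_\<mu>_iff:
  "two_cell (tcomp T T) T \<mu> \<longleftrightarrow>
    (let C = free_mon A; Q = St T; X = Het T in
     is_functor (Q \<times>\<^sub>c Q) Q bx \<and>
     (\<forall>u \<in> Ob C. \<forall>a \<in> Ob C. \<forall>v \<in> Ob C. \<forall>x \<in> Ob Q. \<forall>y \<in> Ob Q. \<forall>x' \<in> Ob Q. \<forall>y' \<in> Ob Q.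
      \<forall>e \<in> val X (u, x, y, a). \<forall>e' \<in> val X (a, x', y', v).
        m (x, y) (x', y') u a v e e' \<in> val X (u, onOb bx (x, x'), onOb bx (y, y'), v)) \<and>
     (\<forall>f \<in> Ar C. \<forall>k \<in> Ar Q. \<forall>l \<in> Ar Q. \<forall>k' \<in> Ar Q. \<forall>l' \<in> Ar Q. \<forall>h \<in> Ar C. \<forall>a \<in> Ob C.
      \<forall>e \<in> val X (Dom C f, Cod Q k, Dom Q l, a). \<forall>e' \<in> val X (a, Cod Q k', Dom Q l', Cod C h).
        m (Dom Q k, Cod Q l) (Dom Q k', Cod Q l') (Cod C f) a (Dom C h)
          (act X (f, k, l, Ident C a) e) (act X (Ident C a, k', l', h) e') =
        act X (f, onAr bx (k, k'), onAr bx (l, l'), h)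
          (m (Cod Q k, Dom Q l) (Cod Q k', Dom Q l') (Dom C f) a (Cod C h) e e')) \<and>
     (\<forall>u1 \<in> Ob C. \<forall>u2 \<in> Ob C. \<forall>a1 \<in> Ob C. \<forall>a2 \<in> Ob C. \<forall>v1 \<in> Ob C. \<forall>v2 \<in> Ob C.
      \<forall>x \<in> Ob Q. \<forall>y \<in> Ob Q. \<forall>z \<in> Ob Q. \<forall>x' \<in> Ob Q. \<forall>y' \<in> Ob Q. \<forall>z' \<in> Ob Q.
      \<forall>e1 \<in> val X (u1, x, y, a1). \<forall>e1' \<in> val X (a1, x', y', v1).
      \<forall>e2 \<in> val X (u2, y, z, a2). \<forall>e2' \<in> val X (a2, y', z', v2).
        m (x, z) (x', z') (u1 @ u2) (a1 @ a2) (v1 @ v2)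
          (Tens T (u1, x, y, a1) (u2, y, z, a2) e1 e2) (Tens T (a1, x', y', v1) (a2, y', z', v2) e1' e2')
        = Tens T (u1, onOb bx (x, x'), onOb bx (y, y'), v1) (u2, onOb bx (y, y'), onOb bx (z, z'), v2)
            (m (x, y) (x', y') u1 a1 v1 e1 e1') (m (y, z) (y', z') u2 a2 v2 e2 e2')) \<and>
     (\<forall>h \<in> Ar Q. \<forall>h' \<in> Ar Q.
        m (Dom Q h, Cod Q h) (Dom Q h', Cod Q h') [] [] [] (Unt T h) (Unt T h') = Unt T (onAr bx (h, h'))))"
proof -
  have functor_iff: "is_functor (St T \<times>\<^sub>c St T) (St T) (stF \<mu>) \<longleftrightarrow> is_functor (St T \<times>\<^sub>c St T) (St T) bx"
    using corr by (intro is_functor_cong) (auto simp: corresponds_def Let_def functor_eq_def)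
  show ?thesis
    unfolding two_cell_tcomp_iff[OF refl Tgt[THEN trans, OF Tgt[symmetric]]] Let_def functor_iff
    by (simp add: cmpt_\<mu> stF_\<mu> act_val_left act_val_right tens_val unt_val cong: ball_cong conj_cong)
qed

text \<open>The two pairs of arguments are the ends of a slide and have the same class, and
  \<open>m\<close> is the value of \<mu> on that class. This yields the cowedge axiom of the graded
  promonad.\<close>

lemma m_dinat:
  assumes "x \<in> Ob (St T)" "y \<in> Ob (St T)" "x' \<in> Ob (St T)" "y' \<in> Ob (St T)"
    "u \<in> Ob (free_mon A)" "g \<in> Ar (free_mon A)" "v \<in> Ob (free_mon A)"
    "e \<in> val (Het T) (u, x, y, Cod (free_mon A) g)" "e' \<in> val (Het T) (Dom (free_mon A) g, x', y', v)"
  shows "m (x, y) (x', y') u (Dom (free_mon A) g) v (act (Het T) (Ident (free_mon A) u, Ident (St T) x, Ident (St T) y, g) e) e' =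
    m (x, y) (x', y') u (Cod (free_mon A) g) v e (act (Het T) (g, Ident (St T) x', Ident (St T) y', Ident (free_mon A) v) e')"
proof -
  have "tcls T T (u, (x, x'), (y, y'), v)
      (Dom (free_mon A) g, act (Het T) (Ident (free_mon A) u, Ident (St T) x, Ident (St T) y, g) e, e') =
    tcls T T (u, (x, x'), (y, y'), v)
      (Cod (free_mon A) g, e, act (Het T) (g, Ident (St T) x', Ident (St T) y', Ident (free_mon A) v) e')"
    using tcls_slide[of g "Dom (free_mon A) g" "Cod (free_mon A) g" e u x y e' x' y' v] assms by simp
  then show ?thesis
    using assms by (simp add: cmpt_\<mu>[symmetric] act_val[OF assms(8)] act_val[OF assms(9)])
qed

text \<open>The state parts of the three cell equations, with functoriality of \<open>bx\<close> and
  \<open>j\<close> being a state, assemble into strict monoidality; their components are the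
  associativity law for \<open>m\<close> and its unit laws at identities.\<close>

lemma monad_axioms_iff:
  assumes \<eta>: "two_cell (iota A) T \<eta>" and \<mu>: "two_cell (tcomp T T) T \<mu>"
  shows "cell_eq (tcomp (tcomp T T) T)
       (vcomp \<mu> (hcomp T T \<mu> id_cell)) (vcomp \<mu> (vcomp (hcomp T T id_cell \<mu>) (assoc_cell T T T))) \<and>
     cell_eq T (vcomp \<mu> (vcomp (hcomp T T \<eta> id_cell) (inv_unitor_src T))) id_cell \<and>
     cell_eq T (vcomp \<mu> (vcomp (hcomp T T id_cell \<eta>) (inv_unitor_tgt T))) id_cell \<longleftrightarrow>
    (let C = free_mon A; Q = St T; X = Het T in
     strict_monoidal Q bx j \<and>
     (\<forall>u \<in> Ob C. \<forall>a \<in> Ob C. \<forall>v \<in> Ob C. \<forall>w \<in> Ob C.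
      \<forall>x \<in> Ob Q. \<forall>x' \<in> Ob Q. \<forall>x'' \<in> Ob Q. \<forall>y \<in> Ob Q. \<forall>y' \<in> Ob Q. \<forall>y'' \<in> Ob Q.
      \<forall>e \<in> val X (u, x, y, a). \<forall>e' \<in> val X (a, x', y', v). \<forall>e'' \<in> val X (v, x'', y'', w).
        m (onOb bx (x, x'), onOb bx (y, y')) (x'', y'') u v w (m (x, y) (x', y') u a v e e') e'' =
        m (x, y) (onOb bx (x', x''), onOb bx (y', y'')) u a w e (m (x', y') (x'', y'') a v w e' e'')) \<and>
     (\<forall>u \<in> Ob C. \<forall>x \<in> Ob Q. \<forall>y \<in> Ob Q. \<forall>v \<in> Ob C. \<forall>e \<in> val X (u, x, y, v).
      m (j, j) (x, y) u u v (un (Ident C u)) e = e) \<and>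
     (\<forall>u \<in> Ob C. \<forall>x \<in> Ob Q. \<forall>y \<in> Ob Q. \<forall>v \<in> Ob C. \<forall>e \<in> val X (u, x, y, v).
      m (x, y) (j, j) u v v e (un (Ident C v)) = e))"
proof -
  note \<eta>' = \<eta>[unfolded two_cell_\<eta>_iff Let_def]
  note \<mu>' = \<mu>[unfolded two_cell_\<mu>_iff Let_def]
  have j: "j \<in> Ob (St T)" and un_val: "\<And>f. f \<in> Ar (free_mon A) \<Longrightarrow> un f \<in> val (Het T) (Cod (free_mon A) f, j, j, Dom (free_mon A) f)"
    using \<eta>' by blast+
  have un_ident: "un (Ident (free_mon A) u) \<in> val (Het T) (u, j, j, u)"
    and cmpt_ident: "cmpt \<eta> (u, (), (), u) (Ident (free_mon A) u) = un (Ident (free_mon A) u)" if "u \<in> Ob (free_mon A)" for u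
    using that un_val[of "Ident (free_mon A) u"] cmpt_\<eta>[of "Ident (free_mon A) u"] by simp_all
  have bx_functor: "is_functor (St T \<times>\<^sub>c St T) (St T) bx"
    using \<mu>' by blast
  note bx = is_functor_D(1,2)[OF bx_functor, of "(x, y)" for x y, simplified]
  have m_val: "m (x, y) (x', y') u a v e e' \<in> val (Het T) (u, onOb bx (x, x'), onOb bx (y, y'), v)"
    if "u \<in> Ob (free_mon A)" "a \<in> Ob (free_mon A)" "v \<in> Ob (free_mon A)"
      "x \<in> Ob (St T)" "y \<in> Ob (St T)" "x' \<in> Ob (St T)" "y' \<in> Ob (St T)"
      "e \<in> val (Het T) (u, x, y, a)" "e' \<in> val (Het T) (a, x', y', v)" for x y x' y' u a v e e'
    using \<mu>'[THEN conjunct2, THEN conjunct1] that by blast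
  show ?thesis
    \<comment> \<open>\<open>strict_monoidal\<close> states the left and right unit laws under a
      common quantifier, whereas they arise from two separate cell equations; distributing
      quantifiers over conjunctions brings the two sides together.\<close>
    unfolding assoc_iff[OF \<mu>] unit_src_iff[OF \<mu> \<eta>] unit_tgt_iff[OF \<mu> \<eta>] Let_def strict_monoidal_def stF_\<eta>
    by (simp add: bx_functor j bx stF_\<mu> cmpt_\<mu> m_val un_ident cmpt_ident cong: ball_cong conj_cong)
      (simp only: ball_conj_distrib conj_ac)
qed

lemma tdx_monad_iff:
  assumes T: "transducer A A T"
  shows "tdx_monad A T \<eta> \<mu> \<longleftrightarrow> tdx_graded_promonad A T j bx un m \<and> concat_compatible A T j bx un m"
proof
  assume "tdx_monad A T \<eta> \<mu>"
  then have \<eta>: "two_cell (iota A) T \<eta>" and \<mu>: "two_cell (tcomp T T) T \<mu>"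
    and eqs: "cell_eq (tcomp (tcomp T T) T)
       (vcomp \<mu> (hcomp T T \<mu> id_cell)) (vcomp \<mu> (vcomp (hcomp T T id_cell \<mu>) (assoc_cell T T T)))"
     "cell_eq T (vcomp \<mu> (vcomp (hcomp T T \<eta> id_cell) (inv_unitor_src T))) id_cell"
     "cell_eq T (vcomp \<mu> (vcomp (hcomp T T id_cell \<eta>) (inv_unitor_tgt T))) id_cell"
    unfolding tdx_monad_def by blast+
  note \<eta>' = \<eta>[unfolded two_cell_\<eta>_iff Let_def]
  note \<mu>' = \<mu>[unfolded two_cell_\<mu>_iff Let_def]
  note eqs' = monad_axioms_iff[OF \<eta> \<mu>, THEN iffD1, unfolded Let_def, OF conjI[OF eqs(1) conjI[OF eqs(2,3)]]]
  have monoidal: "strict_monoidal (St T) bx j"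
    using eqs' by blast
  \<comment> \<open>Naturality of \<open>m\<close> at identity degrees produces
    \<open>onAr bx\<close> of two identities; this and \<open>bx_j\<close> reduce it to the identity
    of the original state.\<close>
  have bx_ident: "onAr bx (Ident (St T) x, Ident (St T) y) = Ident (St T) (onOb bx (x, y))"
    if "x \<in> Ob (St T)" "y \<in> Ob (St T)" for x y
    using monoidal that is_functor_D(5)[of "St T \<times>\<^sub>c St T" "St T" bx "(x, y)"] by (auto simp: strict_monoidal_def)
  have j: "j \<in> Ob (St T)"
    using monoidal by (simp add: strict_monoidal_def)
  have bx_j: "onOb bx (j, x) = x" "onOb bx (x, j) = x" if "x \<in> Ob (St T)" for x
    using monoidal that by (simp_all add: strict_monoidal_def)
  note un_val = \<eta>'[THEN conjunct2, THEN conjunct1, rule_format]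
    and un_nat = \<eta>'[THEN conjunct2, THEN conjunct2, THEN conjunct1, rule_format]
    and un_append = \<eta>'[THEN conjunct2, THEN conjunct2, THEN conjunct2, THEN conjunct1, rule_format]
    and un_Nil = \<eta>'[THEN conjunct2, THEN conjunct2, THEN conjunct2, THEN conjunct2]
    and m_val = \<mu>'[THEN conjunct2, THEN conjunct1, rule_format]
    and m_nat = \<mu>'[THEN conjunct2, THEN conjunct2, THEN conjunct1, rule_format]
    and m_tens = \<mu>'[THEN conjunct2, THEN conjunct2, THEN conjunct2, THEN conjunct1, rule_format]
    and m_unt = \<mu>'[THEN conjunct2, THEN conjunct2, THEN conjunct2, THEN conjunct2, rule_format]
    and m_assoc = eqs'[THEN conjunct2, THEN conjunct1, rule_format]
    and unit_src = eqs'[THEN conjunct2, THEN conjunct2, THEN conjunct1, rule_format]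
    and unit_tgt = eqs'[THEN conjunct2, THEN conjunct2, THEN conjunct2, rule_format]
  have src: "m (j, j) (x, y) (Cod (free_mon A) f) (Dom (free_mon A) f) v (un f) e =
      act (Het T) (f, Ident (St T) x, Ident (St T) y, Ident (free_mon A) v) e"
    if "x \<in> Ob (St T)" "y \<in> Ob (St T)" "f \<in> Ar (free_mon A)" "v \<in> Ob (free_mon A)"
      "e \<in> val (Het T) (Dom (free_mon A) f, x, y, v)" for x y f v e
  proof -
    \<comment> \<open>\<open>f\<close> acts covariantly on the identity of its domain;
      \<open>m_nat\<close> then takes this action outside the composition.\<close>
    have "un f = act (Het T) (f, Ident (St T) j, Ident (St T) j, Ident (free_mon A) (Dom (free_mon A) f)) (un (Ident (free_mon A) (Dom (free_mon A) f)))"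
      using un_nat[of "Ident (free_mon A) (Dom (free_mon A) f)" "Ident (free_mon A) (Dom (free_mon A) f)" f] that by simp
    then show ?thesis
      using m_nat[of f "Ident (St T) j" "Ident (St T) j" "Ident (St T) x" "Ident (St T) y" "Ident (free_mon A) v"
          "Dom (free_mon A) f" "un (Ident (free_mon A) (Dom (free_mon A) f))" e]
        un_val[of "Ident (free_mon A) (Dom (free_mon A) f)"] act_ident[OF that(5)] that j
      by (simp add: bx_ident bx_j unit_src)
  qed
  have tgt: "m (x, y) (j, j) u (Cod (free_mon A) f) (Dom (free_mon A) f) e (un f) =
      act (Het T) (Ident (free_mon A) u, Ident (St T) x, Ident (St T) y, f) e"
    if "x \<in> Ob (St T)" "y \<in> Ob (St T)" "u \<in> Ob (free_mon A)" "f \<in> Ar (free_mon A)"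
      "e \<in> val (Het T) (u, x, y, Cod (free_mon A) f)" for x y f u e
  proof -
    \<comment> \<open>On this side \<open>f\<close> acts contravariantly, so the identity is the one
      at its codomain.\<close>
    have "un f = act (Het T) (Ident (free_mon A) (Cod (free_mon A) f), Ident (St T) j, Ident (St T) j, f) (un (Ident (free_mon A) (Cod (free_mon A) f)))"
      using un_nat[of f "Ident (free_mon A) (Cod (free_mon A) f)" "Ident (free_mon A) (Cod (free_mon A) f)"] that by simp
    then show ?thesis
      using m_nat[of "Ident (free_mon A) u" "Ident (St T) x" "Ident (St T) y" "Ident (St T) j" "Ident (St T) j" f
          "Cod (free_mon A) f" e "un (Ident (free_mon A) (Cod (free_mon A) f))"]
        un_val[of "Ident (free_mon A) (Cod (free_mon A) f)"] act_ident[OF that(5)] that j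
      by (simp add: bx_ident bx_j unit_tgt)
  qed
  show "tdx_graded_promonad A T j bx un m \<and> concat_compatible A T j bx un m"
    unfolding tdx_graded_promonad_iff concat_compatible_def Let_def
    by (intro conjI ballI impI; (rule monoidal un_val un_nat un_append un_Nil m_val m_nat m_dinat m_assoc m_tens m_unt src tgt; assumption))
next
  assume rhs: "tdx_graded_promonad A T j bx un m \<and> concat_compatible A T j bx un m"
  note gr = rhs[THEN conjunct1, unfolded tdx_graded_promonad_iff Let_def]
    and cc = rhs[THEN conjunct2, unfolded concat_compatible_def Let_def]
  have monoidal: "strict_monoidal (St T) bx j"
    using gr by blast
  then have j: "j \<in> Ob (St T)" and bx_functor: "is_functor (St T \<times>\<^sub>c St T) (St T) bx"
    by (simp_all add: strict_monoidal_def)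
  note un_val = gr[THEN conjunct2, THEN conjunct1, rule_format]
    and un_nat = gr[THEN conjunct2, THEN conjunct2, THEN conjunct1, rule_format]
    and un_append = cc[THEN conjunct1, rule_format]
    and un_Nil = cc[THEN conjunct2, THEN conjunct1]
  have \<eta>: "two_cell (iota A) T \<eta>"
    unfolding two_cell_\<eta>_iff Let_def
    by (intro conjI ballI impI; (rule j un_val un_nat un_append un_Nil; assumption))
  note m_val = gr[THEN conjunct2, THEN conjunct2, THEN conjunct2, THEN conjunct1, rule_format]
    and m_nat = gr[THEN conjunct2, THEN conjunct2, THEN conjunct2, THEN conjunct2, THEN conjunct1, rule_format]
    and m_tens = cc[THEN conjunct2, THEN conjunct2, THEN conjunct1, rule_format]
    and m_unt = cc[THEN conjunct2, THEN conjunct2, THEN conjunct2, rule_format]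
  have \<mu>: "two_cell (tcomp T T) T \<mu>"
    unfolding two_cell_\<mu>_iff Let_def
    by (intro conjI ballI; (rule bx_functor m_val m_nat m_tens m_unt; assumption))
  note m_assoc = gr[THEN conjunct2, THEN conjunct2, THEN conjunct2, THEN conjunct2, THEN conjunct2, THEN conjunct2, THEN conjunct1, rule_format]
  \<comment> \<open>The unit laws of a graded promonad are specialized to identity arrows, where the
    action on the right-hand side is trivial.\<close>
  have src: "m (j, j) (x, y) u u v (un (Ident (free_mon A) u)) e = e"
    and tgt: "m (x, y) (j, j) u v v e (un (Ident (free_mon A) v)) = e"
    if "x \<in> Ob (St T)" "y \<in> Ob (St T)" "u \<in> Ob (free_mon A)" "v \<in> Ob (free_mon A)"
      "e \<in> val (Het T) (u, x, y, v)" for x y u v e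
    using gr[THEN conjunct2, THEN conjunct2, THEN conjunct2, THEN conjunct2, THEN conjunct2, THEN conjunct2, THEN conjunct2, THEN conjunct1,
        rule_format, of x y "Ident (free_mon A) u" v e]
      gr[THEN conjunct2, THEN conjunct2, THEN conjunct2, THEN conjunct2, THEN conjunct2, THEN conjunct2, THEN conjunct2, THEN conjunct2,
        rule_format, of x y u "Ident (free_mon A) v" e] that act_ident[OF that(5)]
    by simp_all
  have "cell_eq (tcomp (tcomp T T) T)
       (vcomp \<mu> (hcomp T T \<mu> id_cell)) (vcomp \<mu> (vcomp (hcomp T T id_cell \<mu>) (assoc_cell T T T))) \<and>
     cell_eq T (vcomp \<mu> (vcomp (hcomp T T \<eta> id_cell) (inv_unitor_src T))) id_cell \<and>
     cell_eq T (vcomp \<mu> (vcomp (hcomp T T id_cell \<eta>) (inv_unitor_tgt T))) id_cell"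
    unfolding monad_axioms_iff[OF \<eta> \<mu>] Let_def
    by (intro conjI ballI; (rule monoidal src tgt m_assoc; assumption))
  then show "tdx_monad A T \<eta> \<mu>"
    unfolding tdx_monad_def using T \<eta> \<mu> by simp
qed

end

section \<open>Reading data off cells and rebuilding cells from data\<close>

lemma onAr_unit_cell:
  assumes "two_cell (iota A) T \<eta>"
  shows "onAr (stF \<eta>) () = Ident (St T) (onOb (stF \<eta>) ())"
  using is_functor_D(5)[OF two_cell_functor[OF assms], of "()"] by simp

lemma corresponds_exists: "\<exists>j bx un m. corresponds A T \<eta> \<mu> j bx un m"
proof -
  have "corresponds A T \<eta> \<mu> (onOb (stF \<eta>) ()) (stF \<mu>)
    (\<lambda>f. cmpt \<eta> (Cod (free_mon A) f, (), (), Dom (free_mon A) f) f)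
    (\<lambda>(x, y) (x', y') u a v e e'. cmpt \<mu> (u, (x, x'), (y, y'), v) (tcls T T (u, (x, x'), (y, y'), v) (a, e, e')))"
    by (simp add: corresponds_def functor_eq_def)
  then show ?thesis
    by blast
qed

text \<open>Every element of the composite is a class, so \<mu> is determined by \<open>m\<close>,
  and every element of \<open>iota A\<close> is an arrow, so \<eta> is determined by
  \<open>un\<close>. The third assumption compares the state functors of the units on the arrow,
  about which \<open>corresponds\<close> is silent.\<close>

lemma corresponds_unique:
  assumes c: "corresponds A T \<eta> \<mu> j bx un m" and c': "corresponds A T \<eta>' \<mu>' j bx un m"
    and "onAr (stF \<eta>) () = onAr (stF \<eta>') ()"
  shows "cell_eq (iota A) \<eta>' \<eta>" "cell_eq (tcomp T T) \<mu>' \<mu>"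
proof -
  have "cmpt \<eta>' (u, (), (), a) f = cmpt \<eta> (u, (), (), a) f" if "f \<in> hom (free_mon A) a u" for u a f
    using c c' that by (auto simp: corresponds_def Let_def hom_def)
  then show "cell_eq (iota A) \<eta>' \<eta>"
    using c c' assms(3) by (auto simp: cell_eq_def functor_eq_def corresponds_def Let_def)
  have "cmpt \<mu>' i K = cmpt \<mu> i K" if i: "i \<in> Ob (shape (tcomp T T))" and K: "K \<in> val (Het (tcomp T T)) i" for i K
  proof -
    obtain u x x' y y' v where i_eq: "i = (u, (x, x'), (y, y'), v)"
      by (metis prod.exhaust)
    show ?thesis
      using K[unfolded i_eq]
    proof (cases rule: val_tcomp_cases)
      case (1 a e e')
      then show ?thesis
        using c c' i by (simp add: i_eq shape_def corresponds_def Let_def)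
    qed
  qed
  then show "cell_eq (tcomp T T) \<mu>' \<mu>"
    using c c' by (simp add: cell_eq_def functor_eq_def corresponds_def Let_def)
qed

text \<open>The cowedge axiom of the graded promonad is precisely the condition under which
  \<open>m\<close> descends to the coend. The component of \<eta> can ignore its index, as an arrow
  already determines its ends.\<close>

lemma corresponds_cells:
  assumes gr: "tdx_graded_promonad A T j bx un m"
  defines "\<eta> \<equiv> \<lparr>stF = \<lparr>onOb = (\<lambda>_. j), onAr = (\<lambda>_. Ident (St T) j)\<rparr>, cmpt = (\<lambda>_. un)\<rparr> :: ('a, 'am, 'q, 'qm, 'e) unit_cell"
    and "\<mu> \<equiv> \<lparr>stF = bx, cmpt = (\<lambda>(u, (x, x'), (y, y'), v). coend_desc (\<lambda>(a, e, e'). m (x, y) (x', y') u a v e e'))\<rparr>"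
  shows "corresponds A T \<eta> \<mu> j bx un m"
proof -
  note dinat = gr[unfolded tdx_graded_promonad_iff Let_def, THEN conjunct2, THEN conjunct2, THEN conjunct2, THEN conjunct2,
      THEN conjunct2, THEN conjunct1, rule_format]
  have "coend_desc (\<lambda>(a, e, e'). m (x, y) (x', y') u a v e e') (tcls T T (u, (x, x'), (y, y'), v) (a, e, e')) = m (x, y) (x', y') u a v e e'"
    if "u \<in> Ob (free_mon A)" "v \<in> Ob (free_mon A)" "x \<in> Ob (St T)" "y \<in> Ob (St T)" "x' \<in> Ob (St T)" "y' \<in> Ob (St T)"
    for u a v x y x' y' e e'
  proof (rule trans[OF coend_desc_tcls], rule cowedgeI)
    fix g b b' e f
    assume "g \<in> hom (free_mon (Tgt T)) b b'" "e \<in> val (Het T) (u, x, y, b')" "f \<in> val (Het T) (b, x', y', v)"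
    then show "(case (b, act (Het T) (Ident (free_mon (Src T)) u, Ident (St T) x, Ident (St T) y, g) e, f) of
          (a, e, e') \<Rightarrow> m (x, y) (x', y') u a v e e') =
        (case (b', e, act (Het T) (g, Ident (St T) x', Ident (St T) y', Ident (free_mon (Tgt T)) v) f) of
          (a, e, e') \<Rightarrow> m (x, y) (x', y') u a v e e')"
      using dinat[of x y x' y' u g v e f] that by (auto simp: hom_def)
  qed (use that in simp_all)
  then show ?thesis
    by (simp add: corresponds_def functor_eq_def \<eta>_def \<mu>_def)
qed

end

theorem theorem3p11:
  fixes A :: "('a, 'am) cat" and T :: "('a, 'am, 'a, 'am, 'q, 'qm, 'e) tdx"
  assumes "category A" and "transducer A A T"
  shows
    "(\<forall>\<eta> \<mu> j bx un m.
        tdx_monad A T \<eta> \<mu> \<and> corresponds A T \<eta> \<mu> j bx un m \<longrightarrow>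
          tdx_graded_promonad A T j bx un m \<and> concat_compatible A T j bx un m) \<and>
     (\<forall>\<eta> \<mu>. tdx_monad A T \<eta> \<mu> \<longrightarrow> (\<exists>j bx un m. corresponds A T \<eta> \<mu> j bx un m)) \<and>
     (\<forall>j bx un m.
        tdx_graded_promonad A T j bx un m \<and> concat_compatible A T j bx un m \<longrightarrow>
          (\<exists>\<eta> \<mu>. tdx_monad A T \<eta> \<mu> \<and> corresponds A T \<eta> \<mu> j bx un m \<and>
            (\<forall>\<eta>' \<mu>'. tdx_monad A T \<eta>' \<mu>' \<and> corresponds A T \<eta>' \<mu>' j bx un m \<longrightarrow>
               cell_eq (iota A) \<eta>' \<eta> \<and> cell_eq (tcomp T T) \<mu>' \<mu>)))"
proof -
  interpret endo_tdx T A
    using assms(2) by (rule endo_tdx_transducer)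
  \<comment> \<open>\<open>tdx_monad_iff\<close> and the uniqueness of \<eta> both require this
    value; for a monad it follows from functoriality of the state functor of \<eta>.\<close>
  have ident: "onAr (stF \<eta>) () = Ident (St T) j" if "tdx_monad A T \<eta> \<mu>" "corresponds A T \<eta> \<mu> j bx un m" for \<eta> \<mu> j bx un m
    using that onAr_unit_cell by (auto simp: tdx_monad_def corresponds_def Let_def)
  show ?thesis
  proof (intro conjI allI impI; (elim conjE)?)
    fix \<eta> \<mu> j bx un m
    assume monad: "tdx_monad A T \<eta> \<mu>" and corr: "corresponds A T \<eta> \<mu> j bx un m"
    then show "tdx_graded_promonad A T j bx un m" "concat_compatible A T j bx un m"
      using tdx_monad_iff[OF corr ident[OF monad corr] assms(2)] by simp_all
  next
    fix \<eta> \<mu>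
    show "\<exists>j bx un m. corresponds A T \<eta> \<mu> j bx un m"
      by (rule corresponds_exists)
  next
    fix j bx un m
    assume graded: "tdx_graded_promonad A T j bx un m" and concat: "concat_compatible A T j bx un m"
    define \<eta> :: "('a, 'am, 'q, 'qm, 'e) unit_cell" where
      "\<eta> = \<lparr>stF = \<lparr>onOb = (\<lambda>_. j), onAr = (\<lambda>_. Ident (St T) j)\<rparr>, cmpt = (\<lambda>_. un)\<rparr>"
    define \<mu> :: "('a, 'q, 'qm, 'e) mult_cell" where
      "\<mu> = \<lparr>stF = bx, cmpt = (\<lambda>(u, (x, x'), (y, y'), v). coend_desc (\<lambda>(a, e, e'). m (x, y) (x', y') u a v e e'))\<rparr>"
    have corr: "corresponds A T \<eta> \<mu> j bx un m"
      using corresponds_cells[OF graded] by (simp add: \<eta>_def \<mu>_def)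
    have \<eta>_ident: "onAr (stF \<eta>) () = Ident (St T) j"
      by (simp add: \<eta>_def)
    \<comment> \<open>The equivalence is read backwards: the rebuilt cells correspond to the given
      data, so they need not be checked against the cell axioms directly.\<close>
    have "tdx_monad A T \<eta> \<mu>"
      using tdx_monad_iff[OF corr \<eta>_ident assms(2)] graded concat by simp
    moreover have "cell_eq (iota A) \<eta>' \<eta> \<and> cell_eq (tcomp T T) \<mu>' \<mu>"
      if "tdx_monad A T \<eta>' \<mu>'" "corresponds A T \<eta>' \<mu>' j bx un m" for \<eta>' \<mu>'
      using corresponds_unique[OF corr that(2)] \<eta>_ident ident[OF that] by simp
    ultimately show "\<exists>\<eta> \<mu>. tdx_monad A T \<eta> \<mu> \<and> corresponds A T \<eta> \<mu> j bx un m \<and>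
        (\<forall>\<eta>' \<mu>'. tdx_monad A T \<eta>' \<mu>' \<and> corresponds A T \<eta>' \<mu>' j bx un m \<longrightarrow>
          cell_eq (iota A) \<eta>' \<eta> \<and> cell_eq (tcomp T T) \<mu>' \<mu>)"
      using corr by blast
  qed
qed

end
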